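(* Let $t\geq 5$ be an integer and let $G_t$ be any graph constructed as described in the context. Then for every edge $e\in E(G_t)$, the graph $G_t-e$ has an induced subgraph isomorphic to the cycle on $2t-2$ vertices.
   Context: Graphs are finite and simple; path length = number of edges. Territories. A territory is a pair $(T,B)$ where $T$ is a graph and $B$ an induced cycle in $T$; its perimeter is the length of $B$. Expansion (w.r.t. $t$): given a territory $(T',B')$, choose for some $k\geq0$ a stable set $\{x_1,\dots,x_k\}$ of $B'$, let $x_i^-,x_i^+$ be the neighbours of $x_i$ in $B'$, and choose $I\subseteq\{1,\dots,k\}$. Build $T$ from $T'$: for each $i$ add a new path $P_i$ of length $2t-6$ with ends $y_i^-,y_i^+$ and middle vertex $y_i$, and edges $x_i^-y_i^-,x_iy_i,x_i^+y_i^+$; for each $i\in I$, with $v_i^-,v_i^+$ the neighbours of $y_i$ in $P_i$ ($v_i^-$ on the side of $y_i^-$), add a new path $Q_i$ of length $t-4$ with ends $z_i^-,z_i^+$ and edges $v_i^-z_i^-,v_i^+z_i^+$ (all new vertices distinct). For $i\notin I$, $R_i=x_i^-\text{-}y_i^-\text{-}P_i\text{-}y_i^+\text{-}x_i^+$; for $i\in I$, $R_i$ goes $x_i^-,y_i^-$, along $P_i$ to $v_i^-$, $z_i^-$, along $Q_i$ to $z_i^+$, $v_i^+$, along $P_i$ to $y_i^+$, $x_i^+$. Set $B=(B'\setminus\{x_1,\dots,x_k\})\cup\bigcup_iR_i$; $(T,B)$ is an expansion of $(T',B')$. The territories $(T_m,B_m)$: $T_0=B_0$ is a $t$-cycle;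 for $m\ge1$, with $N=t(t-3)^{m-1}$ and $B_{m-1}=x_1\text{-}\cdots\text{-}x_N\text{-}x_1$, $T_m$ is obtained from $T_{m-1}$ by adding a new cycle $B_m$, the $(t-4)$-subdivision of an $N$-cycle $x_1'\text{-}\cdots\text{-}x_N'\text{-}x_1'$ (each edge replaced by a path of length $t-3$), and the edges $x_ix_i'$. A territory $(T,B)$ is canonical if for some $m\ge0$ there is an expansion $(T',B')$ of $(T_m,B_m)$ and an isomorphism $T\to T'$ mapping $B$ isomorphically onto $B'$. Construction. Let $g=t^{5t}$ and let $\Gamma$ be a $3$-regular graph of girth at least $g$ with a Hamiltonian cycle $\Omega$. Let $(M_1,M_2)$ be a partition of $E(\Omega)$ into two perfect matchings of $\Gamma$ and $M_3=E(\Gamma)\setminus E(\Omega)$. For $i\in\{1,2,3\}$ let $\mathcal{K}_i$ be the set of components (cycles) of the spanning subgraph of $\Gamma$ with edge set $E(\Gamma)\setminus M_i$, and $\mathcal{K}=\mathcal{K}_1\cup\mathcal{K}_2\cup\mathcal{K}_3$. For each $K\in\mathcal{K}$ let $T_K$ be a graph such that $(T_K,K)$ is a canonical territory (of perimeter equal to the length of $K$), with $V(T_K)\cap V(\Gamma)=V(K)$, and such that $V(T_K)\cap V(T_{K'})=V(K)\cap V(K')$ for all distinct $K,K'\in\mathcal{K}$. Define $G_t=\Gamma\cup\bigcup_{K\in\mathcal{K}}T_K$ (union of vertex sets and of edge sets). *)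

theory Defs
  imports Main "HOL-Library.Extended_Nat"
begin

datatype 'a graph = Graph (verts: "'a set") (edges: "'a set set")

definition simple_graph :: "'a graph \<Rightarrow> bool" where
  "simple_graph G \<longleftrightarrow> finite (verts G) \<and> (\<forall>e\<in>edges G. e \<subseteq> verts G \<and> card e = 2)"

definition subgraph :: "'a graph \<Rightarrow> 'a graph \<Rightarrow> bool" where
  "subgraph H G \<longleftrightarrow> verts H \<subseteq> verts G \<and> edges H \<subseteq> edges G"

definition induced :: "'a graph \<Rightarrow> 'a set \<Rightarrow> 'a graph" where
  "induced G S = Graph (verts G \<inter> S) {e \<in> edges G. e \<subseteq> S}"

definition delete_edge :: "'a graph \<Rightarrow> 'a set \<Rightarrow> 'a graph" where
  "delete_edge G e = Graph (verts G) (edges G - {e})"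

definition graph_Union :: "'a graph set \<Rightarrow> 'a graph" where
  "graph_Union \<G> = Graph (\<Union>G\<in>\<G>. verts G) (\<Union>G\<in>\<G>. edges G)"

definition neighbours :: "'a graph \<Rightarrow> 'a \<Rightarrow> 'a set" where
  "neighbours G v = {u \<in> verts G. {u, v} \<in> edges G}"

definition regular :: "nat \<Rightarrow> 'a graph \<Rightarrow> bool" where
  "regular d G \<longleftrightarrow> (\<forall>v\<in>verts G. card (neighbours G v) = d)"

definition graph_iso :: "('a \<Rightarrow> 'b) \<Rightarrow> 'a graph \<Rightarrow> 'b graph \<Rightarrow> bool" where
  "graph_iso f G H \<longleftrightarrow> bij_betw f (verts G) (verts H) \<and>
     (\<forall>u\<in>verts G. \<forall>v\<in>verts G. {u, v} \<in> edges G \<longleftrightarrow> {f u, f v} \<in> edges H)"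

definition isomorphic :: "'a graph \<Rightarrow> 'b graph \<Rightarrow> bool" where
  "isomorphic G H \<longleftrightarrow> (\<exists>f. graph_iso f G H)"

definition path_on :: "'a list \<Rightarrow> 'a graph" where
  "path_on xs = Graph (set xs) {{xs ! i, xs ! Suc i} | i. Suc i < length xs}"

definition cycle_on :: "'a list \<Rightarrow> 'a graph" where
  "cycle_on xs = Graph (set xs) {{xs ! i, xs ! (Suc i mod length xs)} | i. i < length xs}"

definition is_cycle :: "'a graph \<Rightarrow> bool" where
  "is_cycle C \<longleftrightarrow> (\<exists>xs. distinct xs \<and> 3 \<le> length xs \<and> C = cycle_on xs)"

definition cycle_graph :: "nat \<Rightarrow> nat graph" where
  "cycle_graph n = cycle_on [0..<n]"

definition girth :: "'a graph \<Rightarrow> enat" where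
  "girth G = (INF C\<in>{C. is_cycle C \<and> subgraph C G}. enat (card (verts C)))"

definition hamiltonian_cycle :: "'a graph \<Rightarrow> 'a graph \<Rightarrow> bool" where
  "hamiltonian_cycle \<Omega> G \<longleftrightarrow> is_cycle \<Omega> \<and> subgraph \<Omega> G \<and> verts \<Omega> = verts G"

definition perfect_matching :: "'a set set \<Rightarrow> 'a graph \<Rightarrow> bool" where
  "perfect_matching M G \<longleftrightarrow> M \<subseteq> edges G \<and> (\<forall>v\<in>verts G. \<exists>!e. e \<in> M \<and> v \<in> e)"

definition reachable :: "'a graph \<Rightarrow> 'a \<Rightarrow> 'a \<Rightarrow> bool" where
  "reachable G = (\<lambda>u v. {u, v} \<in> edges G)\<^sup>*\<^sup>*"

definition components :: "'a graph \<Rightarrow> 'a graph set" where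
  "components G = (\<lambda>v. induced G {u. reachable G v u}) ` verts G"

definition has_induced_copy :: "'a graph \<Rightarrow> 'b graph \<Rightarrow> bool" where
  "has_induced_copy G H \<longleftrightarrow> (\<exists>S \<subseteq> verts G. isomorphic (induced G S) H)"


definition territory :: "'a graph \<Rightarrow> 'a graph \<Rightarrow> bool" where
  "territory T B \<longleftrightarrow> simple_graph T \<and> is_cycle B \<and> verts B \<subseteq> verts T \<and> B = induced T (verts B)"

text \<open>
  The paths \<open>P\<^sub>i\<close>, \<open>Q\<^sub>i\<close> of an expansion are given by their vertex lists, so a path of length \<open>l\<close>
  is a list of length \<open>l + 1\<close>. Along \<open>P\<^sub>i\<close>, the vertices \<open>v\<^sub>i\<^sup>-\<close>, \<open>y\<^sub>i\<close>, \<open>v\<^sub>i\<^sup>+\<close> have indices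
  \<open>t - 4\<close>, \<open>t - 3\<close>, \<open>t - 2\<close>.
\<close>

definition expansion_path ::
  "nat \<Rightarrow> nat set \<Rightarrow> (nat \<Rightarrow> 'a) \<Rightarrow> (nat \<Rightarrow> 'a) \<Rightarrow> (nat \<Rightarrow> 'a list) \<Rightarrow> (nat \<Rightarrow> 'a list) \<Rightarrow> nat \<Rightarrow> 'a list"
where
  "expansion_path t I xm xp P Q i =
     (if i \<in> I then xm i # take (t - 3) (P i) @ Q i @ drop (t - 2) (P i) @ [xp i]
      else xm i # P i @ [xp i])"

definition expansion ::
  "nat \<Rightarrow> 'a graph \<Rightarrow> 'a graph \<Rightarrow> 'a graph \<Rightarrow> 'a graph \<Rightarrow> bool"
where
  "expansion t T' B' T B \<longleftrightarrow> territory T' B' \<and>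
     (\<exists>(k::nat) x xm xp I P Q.
        inj_on x {..<k} \<and> x ` {..<k} \<subseteq> verts B' \<and>
        (\<forall>i<k. \<forall>j<k. {x i, x j} \<notin> edges B') \<and>
        (\<forall>i<k. xm i \<noteq> xp i \<and> neighbours B' (x i) = {xm i, xp i}) \<and>
        I \<subseteq> {..<k} \<and>
        (\<forall>i<k. length (P i) = 2 * t - 6 + 1) \<and>
        (\<forall>i\<in>I. length (Q i) = t - 4 + 1) \<and>
        distinct (concat (map (\<lambda>i. P i @ (if i \<in> I then Q i else [])) [0..<k])) \<and>
        (\<forall>i<k. set (P i) \<inter> verts T' = {}) \<and>
        (\<forall>i\<in>I. set (Q i) \<inter> verts T' = {}) \<and>
        T = Graph
          (verts T' \<union> (\<Union>i<k. set (P i)) \<union> (\<Union>i\<in>I. set (Q i)))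
          (edges T' \<union>
           (\<Union>i<k. edges (path_on (P i)) \<union>
              {{xm i, hd (P i)}, {x i, P i ! (t - 3)}, {xp i, last (P i)}}) \<union>
           (\<Union>i\<in>I. edges (path_on (Q i)) \<union>
              {{P i ! (t - 4), hd (Q i)}, {P i ! (t - 2), last (Q i)}})) \<and>
        B = graph_Union
          (insert (induced B' (verts B' - x ` {..<k}))
             ((\<lambda>i. path_on (expansion_path t I xm xp P Q i)) ` {..<k})))"

text \<open>
  The vertices of \<open>B\<^sub>m\<close> are the pairs \<open>(m, j)\<close> with \<open>j < t (t - 3)\<^sup>m\<close>, in cyclic order.
  Subdividing each edge of an \<open>N\<close>-cycle into a path of length \<open>t - 3\<close> gives a cycle of
  length \<open>N (t - 3)\<close> in which the original vertex number \<open>i\<close> sits at position \<open>i (t - 3)\<close>.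
\<close>

definition ring_cycle :: "nat \<Rightarrow> nat \<Rightarrow> (nat \<times> nat) graph" where
  "ring_cycle t m = cycle_on (map (Pair m) [0..<t * (t - 3) ^ m])"

primrec nested_rings :: "nat \<Rightarrow> nat \<Rightarrow> (nat \<times> nat) graph" where
  "nested_rings t 0 = ring_cycle t 0"
| "nested_rings t (Suc m) = Graph
     (verts (nested_rings t m) \<union> verts (ring_cycle t (Suc m)))
     (edges (nested_rings t m) \<union> edges (ring_cycle t (Suc m)) \<union>
      {{(m, i), (Suc m, i * (t - 3))} | i. i < t * (t - 3) ^ m})"

text \<open>
  Expansions are taken inside the infinite vertex type \<^typ>\<open>nat \<times> nat\<close>, which always has room
  for the new vertices.
\<close>

definition canonical :: "nat \<Rightarrow> 'a graph \<Rightarrow> 'a graph \<Rightarrow> bool" where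
  "canonical t T B \<longleftrightarrow> territory T B \<and>
     (\<exists>m T' B' f. expansion t (nested_rings t m) (ring_cycle t m) T' B' \<and>
        graph_iso f T T' \<and> graph_iso f B B')"


definition cycle_family :: "'a graph \<Rightarrow> 'a set set \<Rightarrow> 'a graph set" where
  "cycle_family \<Gamma> M = components (Graph (verts \<Gamma>) (edges \<Gamma> - M))"

definition constructed_graph :: "nat \<Rightarrow> 'a graph \<Rightarrow> bool" where
  "constructed_graph t G \<longleftrightarrow>
     (\<exists>\<Gamma> \<Omega> M\<^sub>1 M\<^sub>2 M\<^sub>3 \<K> T.
        simple_graph \<Gamma> \<and> regular 3 \<Gamma> \<and> enat (t ^ (5 * t)) \<le> girth \<Gamma> \<and>
        hamiltonian_cycle \<Omega> \<Gamma> \<and>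
        M\<^sub>1 \<union> M\<^sub>2 = edges \<Omega> \<and> M\<^sub>1 \<inter> M\<^sub>2 = {} \<and>
        perfect_matching M\<^sub>1 \<Gamma> \<and> perfect_matching M\<^sub>2 \<Gamma> \<and>
        M\<^sub>3 = edges \<Gamma> - edges \<Omega> \<and>
        \<K> = cycle_family \<Gamma> M\<^sub>1 \<union> cycle_family \<Gamma> M\<^sub>2 \<union> cycle_family \<Gamma> M\<^sub>3 \<and>
        (\<forall>K\<in>\<K>. canonical t (T K) K \<and> verts (T K) \<inter> verts \<Gamma> = verts K) \<and>
        (\<forall>K\<in>\<K>. \<forall>K'\<in>\<K>. K \<noteq> K' \<longrightarrow> verts (T K) \<inter> verts (T K') = verts K \<inter> verts K') \<and>
        G = graph_Union (insert \<Gamma> (T ` \<K>)))"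

end

theory Submission
  imports Defs
begin

text \<open>
  A canonical territory \<open>(T, B)\<close> is a disc tiled by induced \<open>t\<close>-cycles. An edge of \<open>T\<close> inside the
  disc lies on two tiles which share only that edge and have no further edge between them; an edge
  of \<open>B\<close> lies on one tile, but every edge of \<open>\<Gamma>\<close> is on the boundary of exactly two of the discs
  glued together in \<open>G\<^sub>t\<close>. In both cases deleting the common edge of the two tiles leaves a cycle of
  length \<open>2 t - 2\<close>. It remains to see that no chord arises in \<open>G\<^sub>t\<close>: vertices of \<open>B\<close> at distance
  \<open>d\<close> in \<open>T\<close> have distance at most \<open>3 t (d (t - 3)\<^sup>d + 1)\<close> in \<open>B\<close>, because a walk of length \<open>d\<close>
  goes at most \<open>d\<close> rings down, where a step spans \<open>(t - 3)\<^sup>d\<close> outer vertices. Hence a chord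
  or a second common vertex would close a cycle in \<open>\<Gamma>\<close> shorter than its girth.
\<close>

section \<open>Induced cycles sharing an edge\<close>

text \<open>No planarity is used: a pair of tiles at an edge is recorded by \<open>theta\<close>
  alone, in the same form for edges inside a territory and edges of \<open>\<Gamma>\<close>, so one
  closing argument serves both. The obstacle is that a tile is induced only in its own territory.
  Each cycle \<open>K\<close> is induced in \<open>T K\<close> and territories meet only in their
  cycles, so any extra edge between two vertices of one territory belongs to \<open>\<Gamma>\<close>
  and has both ends on \<open>K\<close>. Distances are therefore needed on boundaries only. They are
  taken for walks of length \<open>2 * t\<close>: \<open>t\<close> steps in each of two tiles with a
  common vertex. The factor \<open>3 * t\<close> pays for expansions: everything added at
  \<open>x i\<close> is contracted to \<open>x i\<close>, and a step on the old boundary is lifted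
  along a path of at most \<open>3 * t\<close> vertices; the summand 1 is there because vertices
  with the same image may still be a whole such path apart. For an edge of \<open>\<Gamma>\<close>,
  the two discs come from removing two different matchings, so their cycles share only edges of the
  third matching and never two consecutive ones; this keeps the two tiles from meeting or being
  joined away from the edge.\<close>

definition icycle :: "'a set set \<Rightarrow> nat \<Rightarrow> (nat \<Rightarrow> 'a) \<Rightarrow> bool" where
  "icycle E n c \<longleftrightarrow> inj_on c {..<n} \<and>
     (\<forall>i j. i < j \<longrightarrow> j < n \<longrightarrow> ({c i, c j} \<in> E \<longleftrightarrow> j = Suc i \<or> (i = 0 \<and> Suc j = n)))"

definition induces_cycle :: "'a set set \<Rightarrow> nat \<Rightarrow> 'a set \<Rightarrow> bool" where
  "induces_cycle E n S \<longleftrightarrow> (\<exists>c. icycle E n c \<and> S = c ` {..<n})"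

text \<open>Edges between the two cycles are forbidden only off \<open>e\<close>: a pair with one
  end in \<open>e\<close> lies inside one of the cycles, where inducedness already decides
  it.\<close>

definition theta :: "'a set set \<Rightarrow> nat \<Rightarrow> 'a set \<Rightarrow> bool" where
  "theta E n e \<longleftrightarrow> (\<exists>S S'. induces_cycle E n S \<and> induces_cycle E n S' \<and> S \<inter> S' = e \<and>
     (\<forall>a\<in>S - e. \<forall>b\<in>S' - e. {a, b} \<notin> E))"

lemma icycle_rotate1:
  assumes "icycle E n c" "n \<ge> 3"
  shows "icycle E n (\<lambda>k. c (Suc k mod n))"
proof -
  have inj: "inj_on c {..<n}" and
    E: "\<And>i j. i < j \<Longrightarrow> j < n \<Longrightarrow> {c i, c j} \<in> E \<longleftrightarrow> j = Suc i \<or> (i = 0 \<and> Suc j = n)"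
    using assms(1) by (auto simp: icycle_def)
  have "{c (Suc i mod n), c (Suc j mod n)} \<in> E \<longleftrightarrow> j = Suc i \<or> (i = 0 \<and> Suc j = n)"
    if "i < j" "j < n" for i j
  proof (cases "Suc j = n")
    case True
    then show ?thesis using that E[of 0 "Suc i"] assms(2) by (auto simp: insert_commute)
  next
    case False
    then show ?thesis using that E[of "Suc i" "Suc j"] by auto
  qed
  moreover have "inj_on (\<lambda>k. c (Suc k mod n)) {..<n}"
  proof (rule inj_onI)
    fix x y assume *: "x \<in> {..<n}" "y \<in> {..<n}" "c (Suc x mod n) = c (Suc y mod n)"
    then have "Suc x mod n = Suc y mod n" using inj assms(2) by (auto dest!: inj_onD)
    then show "x = y" using * by (auto simp: mod_Suc split: if_splits)
  qed
  ultimately show ?thesis by (simp add: icycle_def)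
qed

lemma icycle_rotate:
  assumes "icycle E n c" "n \<ge> 3"
  shows "icycle E n (\<lambda>k. c ((k + s) mod n))"
proof (induction s)
  case 0
  have "icycle E n (\<lambda>k. c (k mod n)) \<longleftrightarrow> icycle E n c"
    unfolding icycle_def by (intro conj_cong inj_on_cong) auto
  then show ?case using assms by simp
next
  case (Suc s)
  from icycle_rotate1[OF this assms(2)] show ?case by (simp add: mod_simps)
qed

lemma icycle_reflect:
  assumes "icycle E n c"
  shows "icycle E n (\<lambda>k. c (n - Suc k))"
proof -
  have inj: "inj_on c {..<n}" and
    E: "\<And>i j. i < j \<Longrightarrow> j < n \<Longrightarrow> {c i, c j} \<in> E \<longleftrightarrow> j = Suc i \<or> (i = 0 \<and> Suc j = n)"
    using assms(1) by (auto simp: icycle_def)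
  have "{c (n - Suc i), c (n - Suc j)} \<in> E \<longleftrightarrow> j = Suc i \<or> (i = 0 \<and> Suc j = n)"
    if "i < j" "j < n" for i j
    using that E[of "n - Suc j" "n - Suc i"] by (auto simp: insert_commute)
  moreover have "inj_on (\<lambda>k. c (n - Suc k)) {..<n}"
    by (rule inj_onI) (use inj in \<open>auto dest!: inj_onD\<close>)
  ultimately show ?thesis by (simp add: icycle_def)
qed

lemma rotate_image: "(n::nat) > 0 \<Longrightarrow> (\<lambda>k. c ((k + s) mod n)) ` {..<n} = c ` {..<n}"
proof -
  assume n: "n > 0"
  have "(\<lambda>k. (k + s) mod n) ` {..<n} = {..<n}"
  proof (rule card_subset_eq)
    show "(\<lambda>k. (k + s) mod n) ` {..<n} \<subseteq> {..<n}" using n by auto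
    have "inj_on (\<lambda>k. (k + s) mod n) {..<n}"
    proof (rule inj_onI)
      fix x y assume *: "x \<in> {..<n}" "y \<in> {..<n}" "(x + s) mod n = (y + s) mod n"
      then have "int n dvd (int x + int s) - (int y + int s)"
        by (metis mod_eq_dvd_iff of_nat_add of_nat_mod)
      then have "int n dvd int x - int y" by simp
      then have "int x mod int n = int y mod int n" by (simp add: mod_eq_dvd_iff)
      then show "x = y" using * by simp
    qed
    then show "card ((\<lambda>k. (k + s) mod n) ` {..<n}) = card {..<n}" by (simp add: card_image)
  qed simp
  then have "c ` ((\<lambda>k. (k + s) mod n) ` {..<n}) = c ` {..<n}" by simp
  then show ?thesis by (simp only: image_image)
qed

lemma reflect_image: "(\<lambda>k. c (n - Suc k)) ` {..<n} = c ` {..<n}"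
proof -
  have "(\<lambda>k. n - Suc k) ` {..<n} = {..<n}"
  proof
    show "{..<n} \<subseteq> (\<lambda>k. n - Suc k) ` {..<n}"
    proof
      fix x assume "x \<in> {..<n}"
      then have "x = n - Suc (n - Suc x)" "n - Suc x \<in> {..<n}" by auto
      then show "x \<in> (\<lambda>k. n - Suc k) ` {..<n}" by blast
    qed
  qed auto
  then have "c ` ((\<lambda>k. n - Suc k) ` {..<n}) = c ` {..<n}" by simp
  then show ?thesis by (simp only: image_image)
qed

text \<open>Turns the chosen edge into the closing pair of the numbering, so that both cycles at an
  edge can be read as paths from \<open>u\<close> to \<open>v\<close>. A rotation handles
  consecutive indices, a reflection the pair 0, \<open>n - 1\<close>.\<close>

lemma induces_cycle_param:
  assumes "induces_cycle E n S" "n \<ge> 3" "{u, v} \<in> E" "u \<in> S" "v \<in> S" "u \<noteq> v"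
  obtains c where "icycle E n c" "S = c ` {..<n}" "c 0 = u" "c (n - 1) = v"
proof -
  obtain c where c: "icycle E n c" "S = c ` {..<n}" using assms by (auto simp: induces_cycle_def)
  have *: "\<exists>c. icycle E n c \<and> S = c ` {..<n} \<and> c 0 = c' j \<and> c (n - 1) = c' i"
    if "{c' i, c' j} \<in> E" "i < j" "j < n" "icycle E n c'" "S = c' ` {..<n}" for i j c'
  proof -
    from that have "j = Suc i \<or> (i = 0 \<and> Suc j = n)" unfolding icycle_def by blast
    then consider "j = Suc i" | "i = 0" "Suc j = n" by blast
    then show ?thesis
    proof cases
      case 1
      have "(n - 1 + j) mod n = i" using 1 that by simp
      then show ?thesis
        using that assms(2) 1 icycle_rotate[of E n c' j] rotate_image[of n c' j]
        by (intro exI[of _ "\<lambda>k. c' ((k + j) mod n)"]) auto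
    next
      case 2
      then show ?thesis
        using that assms(2) icycle_reflect[of E n c'] reflect_image[of c' n]
        by (intro exI[of _ "\<lambda>k. c' (n - Suc k)"]) auto
    qed
  qed
  obtain i j where ij: "i < n" "j < n" "u = c i" "v = c j" "i \<noteq> j" using assms c by auto
  show ?thesis
  proof (cases "i < j")
    case False
    then show ?thesis using *[of c j i] ij c assms(3) that by (auto simp: insert_commute)
  next
    case True
    \<comment> \<open>The claim \<open>*\<close> starts the numbering at the end of larger index,
      which here is \<open>v\<close>; one more reflection exchanges the ends.\<close>
    then obtain d where d: "icycle E n d" "S = d ` {..<n}" "d 0 = v" "d (n - 1) = u"
      using *[of c i j] ij c assms(3) by auto
    then show ?thesis
      using that[of "\<lambda>k. d (n - Suc k)"] icycle_reflect reflect_image[of d n] assms(2) by auto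
  qed
qed

lemma has_induced_copy_cycle:
  assumes c: "icycle (edges G) n c" and "n \<ge> 3" and sub: "c ` {..<n} \<subseteq> verts G"
    and simple: "\<And>e. e \<in> edges G \<Longrightarrow> card e = 2"
  shows "has_induced_copy G (cycle_graph n)"
proof -
  let ?S = "c ` {..<n}"
  have inj: "inj_on c {..<n}" and
    E: "\<And>i j. i < j \<Longrightarrow> j < n \<Longrightarrow> {c i, c j} \<in> edges G \<longleftrightarrow> j = Suc i \<or> (i = 0 \<and> Suc j = n)"
    using c by (auto simp: icycle_def)
  let ?f = "inv_into {..<n} c"
  have f: "?f (c i) = i" if "i < n" for i using inj that by simp
  have cyE: "edges (cycle_graph n) = {{k, Suc k mod n} | k. k < n}"
  proof -
    have "{[0..<n] ! i, [0..<n] ! (Suc i mod n)} = {i, Suc i mod n}" if "i < n" for i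
      using that by (simp add: mod_less_divisor)
    then have "{{[0..<n] ! i, [0..<n] ! (Suc i mod n)} | i. i < n} = {{i, Suc i mod n} | i. i < n}"
      by (intro Collect_cong) metis
    then show ?thesis by (simp add: cycle_graph_def cycle_on_def)
  qed
  have cg: "{i, j} \<in> edges (cycle_graph n) \<longleftrightarrow> j = Suc i \<or> (i = 0 \<and> Suc j = n)"
    if "i < j" "j < n" for i j
  proof -
    have "{i, j} \<in> edges (cycle_graph n) \<longleftrightarrow> (\<exists>k<n. {i, j} = {k, Suc k mod n})"
      by (auto simp: cyE)
    also have "\<dots> \<longleftrightarrow> j = Suc i \<or> (i = 0 \<and> Suc j = n)"
    proof
      assume "\<exists>k<n. {i, j} = {k, Suc k mod n}"
      then obtain k where k: "k < n" "{i, j} = {k, Suc k mod n}" by blast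
      show "j = Suc i \<or> (i = 0 \<and> Suc j = n)"
        using k that by (cases "Suc k = n") (auto simp: doubleton_eq_iff)
    next
      assume "j = Suc i \<or> (i = 0 \<and> Suc j = n)"
      then show "\<exists>k<n. {i, j} = {k, Suc k mod n}"
      proof
        assume "j = Suc i" then show ?thesis using that by (intro exI[of _ i]) auto
      next
        assume "i = 0 \<and> Suc j = n" then show ?thesis using that by (intro exI[of _ j]) auto
      qed
    qed
    finally show ?thesis .
  qed
  \<comment> \<open>\<open>graph_iso\<close> also compares pairs with equal entries, so loops must
    be excluded on both sides.\<close>
  have loop: "{i, i} \<notin> edges (cycle_graph n)" if "i < n" for i
    using \<open>n \<ge> 3\<close> by (auto simp: cycle_graph_def cycle_on_def doubleton_eq_iff mod_Suc)
  have loop': "{a, a} \<notin> edges G" for a using simple[of "{a,a}"] by auto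
  have "graph_iso ?f (induced G ?S) (cycle_graph n)"
    unfolding graph_iso_def
  proof (intro conjI ballI)
    have "bij_betw ?f ?S {..<n}" using inj by (meson bij_betw_inv_into inj_on_imp_bij_betw)
    then show "bij_betw ?f (verts (induced G ?S)) (verts (cycle_graph n))"
      using sub by (simp add: induced_def Int_absorb1 cycle_graph_def cycle_on_def lessThan_atLeast0)
    fix u v assume "u \<in> verts (induced G ?S)" "v \<in> verts (induced G ?S)"
    then obtain i j where ij: "i < n" "j < n" "u = c i" "v = c j" by (auto simp: induced_def)
    have 1: "{u, v} \<in> edges (induced G ?S) \<longleftrightarrow> {u, v} \<in> edges G" using ij by (auto simp: induced_def)
    consider "i < j" | "j < i" | "i = j" by linarith
    then have 2: "{c i, c j} \<in> edges G \<longleftrightarrow> {i, j} \<in> edges (cycle_graph n)"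
    proof cases
      case 1 then show ?thesis using E[of i j] cg[of i j] ij by simp
    next
      case 2 then show ?thesis using E[of j i] cg[of j i] ij by (simp add: insert_commute)
    next
      case 3 then show ?thesis using loop[of j] loop'[of "c j"] ij by simp
    qed
    show "{u, v} \<in> edges (induced G ?S) \<longleftrightarrow> {?f u, ?f v} \<in> edges (cycle_graph n)"
      using 1 2 ij f by simp
  qed
  then show ?thesis using sub by (auto simp: has_induced_copy_def isomorphic_def)
qed

lemma icycle_in_Union:
  assumes "icycle E n c" "n \<ge> 3"
  shows "c ` {..<n} \<subseteq> \<Union>E"
proof
  fix x assume "x \<in> c ` {..<n}"
  then obtain i where i: "i < n" "x = c i" by auto
  have E: "\<And>i j. i < j \<Longrightarrow> j < n \<Longrightarrow> {c i, c j} \<in> E \<longleftrightarrow> j = Suc i \<or> (i = 0 \<and> Suc j = n)"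
    using assms by (auto simp: icycle_def)
  show "x \<in> \<Union>E"
  proof (cases i)
    case 0 then show ?thesis using E[of 0 1] i assms by auto
  next
    case (Suc k) then show ?thesis using E[of k i] i by auto
  qed
qed

lemma induces_cycle_in_Union: "induces_cycle E n S \<Longrightarrow> n \<ge> 3 \<Longrightarrow> S \<subseteq> \<Union>E"
  unfolding induces_cycle_def using icycle_in_Union by metis

lemma theta_imp_induced_copy:
  assumes G: "simple_graph G" and e: "e \<in> edges G" and n: "n \<ge> 3" and th: "theta (edges G) n e"
  shows "has_induced_copy (delete_edge G e) (cycle_graph (2 * n - 2))"
proof -
  let ?E = "edges G"
  obtain S S' where S: "induces_cycle ?E n S" "induces_cycle ?E n S'" "S \<inter> S' = e"
    and cross: "\<And>a b. a \<in> S - e \<Longrightarrow> b \<in> S' - e \<Longrightarrow> {a, b} \<notin> ?E"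
    using th unfolding theta_def by blast
  obtain u v where uv: "e = {u, v}" "u \<noteq> v"
    using G e by (meson card_2_iff simple_graph_def)
  have inS: "u \<in> S" "v \<in> S" and inS': "u \<in> S'" "v \<in> S'" using S(3) uv by auto
  obtain p where p: "icycle ?E n p" "S = p ` {..<n}" "p 0 = u" "p (n - 1) = v"
    using induces_cycle_param[of ?E n S u v] S(1,2) n uv e inS by metis
  obtain q where q: "icycle ?E n q" "S' = q ` {..<n}" "q 0 = u" "q (n - 1) = v"
    using induces_cycle_param[of ?E n S' u v] S(1,2) n uv e inS' by metis
  have pinj: "inj_on p {..<n}" and
    pE: "\<And>i j. i < j \<Longrightarrow> j < n \<Longrightarrow> {p i, p j} \<in> ?E \<longleftrightarrow> j = Suc i \<or> (i = 0 \<and> Suc j = n)"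
    using p(1) by (auto simp: icycle_def)
  have qinj: "inj_on q {..<n}" and
    qE: "\<And>i j. i < j \<Longrightarrow> j < n \<Longrightarrow> {q i, q j} \<in> ?E \<longleftrightarrow> j = Suc i \<or> (i = 0 \<and> Suc j = n)"
    using q(1) by (auto simp: icycle_def)
  have pin: "p i \<in> S - e" if "0 < i" "i < n - 1" for i
  proof -
    have "i < n" using that by simp
    then show ?thesis
      using that p uv inj_onD[OF pinj, of i 0] inj_onD[OF pinj, of i "n - 1"] by auto
  qed
  have qin: "q i \<in> S' - e" if "0 < i" "i < n - 1" for i
  proof -
    have "i < n" using that by simp
    then show ?thesis
      using that q uv inj_onD[OF qinj, of i 0] inj_onD[OF qinj, of i "n - 1"] by auto
  qed
  \<comment> \<open>From \<open>u\<close> to \<open>v\<close> along \<open>p\<close>, then back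
    along \<open>q\<close> through the indices \<open>n - 2\<close> down to 1; the ends of
    \<open>q\<close> are already listed.\<close>
  define c where "c k = (if k < n then p k else q (2 * n - 2 - k))" for k
  have "icycle (?E - {e}) (2 * n - 2) c"
    unfolding icycle_def
  proof (intro conjI allI impI)
    show "inj_on c {..<2 * n - 2}"
    proof (rule linorder_inj_onI')
      fix i j assume ij: "i \<in> {..<2 * n - 2}" "j \<in> {..<2 * n - 2}" "i < j"
      consider "j < n" | "n \<le> i" | "i = 0" "n \<le> j" | "Suc i = n" "n \<le> j" | "0 < i" "i < n - 1" "n \<le> j"
        by linarith
      then show "c i \<noteq> c j"
      proof cases
        case 1 then show ?thesis using ij inj_onD[OF pinj, of i j] by (auto simp: c_def)
      next
        case 2
        define a b where "a = 2 * n - 2 - i" and "b = 2 * n - 2 - j"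
        have "b < a" "a < n" using 2 ij by (auto simp: a_def b_def)
        then have "q a \<noteq> q b" using inj_onD[OF qinj, of a b] by auto
        then show ?thesis using 2 ij by (simp add: c_def a_def b_def)
      next
        case 3
        then have "q (2 * n - 2 - j) \<notin> e" using qin[of "2 * n - 2 - j"] ij by simp
        then show ?thesis using 3 ij p uv n by (auto simp: c_def)
      next
        case 4
        then have "c i = v" using p by (auto simp: c_def)
        moreover have "q (2 * n - 2 - j) \<notin> e" using 4 qin[of "2 * n - 2 - j"] ij by simp
        ultimately show ?thesis using 4 ij uv by (auto simp: c_def)
      next
        case 5
        then have "q (2 * n - 2 - j) \<in> S' - e" "p i \<in> S - e"
          using qin[of "2 * n - 2 - j"] pin[of i] ij by simp_all
        then show ?thesis using 5 ij S(3) by (auto simp: c_def)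
      qed
    qed
    fix i j assume ij: "i < j" "j < 2 * n - 2"
    \<comment> \<open>Inner vertices of \<open>q\<close> avoid \<open>e\<close>, so deleting
      \<open>e\<close> affects no pair that involves the second half.\<close>
    have ne: "{x, q k} \<noteq> e" if "0 < k" "k < n - 1" for x k using qin[OF that] by auto
    \<comment> \<open>The two ends of \<open>e\<close> also lie on \<open>q\<close>, so their pairs
      with the second half are read off \<open>q\<close>; only two inner vertices of different
      cycles need \<open>cross\<close>.\<close>
    consider "j < n" | "n \<le> i" | "i = 0" "n \<le> j" | "Suc i = n" "n \<le> j" | "0 < i" "i < n - 1" "n \<le> j"
      by linarith
    then show "{c i, c j} \<in> ?E - {e} \<longleftrightarrow> j = Suc i \<or> (i = 0 \<and> Suc j = 2 * n - 2)"
    proof cases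
      case 1
      have "{p i, p j} = e \<longleftrightarrow> i = 0 \<and> Suc j = n"
      proof
        assume *: "{p i, p j} = e"
        then have "\<not> (0 < i \<and> i < n - 1)" "\<not> (0 < j \<and> j < n - 1)" using pin[of i] pin[of j] by auto
        then show "i = 0 \<and> Suc j = n" using ij 1 by auto
      qed (use p uv in auto)
      then show ?thesis using 1 ij pE[of i j] n by (auto simp: c_def)
    next
      case 2
      define a b where "a = 2 * n - 2 - i" and "b = 2 * n - 2 - j"
      have ab: "0 < b" "b < a" "a < n - 1" "j = Suc i \<longleftrightarrow> a = Suc b" "c i = q a" "c j = q b"
        using 2 ij by (auto simp: a_def b_def c_def)
      then show ?thesis using 2 qE[of b a] ne[of b "q a"] by (auto simp: insert_commute)
    next
      case 3
      define b where "b = 2 * n - 2 - j"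
      have ab: "0 < b" "b < n - 1" "Suc j = 2 * n - 2 \<longleftrightarrow> b = 1" "c j = q b" "c i = q 0"
        using 3 ij n p q by (auto simp: b_def c_def)
      then show ?thesis using 3 n qE[of 0 b] ne[of b "q 0"] by auto
    next
      case 4
      define b where "b = 2 * n - 2 - j"
      have ab: "0 < b" "b < n - 1" "j = Suc i \<longleftrightarrow> Suc b = n - 1" "c j = q b" "c i = q (n - 1)"
        using 4 ij n p q by (auto simp: b_def c_def)
      then show ?thesis using 4 n qE[of b "n - 1"] ne[of b "q (n - 1)"] by (auto simp: insert_commute)
    next
      case 5
      define b where "b = 2 * n - 2 - j"
      have ab: "0 < b" "b < n - 1" "c j = q b" "c i = p i"
        using 5 ij n p q by (auto simp: b_def c_def)
      then show ?thesis using 5 cross[OF pin[of i] qin[of b]] by auto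
    qed
  qed
  moreover have "\<Union>?E \<subseteq> verts G" using G by (auto simp: simple_graph_def)
  then have "S \<subseteq> verts G" "S' \<subseteq> verts G" using S n induces_cycle_in_Union by (meson order_trans)+
  then have "c ` {..<2 * n - 2} \<subseteq> verts G" using p q by (auto simp: c_def)
  ultimately show ?thesis using G n
    by (intro has_induced_copy_cycle) (auto simp: delete_edge_def simple_graph_def)
qed

lemma icycle_map:
  assumes "icycle E n c" "c ` {..<n} \<subseteq> U" "inj_on h U"
    and "\<And>a b. a \<in> U \<Longrightarrow> b \<in> U \<Longrightarrow> {h a, h b} \<in> E' \<longleftrightarrow> {a, b} \<in> E"
  shows "icycle E' n (\<lambda>i. h (c i))"
proof -
  have "inj_on (h \<circ> c) {..<n}"
    using assms by (intro comp_inj_on) (auto simp: icycle_def inj_on_subset)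
  moreover have "{h (c i), h (c j)} \<in> E' \<longleftrightarrow> {c i, c j} \<in> E" if "i < n" "j < n" for i j
    using that assms(2,4) by (auto simp: image_subset_iff)
  ultimately show ?thesis using assms(1) by (simp add: icycle_def comp_def)
qed

lemma induces_cycle_map:
  assumes "induces_cycle E n S" "S \<subseteq> U" "inj_on h U"
    and "\<And>a b. a \<in> U \<Longrightarrow> b \<in> U \<Longrightarrow> {h a, h b} \<in> E' \<longleftrightarrow> {a, b} \<in> E"
  shows "induces_cycle E' n (h ` S)"
proof -
  obtain c where c: "icycle E n c" "S = c ` {..<n}" using assms(1) by (auto simp: induces_cycle_def)
  have "icycle E' n (\<lambda>i. h (c i))" by (rule icycle_map[OF c(1) _ assms(3,4)]) (use c(2) assms(2) in auto)
  then show ?thesis unfolding induces_cycle_def using c(2)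
    by (intro exI[of _ "\<lambda>i. h (c i)"]) (auto simp: image_image)
qed

lemma induces_cycle_cong:
  assumes "induces_cycle E n S" "\<And>a b. a \<in> S \<Longrightarrow> b \<in> S \<Longrightarrow> {a, b} \<in> E' \<longleftrightarrow> {a, b} \<in> E"
  shows "induces_cycle E' n S"
  using induces_cycle_map[of E n S S "\<lambda>x. x" E'] assms by simp

text \<open>Adjacency is compared only on a set \<open>U\<close> that contains all ends of edges.
  This covers isomorphisms and also the passage to a larger graph that adds no edge inside
  \<open>U\<close>.\<close>

lemma theta_map:
  assumes "theta E n e" "n \<ge> 3" "\<Union>E \<subseteq> U" "inj_on h U"
    and E': "\<And>a b. a \<in> U \<Longrightarrow> b \<in> U \<Longrightarrow> {h a, h b} \<in> E' \<longleftrightarrow> {a, b} \<in> E"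
  shows "theta E' n (h ` e)"
proof -
  obtain S S' where S: "induces_cycle E n S" "induces_cycle E n S'" "S \<inter> S' = e"
    and cross: "\<And>a b. a \<in> S - e \<Longrightarrow> b \<in> S' - e \<Longrightarrow> {a, b} \<notin> E"
    using assms(1) unfolding theta_def by blast
  have sub: "S \<subseteq> U" "S' \<subseteq> U" using S induces_cycle_in_Union assms(2,3) by (meson order_trans)+
  have "h ` S \<inter> h ` S' = h ` e" using inj_on_image_Int[OF assms(4) sub] S by simp
  moreover have "induces_cycle E' n (h ` S)" "induces_cycle E' n (h ` S')"
    using induces_cycle_map[of E n _ U h E'] S(1,2) sub assms(4) E' by auto
  moreover have "{a, b} \<notin> E'" if ab: "a \<in> h ` S - h ` e" "b \<in> h ` S' - h ` e" for a b
  proof -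
    obtain x y where "a = h x" "x \<in> S - e" "b = h y" "y \<in> S' - e" using ab by auto
    then show ?thesis using cross[of x y] E'[of x y] sub by auto
  qed
  ultimately show ?thesis unfolding theta_def by blast
qed

lemma theta_cong:
  assumes "theta E n e" "n \<ge> 3" "\<Union>E \<subseteq> U"
    and "\<And>a b. a \<in> U \<Longrightarrow> b \<in> U \<Longrightarrow> {a, b} \<in> E' \<longleftrightarrow> {a, b} \<in> E"
  shows "theta E' n e"
  using theta_map[of E n e U "\<lambda>x. x" E'] assms by simp

lemma thetaI:
  assumes "induces_cycle E n S" "induces_cycle E n S'" "S \<inter> S' = e"
     "\<And>a b. a \<in> S - e \<Longrightarrow> b \<in> S' - e \<Longrightarrow> {a, b} \<notin> E"
  shows "theta E n e"
  using assms unfolding theta_def by blast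

text \<open>In \<open>tiled n T B\<close>, the graph \<open>T\<close> behaves like a disc with boundary \<open>B\<close> that is tiled by
  induced \<open>n\<close>-cycles: an inner edge lies on two tiles, which meet nowhere else, and a boundary
  edge on at least one.\<close>

definition tiled :: "nat \<Rightarrow> 'a graph \<Rightarrow> 'a graph \<Rightarrow> bool" where
  "tiled n T B \<longleftrightarrow> (\<forall>e\<in>edges T. theta (edges T) n e \<or>
     (e \<in> edges B \<and> (\<exists>S. induces_cycle (edges T) n S \<and> e \<subseteq> S)))"

lemma tiled_face:
  assumes "tiled n T B" "e \<in> edges T"
  obtains S where "induces_cycle (edges T) n S" "e \<subseteq> S"
proof -
  have "theta (edges T) n e \<or> (\<exists>S. induces_cycle (edges T) n S \<and> e \<subseteq> S)"
    using assms unfolding tiled_def by blast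
  then have "\<exists>S. induces_cycle (edges T) n S \<and> e \<subseteq> S"
    unfolding theta_def by (metis inf_le1)
  then show ?thesis using that by blast
qed

text \<open>The common shape of all tiles added later: an edge \<open>a b\<close>, closed by a path
  that is attached to it only at the ends.\<close>

lemma induces_cycle_ear:
  assumes inj: "inj_on c {..<k}" and ab: "a \<noteq> b" "a \<notin> c ` {..<k}" "b \<notin> c ` {..<k}" "{a, b} \<in> E"
    and cE: "\<And>i j. i < j \<Longrightarrow> j < k \<Longrightarrow> {c i, c j} \<in> E \<longleftrightarrow> j = Suc i"
    and aE: "\<And>i. i < k \<Longrightarrow> {a, c i} \<in> E \<longleftrightarrow> i = 0"
    and bE: "\<And>i. i < k \<Longrightarrow> {b, c i} \<in> E \<longleftrightarrow> Suc i = k"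
    and n: "n = k + 2" and k: "k \<ge> 1"
  shows "induces_cycle E n ({a, b} \<union> c ` {..<k})"
proof -
  \<comment> \<open>The cyclic order is \<open>a\<close>, \<open>c 0\<close>, ...,
    \<open>c (k - 1)\<close>, \<open>b\<close>, with \<open>a b\<close> as the closing edge.\<close>
  define d where "d i = (case i of 0 \<Rightarrow> a | Suc j \<Rightarrow> if j < k then c j else b)" for i
  have d0: "d 0 = a" and ds: "\<And>i. i < k \<Longrightarrow> d (Suc i) = c i" and dk: "d (Suc k) = b"
    by (auto simp: d_def)
  have less: "{..<n} = insert 0 (insert (Suc k) (Suc ` {..<k}))"
    using lessThan_Suc[of "Suc k"] lessThan_Suc_eq_insert_0[of k] n by auto
  have img: "d ` {..<n} = {a, b} \<union> c ` {..<k}"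
    unfolding less by (auto simp: d0 dk ds image_iff)
  have "icycle E n d"
    unfolding icycle_def
  proof (intro conjI allI impI)
    show "inj_on d {..<n}"
    proof (rule linorder_inj_onI')
      fix i j assume ij: "i \<in> {..<n}" "j \<in> {..<n}" "i < j"
      then obtain j' where j': "j = Suc j'" by (cases j) auto
      show "d i \<noteq> d j"
      proof (cases i)
        case 0
        then show ?thesis using ij ab j' ds[of j'] d0 dk n by (cases "j' = k") auto
      next
        case (Suc i')
        have i': "i' < k" using ij Suc n by simp
        show ?thesis
        proof (cases "j' = k")
          case True
          moreover have "c i' \<in> c ` {..<k}" using i' by simp
          ultimately show ?thesis using ab Suc j' ds[OF i'] dk by metis
        next
          case False
          then have "j' < k" "i' < j'" using ij j' n Suc by auto
          then show ?thesis using Suc j' ds i' inj_onD[OF inj, of i' j'] by auto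
        qed
      qed
    qed
    fix i j assume ij: "i < j" "j < n"
    then obtain j' where j': "j = Suc j'" by (cases j) auto
    show "{d i, d j} \<in> E \<longleftrightarrow> j = Suc i \<or> (i = 0 \<and> Suc j = n)"
    proof (cases i)
      case 0
      then show ?thesis using ij ab j' ds[of j'] d0 dk n aE[of j'] by (cases "j' = k") auto
    next
      case (Suc i')
      have i': "i' < k" using ij Suc n by simp
      show ?thesis
      proof (cases "j' = k")
        case True
        then show ?thesis using i' Suc j' ds[of i'] dk bE[of i'] by (auto simp: insert_commute)
      next
        case False
        then have "j' < k" "i' < j'" using ij j' n Suc by auto
        then show ?thesis using Suc j' ds i' cE[of i' j'] n by auto
      qed
    qed
  qed
  then show ?thesis unfolding induces_cycle_def using img by blast
qed

section \<open>Nested rings\<close>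

definition ring_len :: "nat \<Rightarrow> nat \<Rightarrow> nat" where
  "ring_len t m = t * (t - 3) ^ m"

text \<open>Ring positions taken modulo the length of the ring, so that index arithmetic becomes
  divisibility.\<close>

definition ring_vertex :: "nat \<Rightarrow> nat \<Rightarrow> int \<Rightarrow> nat \<times> nat" where
  "ring_vertex t m z = (m, nat (z mod int (ring_len t m)))"

lemma ring_len_Suc: "ring_len t (Suc m) = ring_len t m * (t - 3)"
  by (simp add: ring_len_def)

lemma ring_len_ge: "t \<ge> 5 \<Longrightarrow> ring_len t m \<ge> 5"
proof (induction m)
  case (Suc m)
  then show ?case using mult_le_mono[of 5 "ring_len t m" 1 "t - 3"] by (auto simp: ring_len_Suc)
qed (simp add: ring_len_def)

lemma fst_ring_vertex [simp]: "fst (ring_vertex t m z) = m"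
  by (simp add: ring_vertex_def)

lemma ring_vertex_eq_iff:
  assumes "t \<ge> 5"
  shows "ring_vertex t m a = ring_vertex t m b \<longleftrightarrow> int (ring_len t m) dvd a - b"
proof -
  have "int (ring_len t m) > 0" using ring_len_ge[OF assms, of m] by linarith
  then have "ring_vertex t m a = ring_vertex t m b \<longleftrightarrow> a mod int (ring_len t m) = b mod int (ring_len t m)"
    by (simp add: ring_vertex_def nat_eq_iff)
  then show ?thesis by (simp add: mod_eq_dvd_iff)
qed

lemma ring_vertex_of_nat: "j < ring_len t m \<Longrightarrow> ring_vertex t m (int j) = (m, j)"
  by (simp add: ring_vertex_def)

lemma verts_ring_cycle: "verts (ring_cycle t m) = {(m, j) | j. j < ring_len t m}"
  by (auto simp: ring_cycle_def cycle_on_def ring_len_def)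

lemma verts_ring_cycle':
  assumes "t \<ge> 5"
  shows "verts (ring_cycle t m) = range (ring_vertex t m)"
proof -
  have "int (ring_len t m) > 0" using ring_len_ge[OF assms, of m] by linarith
  then have "ring_vertex t m z \<in> verts (ring_cycle t m)" for z
    by (auto simp: verts_ring_cycle ring_vertex_def nat_less_iff)
  moreover have "v \<in> range (ring_vertex t m)" if "v \<in> verts (ring_cycle t m)" for v
  proof -
    obtain j where "v = (m, j)" "j < ring_len t m" using \<open>v \<in> _\<close> by (auto simp: verts_ring_cycle)
    then show ?thesis using ring_vertex_of_nat[of j t m] by (metis rangeI)
  qed
  ultimately show ?thesis by blast
qed

text \<open>Letting the index run through all integers absorbs the wrap-around edge; reducing it
  modulo the length gives back one of the listed edges.\<close>

lemma edges_ring_cycle: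
  assumes "t \<ge> 5"
  shows "edges (ring_cycle t m) = range (\<lambda>a. {ring_vertex t m a, ring_vertex t m (a + 1)})"
proof -
  let ?N = "ring_len t m"
  have pos: "?N > 0" using ring_len_ge[OF assms, of m] by linarith
  have *: "{map (Pair m) [0..<?N] ! i, map (Pair m) [0..<?N] ! (Suc i mod ?N)} =
        {ring_vertex t m (int i), ring_vertex t m (int i + 1)}" if "i < ?N" for i
  proof -
    have "Suc i mod ?N < ?N" using pos by simp
    moreover have "ring_vertex t m (int i + 1) = (m, Suc i mod ?N)"
      by (simp add: ring_vertex_def) (metis nat_int of_nat_Suc zmod_int add.commute)
    ultimately show ?thesis using that by (simp add: ring_vertex_of_nat)
  qed
  have "edges (ring_cycle t m) = {{ring_vertex t m (int i), ring_vertex t m (int i + 1)} | i. i < ?N}"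
    unfolding ring_cycle_def cycle_on_def ring_len_def[symmetric]
    using * by (simp del: nth_map) (metis (no_types, lifting))
  also have "\<dots> = range (\<lambda>a. {ring_vertex t m a, ring_vertex t m (a + 1)})"
  proof -
    have "\<exists>i. {ring_vertex t m a, ring_vertex t m (a + 1)} =
        {ring_vertex t m (int i), ring_vertex t m (int i + 1)} \<and> i < ?N" for a
    proof (intro exI conjI)
      let ?i = "nat (a mod int ?N)"
      have i: "int ?i = a mod int ?N" using pos by simp
      then have "int ?N dvd a - int ?i" by (simp add: minus_mod_eq_mult_div)
      then have "ring_vertex t m a = ring_vertex t m (int ?i)"
          "ring_vertex t m (a + 1) = ring_vertex t m (int ?i + 1)"
        unfolding ring_vertex_eq_iff[OF assms] by (simp_all only: add_diff_cancel_right)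
      then show "{ring_vertex t m a, ring_vertex t m (a + 1)} =
        {ring_vertex t m (int ?i), ring_vertex t m (int ?i + 1)}" by simp
      show "?i < ?N" using pos by (simp add: nat_less_iff)
    qed
    then show ?thesis unfolding full_SetCompr_eq[symmetric] by (intro equalityI subsetI) (blast, force)
  qed
  finally show ?thesis .
qed

lemma ring_edge_iff:
  assumes "t \<ge> 5"
  shows "{ring_vertex t m a, ring_vertex t m b} \<in> edges (ring_cycle t m) \<longleftrightarrow>
    int (ring_len t m) dvd b - a - 1 \<or> int (ring_len t m) dvd a - b - 1"
proof
  assume "{ring_vertex t m a, ring_vertex t m b} \<in> edges (ring_cycle t m)"
  then obtain z where "{ring_vertex t m a, ring_vertex t m b} = {ring_vertex t m z, ring_vertex t m (z + 1)}"
    by (auto simp: edges_ring_cycle[OF assms])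
  then consider "int (ring_len t m) dvd a - z" "int (ring_len t m) dvd b - (z + 1)"
    | "int (ring_len t m) dvd b - z" "int (ring_len t m) dvd a - (z + 1)"
    by (auto simp: doubleton_eq_iff ring_vertex_eq_iff[OF assms])
  then show "int (ring_len t m) dvd b - a - 1 \<or> int (ring_len t m) dvd a - b - 1"
  proof cases
    case 1
    from dvd_diff[OF 1(2) 1(1)] show ?thesis by (simp add: algebra_simps)
  next
    case 2
    from dvd_diff[OF 2(2) 2(1)] show ?thesis by (simp add: algebra_simps)
  qed
next
  assume "int (ring_len t m) dvd b - a - 1 \<or> int (ring_len t m) dvd a - b - 1"
  then have "ring_vertex t m b = ring_vertex t m (a + 1) \<or> ring_vertex t m a = ring_vertex t m (b + 1)"
    by (simp add: ring_vertex_eq_iff[OF assms] algebra_simps)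
  then show "{ring_vertex t m a, ring_vertex t m b} \<in> edges (ring_cycle t m)"
    unfolding edges_ring_cycle[OF assms] by (auto simp: insert_commute)
qed

lemma verts_nested_rings: "verts (nested_rings t m) = {(l, j). l \<le> m \<and> j < ring_len t l}"
  by (induction m) (auto simp: verts_ring_cycle le_Suc_eq)

text \<open>Spokes may be indexed by integers too: a multiple of the old ring length, times
  \<open>t - 3\<close>, is a multiple of the new one, so both ends depend only on the
  residue.\<close>

lemma edges_nested_rings_Suc:
  assumes "t \<ge> 5"
  shows "edges (nested_rings t (Suc m)) = edges (nested_rings t m) \<union> edges (ring_cycle t (Suc m)) \<union>
    range (\<lambda>a. {ring_vertex t m a, ring_vertex t (Suc m) (a * int (t - 3))})"
proof -
  have pos: "ring_len t m > 0" using ring_len_ge[OF assms, of m] by linarith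
  have *: "ring_vertex t (Suc m) (int i * int (t - 3)) = (Suc m, i * (t - 3))" if "i < ring_len t m" for i
    using that assms ring_vertex_of_nat[of "i * (t - 3)" t "Suc m"] by (simp add: ring_len_Suc)
  have "{{(m, i), (Suc m, i * (t - 3))} | i. i < t * (t - 3) ^ m} =
    {{ring_vertex t m (int i), ring_vertex t (Suc m) (int i * int (t - 3))} | i. i < ring_len t m}"
    unfolding ring_len_def[symmetric] using * ring_vertex_of_nat by (metis (no_types, lifting))
  also have "\<dots> = range (\<lambda>a. {ring_vertex t m a, ring_vertex t (Suc m) (a * int (t - 3))})"
  proof -
    have "\<exists>i. {ring_vertex t m a, ring_vertex t (Suc m) (a * int (t - 3))} =
        {ring_vertex t m (int i), ring_vertex t (Suc m) (int i * int (t - 3))} \<and> i < ring_len t m" for a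
    proof (intro exI conjI)
      let ?i = "nat (a mod int (ring_len t m))"
      have i: "int ?i = a mod int (ring_len t m)" using pos by simp
      then have d: "int (ring_len t m) dvd a - int ?i" by (simp add: minus_mod_eq_mult_div)
      then have "int (ring_len t m) * int (t - 3) dvd (a - int ?i) * int (t - 3)" by (rule mult_dvd_mono) simp
      then have d': "int (ring_len t (Suc m)) dvd a * int (t - 3) - int ?i * int (t - 3)"
        by (simp add: ring_len_Suc left_diff_distrib)
      show "{ring_vertex t m a, ring_vertex t (Suc m) (a * int (t - 3))} =
        {ring_vertex t m (int ?i), ring_vertex t (Suc m) (int ?i * int (t - 3))}"
        using ring_vertex_eq_iff[OF assms, THEN iffD2, OF d] ring_vertex_eq_iff[OF assms, THEN iffD2, OF d']
        by simp
      show "?i < ring_len t m" using pos by (simp add: nat_less_iff)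
    qed
    then show ?thesis unfolding full_SetCompr_eq[symmetric] by (intro equalityI subsetI) (blast, force)
  qed
  finally show ?thesis by simp
qed

lemma nested_rings_edge_verts:
  assumes "t \<ge> 5" "e \<in> edges (nested_rings t m)"
  shows "e \<subseteq> verts (nested_rings t m)"
  using assms(2)
proof (induction m)
  case 0
  then show ?case using verts_ring_cycle'[OF assms(1), of 0]
    by (auto simp: edges_ring_cycle[OF assms(1)])
next
  case (Suc m)
  have "ring_vertex t m a \<in> verts (nested_rings t m)" for a
    using verts_ring_cycle'[OF assms(1), of m] by (cases m) auto
  moreover have "ring_vertex t (Suc m) a \<in> verts (ring_cycle t (Suc m))" for a
    using verts_ring_cycle'[OF assms(1), of "Suc m"] by auto
  ultimately show ?case using Suc unfolding edges_nested_rings_Suc[OF assms(1)]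
    by (auto simp: edges_ring_cycle[OF assms(1)])
qed

lemma nested_ring_edge_fst:
  assumes "t \<ge> 5" "e \<in> edges (nested_rings t m)" "v \<in> e"
  shows "fst v \<le> m"
  using nested_rings_edge_verts[OF assms(1,2)] assms(3) by (auto simp: verts_nested_rings)

lemma ring_subset_nested: "edges (ring_cycle t m) \<subseteq> edges (nested_rings t m)"
  by (cases m) auto

text \<open>Spokes and edges of inner rings have an end of smaller level, so the outermost ring is
  induced.\<close>

lemma nested_outer_edge:
  assumes "t \<ge> 5" "{a, b} \<in> edges (nested_rings t m)" "fst a = m" "fst b = m"
  shows "{a, b} \<in> edges (ring_cycle t m)"
proof (cases m)
  case 0
  then show ?thesis using assms by simp
next
  case (Suc l)
  then show ?thesis
    using assms nested_ring_edge_fst[OF assms(1), of "{a, b}" l a]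
    by (auto simp: edges_nested_rings_Suc[OF assms(1)] doubleton_eq_iff)
qed

section \<open>Tiling of the nested rings\<close>

declare nested_rings.simps(2) [simp del]

text \<open>Equality and adjacency on a ring are divisibility statements; they are refuted by this
  lemma because the index differences that occur are smaller than the ring length.\<close>

lemma dvd_small_int:
  fixes N z :: int
  assumes "N dvd z" "- N < z" "z < N"
  shows "z = 0"
proof (rule ccontr)
  assume "z \<noteq> 0"
  then have "\<bar>N\<bar> \<le> \<bar>z\<bar>" using assms(1) by (rule dvd_imp_le_int)
  then show False using assms(2,3) by linarith
qed

text \<open>The ring is its own only tile and all edges are boundary edges, so no pair of tiles is
  required yet.\<close>

lemma tiled_ring_0:
  assumes t: "t \<ge> 5"
  shows "tiled t (nested_rings t 0) (ring_cycle t 0)"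
proof -
  have len: "ring_len t 0 = t" by (simp add: ring_len_def)
  have "icycle (edges (ring_cycle t 0)) t (Pair 0)"
    unfolding icycle_def
  proof (intro conjI allI impI)
    fix i j :: nat assume ij: "i < j" "j < t"
    have "{(0, i), (0, j)} \<in> edges (ring_cycle t 0) \<longleftrightarrow>
        int t dvd int j - int i - 1 \<or> int t dvd int i - int j - 1"
      using ring_edge_iff[OF t, of 0 "int i" "int j"] ij by (simp add: ring_vertex_of_nat len)
    also have "\<dots> \<longleftrightarrow> j = Suc i \<or> (i = 0 \<and> Suc j = t)"
    proof
      assume "int t dvd int j - int i - 1 \<or> int t dvd int i - int j - 1"
      then show "j = Suc i \<or> (i = 0 \<and> Suc j = t)"
      proof
        assume "int t dvd int j - int i - 1"
        from dvd_small_int[OF this] ij show ?thesis by linarith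
      next
        assume "int t dvd int i - int j - 1"
        \<comment> \<open>The shift by \<open>t\<close> moves the difference into the range of
          \<open>dvd_small_int\<close>; it vanishes only for \<open>i = 0\<close> and
          \<open>j = t - 1\<close>.\<close>
        then have "int t dvd (int i - int j - 1) + int t" by simp
        from dvd_small_int[OF this] ij show ?thesis by linarith
      qed
    next
      assume "j = Suc i \<or> (i = 0 \<and> Suc j = t)"
      then have "int j - int i - 1 = 0 \<or> int i - int j - 1 = - int t" by linarith
      then show "int t dvd int j - int i - 1 \<or> int t dvd int i - int j - 1"
        by (metis dvd_0_right dvd_minus_iff dvd_refl)
    qed
    finally show "{(0, i), (0, j)} \<in> edges (ring_cycle t 0) \<longleftrightarrow> j = Suc i \<or> (i = 0 \<and> Suc j = t)" .
  qed (simp add: inj_on_def)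
  then have "induces_cycle (edges (ring_cycle t 0)) t (Pair 0 ` {..<t})"
    unfolding induces_cycle_def by blast
  moreover have "e \<subseteq> Pair 0 ` {..<t}" if "e \<in> edges (ring_cycle t 0)" for e
    using nested_rings_edge_verts[OF t, of e 0] that by (auto simp: verts_ring_cycle len)
  ultimately show ?thesis unfolding tiled_def nested_rings.simps by blast
qed

text \<open>Each edge of the old ring receives a new tile \<open>F i\<close> on its outer side. Old
  boundary edges pair their old tile with \<open>F i\<close>, spokes pair \<open>F (a - 1)\<close>
  with \<open>F a\<close>, and each edge of the new ring lies on some \<open>F i\<close>.\<close>

lemma tiled_ring_Suc:
  assumes t: "t \<ge> 5" and IH: "tiled t (nested_rings t m) (ring_cycle t m)"
  shows "tiled t (nested_rings t (Suc m)) (ring_cycle t (Suc m))"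
proof -
  define r where "r = int (t - 3)"
  define N where "N = int (ring_len t m)"
  define M where "M = int (ring_len t (Suc m))"
  define X where "X = ring_vertex t m"
  define W where "W = ring_vertex t (Suc m)"
  let ?V = "verts (nested_rings t m)"
  let ?E = "edges (nested_rings t m)" and ?E' = "edges (nested_rings t (Suc m))"
  have r: "r \<ge> 2" "int t = r + 3" using t by (auto simp: r_def)
  have N5: "N \<ge> 5" using ring_len_ge[OF t, of m] by (simp add: N_def)
  have M: "M = N * r" by (simp add: M_def N_def ring_len_Suc r_def)
  \<comment> \<open>Across two neighbouring tiles, index differences on the new ring are at most
    \<open>2 * r + 1\<close>, including the shift by one in an adjacency, hence below
    \<open>5 * r\<close>: nothing wraps around.\<close>
  have M5: "M \<ge> 5 * r" unfolding M using N5 r by (intro mult_right_mono) auto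
  have E': "?E' = ?E \<union> edges (ring_cycle t (Suc m)) \<union> range (\<lambda>a. {X a, W (a * r)})"
    unfolding edges_nested_rings_Suc[OF t] X_def W_def r_def by simp
  have fstX [simp]: "fst (X a) = m" and fstW [simp]: "fst (W a) = Suc m" for a
    by (simp_all add: X_def W_def)
  have fstV: "fst v \<le> m" if "v \<in> ?V" for v using that by (auto simp: verts_nested_rings)
  have ringV: "verts (ring_cycle t m) \<subseteq> ?V" by (auto simp: verts_ring_cycle verts_nested_rings)
  then have XV: "X a \<in> ?V" for a using verts_ring_cycle'[OF t, of m] by (auto simp: X_def)
  have EV: "\<Union>?E \<subseteq> ?V" using nested_rings_edge_verts[OF t, of _ m] by blast
  have ring_fst: "fst v = Suc m" if "v \<in> e" "e \<in> edges (ring_cycle t (Suc m))" for v e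
    using that unfolding edges_ring_cycle[OF t] by auto
  have old: "{a, b} \<in> ?E' \<longleftrightarrow> {a, b} \<in> ?E" if "a \<in> ?V" "b \<in> ?V" for a b
  proof -
    have "fst a \<le> m" "fst b \<le> m" using that fstV by auto
    then show ?thesis unfolding E' using ring_fst[of a "{a, b}"] by (auto simp: doubleton_eq_iff)
  qed
  have WW: "{W a, W b} \<in> ?E' \<longleftrightarrow> M dvd b - a - 1 \<or> M dvd a - b - 1" for a b
  proof -
    have "{W a, W b} \<in> ?E' \<longleftrightarrow> {W a, W b} \<in> edges (ring_cycle t (Suc m))"
      using nested_outer_edge[OF t, of "W a" "W b" "Suc m"] ring_subset_nested[of t "Suc m"] by auto
    then show ?thesis unfolding W_def M_def ring_edge_iff[OF t] .
  qed
  have Weq: "W a = W b \<longleftrightarrow> M dvd a - b" for a b unfolding W_def M_def ring_vertex_eq_iff[OF t] ..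
  have Xeq: "X a = X b \<longleftrightarrow> N dvd a - b" for a b unfolding X_def N_def ring_vertex_eq_iff[OF t] ..
  have XX: "{X a, X b} \<in> ?E' \<longleftrightarrow> N dvd b - a - 1 \<or> N dvd a - b - 1" for a b
  proof -
    have "{X a, X b} \<in> ?E' \<longleftrightarrow> {X a, X b} \<in> edges (ring_cycle t m)"
      using nested_outer_edge[OF t, of "X a" "X b" m] ring_subset_nested[of t m] old[OF XV XV] by auto
    then show ?thesis unfolding X_def N_def ring_edge_iff[OF t] .
  qed
  \<comment> \<open>Spokes are the only edges between the old vertices and the new ring.\<close>
  have VW: "\<exists>a. v = X a \<and> W b = W (a * r)" if vw: "{v, W b} \<in> ?E'" "v \<in> ?V" for v b
  proof -
    have "{v, W b} \<notin> ?E" using nested_ring_edge_fst[OF t, of "{v, W b}" m "W b"] by auto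
    moreover have "{v, W b} \<notin> edges (ring_cycle t (Suc m))"
      using ring_fst[of v "{v, W b}"] fstV[OF vw(2)] by auto
    ultimately obtain a where "{v, W b} = {X a, W (a * r)}" using vw(1) unfolding E' by blast
    moreover have "v \<noteq> W (a * r)" using fstV[OF vw(2)] by auto
    ultimately show ?thesis by (auto simp: doubleton_eq_iff)
  qed
  have XW: "{X a, W b} \<in> ?E' \<longleftrightarrow> M dvd b - a * r" for a b
  proof
    assume "{X a, W b} \<in> ?E'"
    then obtain a' where "X a = X a'" "W b = W (a' * r)" using VW[OF _ XV] by blast
    then have "N dvd a' - a" "M dvd b - a' * r" using Xeq[of a' a] Weq by simp_all
    then have "N * r dvd (a' - a) * r" "M dvd b - a' * r" by simp_all
    then have "M dvd (b - a' * r) + (a' - a) * r" unfolding M by (intro dvd_add)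
    then show "M dvd b - a * r" by (simp add: algebra_simps)
  next
    assume "M dvd b - a * r"
    then have "W b = W (a * r)" using Weq by simp
    then show "{X a, W b} \<in> ?E'" unfolding E' by auto
  qed
  have XnW: "X a \<noteq> W b" for a b by (metis fstX fstW n_not_Suc_n)

  \<comment> \<open>The \<open>t - 2 = r + 1\<close> outer vertices run from the foot of the spoke
    at \<open>X i\<close> to the foot of the spoke at \<open>X (i + 1)\<close>, both
    included.\<close>
  define F where "F i = {X i, X (i + 1)} \<union> (\<lambda>k. W (i * r + int k)) ` {..<t - 2}" for i
  have face: "induces_cycle ?E' t (F i)" for i
    unfolding F_def
  proof (rule induces_cycle_ear)
    show "inj_on (\<lambda>k. W (i * r + int k)) {..<t - 2}"
    proof (rule inj_onI)
      fix x y assume xy: "x \<in> {..<t - 2}" "y \<in> {..<t - 2}" "W (i * r + int x) = W (i * r + int y)"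
      then have d: "M dvd int x - int y" by (simp add: Weq)
      show "x = y" using dvd_small_int[OF d] xy M5 r by auto
    qed
    show "X i \<noteq> X (i + 1)" using dvd_small_int[of N "-1"] N5 by (auto simp: Xeq)
    show "X i \<notin> (\<lambda>k. W (i * r + int k)) ` {..<t - 2}" "X (i + 1) \<notin> (\<lambda>k. W (i * r + int k)) ` {..<t - 2}"
      using XnW by auto
    show "{X i, X (i + 1)} \<in> ?E'" by (simp add: XX)
    show "{W (i * r + int j), W (i * r + int k)} \<in> ?E' \<longleftrightarrow> k = Suc j" if "j < k" "k < t - 2" for j k
    proof -
      have "M dvd int k - int j - 1 \<Longrightarrow> k = Suc j"
        using dvd_small_int[of M "int k - int j - 1"] that M5 r by linarith
      moreover have "\<not> M dvd int j - int k - 1"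
        using dvd_small_int[of M "int j - int k - 1"] that M5 r by linarith
      ultimately show ?thesis by (auto simp: WW)
    qed
    show "{X i, W (i * r + int k)} \<in> ?E' \<longleftrightarrow> k = 0" if "k < t - 2" for k
      using dvd_small_int[of M "int k"] that M5 r by (auto simp: XW)
    show "{X (i + 1), W (i * r + int k)} \<in> ?E' \<longleftrightarrow> Suc k = t - 2" if "k < t - 2" for k
    proof -
      have "M dvd int k - r \<longleftrightarrow> int k = r" using dvd_small_int[of M "int k - r"] that M5 r by auto
      moreover have "int k = r \<longleftrightarrow> Suc k = t - 2" using r that by linarith
      ultimately show ?thesis by (simp add: XW algebra_simps)
    qed
    show "t = t - 2 + 2" "t - 2 \<ge> 1" using t by auto
  qed
  have Fcases: "v = X i \<or> v = X (i + 1) \<or> (\<exists>k. v = W (i * r + int k) \<and> int k \<le> r)" if "v \<in> F i" for v i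
    using that r by (auto simp: F_def)
  have WF: "W (i * r + k) \<in> F i" if "0 \<le> k" "k \<le> r" for i k
    unfolding F_def using that r by (auto simp: image_iff intro!: bexI[of _ "nat k"])

  show ?thesis unfolding tiled_def
  proof
    fix e assume e: "e \<in> ?E'"
    consider "e \<in> ?E - edges (ring_cycle t m)" | "e \<in> edges (ring_cycle t m)"
      | "e \<in> edges (ring_cycle t (Suc m))" | a where "e = {X a, W (a * r)}"
      using e unfolding E' by blast
    then show "theta ?E' t e \<or> e \<in> edges (ring_cycle t (Suc m)) \<and>
        (\<exists>S. induces_cycle ?E' t S \<and> e \<subseteq> S)"
    proof cases
      case 1
      then have "theta ?E t e" using IH unfolding tiled_def by blast
      then show ?thesis using theta_cong[of ?E t e ?V ?E'] EV old t by auto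
    next
      case 2
      then obtain i where i: "e = {X i, X (i + 1)}" by (auto simp: edges_ring_cycle[OF t] X_def)
      have "e \<in> ?E" using 2 ring_subset_nested by blast
      then obtain S where S: "induces_cycle ?E t S" "e \<subseteq> S" using tiled_face[OF IH] by blast
      have SV: "S \<subseteq> ?V" using induces_cycle_in_Union[OF S(1)] t EV by auto
      have "theta ?E' t e"
      proof (rule thetaI)
        show "induces_cycle ?E' t S" by (rule induces_cycle_cong[OF S(1)], rule old) (use SV in blast)+
        show "induces_cycle ?E' t (F i)" by (rule face)
        have "W k \<notin> S" for k using SV fstV[of "W k"] by auto
        then show "S \<inter> F i = e" using S(2) i Fcases[of _ i] by (auto simp: F_def)
        fix a b assume a: "a \<in> S - e" and b: "b \<in> F i - e"
        obtain k where k: "b = W (i * r + int k)" "int k \<le> r" using b i Fcases[of b i] by blast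
        show "{a, b} \<notin> ?E'"
        proof
          assume *: "{a, b} \<in> ?E'"
          then obtain j where j: "a = X j" using VW[of a "i * r + int k"] k a SV by blast
          have "M dvd i * r + int k - j * r" using * XW j k by simp
          then have d: "N * r dvd (i - j) * r + int k" unfolding M by (simp add: algebra_simps)
          \<comment> \<open>Being adjacent to a vertex of the old ring, \<open>b\<close> is the foot
            of a spoke. Within \<open>F i\<close> this leaves only the two end positions, and then
            \<open>a\<close> is \<open>X i\<close> or \<open>X (i + 1)\<close>, that is, in
            \<open>e\<close>.\<close>
          then have "r dvd int k" by (metis dvd_add_times_triv_left_iff dvd_mult_right mult.commute)
          then have "int k = 0 \<or> int k = r" using k r by (metis zdvd_not_zless of_nat_0_le_iff order_le_less)
          then have "N * r dvd (i - j) * r \<or> N * r dvd (i + 1 - j) * r" using d by (auto simp: algebra_simps)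
          then have "N dvd i - j \<or> N dvd i + 1 - j" using r by auto
          then have "X i = X j \<or> X (i + 1) = X j" by (simp add: Xeq)
          then show False using a i j by auto
        qed
      qed
      then show ?thesis ..
    next
      case 3
      then obtain z where z: "e = {W z, W (z + 1)}" by (auto simp: edges_ring_cycle[OF t] W_def)
      \<comment> \<open>The tile at the edge from \<open>z\<close> to \<open>z + 1\<close> has index
        \<open>z div r\<close>; because \<open>z mod r + 1 <= r\<close>, the edge does not run into
        the next tile.\<close>
      have "z div r * r + z mod r = z" "z div r * r + (z mod r + 1) = z + 1"
        by (simp_all flip: add.assoc)
      moreover have "0 \<le> z mod r" "z mod r + 1 \<le> r" using r by (auto simp: add1_zle_eq)
      ultimately have "e \<subseteq> F (z div r)"
        using z WF[of "z mod r" "z div r"] WF[of "z mod r + 1" "z div r"] by simp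
      then show ?thesis using 3 face by blast
    next
      case 4
      have "theta ?E' t e"
      proof (rule thetaI)
        show "induces_cycle ?E' t (F (a - 1))" "induces_cycle ?E' t (F a)" by (rule face)+
        \<comment> \<open>Positions are counted from the foot \<open>W (a * r)\<close> of the spoke,
          backwards here and forwards in \<open>F2\<close>, so vertices on the two sides differ by
          \<open>k + l\<close>.\<close>
        have F1: "v \<in> e \<or> v = X (a - 1) \<or> (\<exists>k. v = W (a * r - k) \<and> 1 \<le> k \<and> k \<le> r)" if v: "v \<in> F (a - 1)" for v
        proof -
          consider "v = X (a - 1)" | "v = X a" | k where "v = W ((a - 1) * r + int k)" "int k \<le> r"
            using Fcases[OF v] by auto
          then show ?thesis
          proof cases
            case (3 k)
            then have "v = W (a * r - (r - int k))" by (simp add: algebra_simps)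
            then show ?thesis using 3 4
              by (cases "int k = r") (auto intro!: exI[of _ "r - int k"])
          qed (use 4 in auto)
        qed
        have F2: "v \<in> e \<or> v = X (a + 1) \<or> (\<exists>k. v = W (a * r + k) \<and> 1 \<le> k \<and> k \<le> r)" if v: "v \<in> F a" for v
        proof -
          consider "v = X a" | "v = X (a + 1)" | k where "v = W (a * r + int k)" "int k \<le> r"
            using Fcases[OF v] by auto
          then show ?thesis
          proof cases
            case (3 k)
            then show ?thesis using 4 by (cases "k = 0") (auto intro!: exI[of _ "int k"])
          qed (use 4 in auto)
        qed
        have X2: "X (a - 1) \<noteq> X (a + 1)" using dvd_small_int[of N "- 2"] N5 by (auto simp: Xeq)
        have X2': "{X (a - 1), X (a + 1)} \<notin> ?E'"
          using dvd_small_int[of N "1"] dvd_small_int[of N "- 3"] N5 by (auto simp: XX)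
        have W2: "W (a * r - k) \<noteq> W (a * r + l)" "{W (a * r - k), W (a * r + l)} \<notin> ?E'"
          "{X (a - 1), W (a * r + l)} \<notin> ?E'" "{W (a * r - k), X (a + 1)} \<notin> ?E'"
          if "1 \<le> k" "k \<le> r" "1 \<le> l" "l \<le> r" for k l
        proof -
          show "W (a * r - k) \<noteq> W (a * r + l)"
            using dvd_small_int[of M "- k - l"] that M5 r by (auto simp: Weq)
          have "\<not> M dvd (a * r + l) - (a * r - k) - 1" "\<not> M dvd (a * r - k) - (a * r + l) - 1"
            using dvd_small_int[of M "(a * r + l) - (a * r - k) - 1"]
              dvd_small_int[of M "(a * r - k) - (a * r + l) - 1"] that M5 r by linarith+
          then show "{W (a * r - k), W (a * r + l)} \<notin> ?E'" by (simp add: WW)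
          have "\<not> M dvd a * r + l - (a - 1) * r"
            using dvd_small_int[of M "l + r"] that M5 r by (auto simp: algebra_simps)
          then show "{X (a - 1), W (a * r + l)} \<notin> ?E'" by (simp add: XW)
          have "\<not> M dvd (a * r - k) - (a + 1) * r"
            using dvd_small_int[of M "- k - r"] that M5 r by (auto simp: algebra_simps)
          then show "{W (a * r - k), X (a + 1)} \<notin> ?E'" by (simp add: XW insert_commute)
        qed
        have ine: "e \<subseteq> F (a - 1)" "e \<subseteq> F a"
          using 4 WF[of r "a - 1"] WF[of 0 a] r by (auto simp: F_def algebra_simps)
        have main: "v \<noteq> w \<and> {v, w} \<notin> ?E'" if v: "v \<in> F (a - 1) - e" and w: "w \<in> F a - e" for v w
        proof -
          have "v = X (a - 1) \<or> (\<exists>k. v = W (a * r - k) \<and> 1 \<le> k \<and> k \<le> r)" using F1 v by blast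
          moreover have "w = X (a + 1) \<or> (\<exists>k. w = W (a * r + k) \<and> 1 \<le> k \<and> k \<le> r)" using F2 w by blast
          ultimately show ?thesis
            using X2 X2' W2 XnW XnW[symmetric] W2(3)[of 1] W2(4)[of _ 1] r by (elim disjE exE conjE) auto
        qed
        then show "F (a - 1) \<inter> F a = e" using ine by blast
        show "{v, w} \<notin> ?E'" if "v \<in> F (a - 1) - e" "w \<in> F a - e" for v w using main that by blast
      qed
      then show ?thesis ..
    qed
  qed
qed

lemma tiled_nested_rings:
  assumes "t \<ge> 5"
  shows "tiled t (nested_rings t m) (ring_cycle t m)"
  by (induction m) (use assms tiled_ring_0 tiled_ring_Suc in blast)+

section \<open>Expansions\<close>

lemma distinct_concat_disjoint:
  assumes "distinct (concat (map f [0..<k]))" "i < k" "j < k" "i \<noteq> j"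
  shows "set (f i) \<inter> set (f j) = {}"
proof -
  have "set (f i) \<inter> set (f j) = {}" if "i < j" "j < k" for i j
    using assms(1) that
  proof (induction k)
    case (Suc k)
    then have IH: "j < k \<Longrightarrow> set (f i) \<inter> set (f j) = {}" and
      "\<Union> (set ` f ` {0..<k}) \<inter> set (f k) = {}" by auto
    moreover have "set (f i) \<subseteq> \<Union> (set ` f ` {0..<k})" using Suc.prems by auto
    ultimately show ?case using Suc.prems by (cases "j = k") auto
  qed simp
  from this[of i j] this[of j i] assms show ?thesis by (cases "i < j") (auto simp: Int_commute)
qed

lemma distinct_concat_each:
  assumes "distinct (concat (map f [0..<k]))" "i < k"
  shows "distinct (f i)"
  using assms by (auto simp: distinct_concat_iff)

text \<open>The data of an expansion together with \<open>no_triangle\<close>. As \<open>B'\<close>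
  is an induced cycle, that condition just says that \<open>B'\<close> is not a triangle when
  \<open>k > 0\<close>; for the rings it comes from their length.\<close>

locale expansion_data =
  fixes t :: nat and T' B' :: "'a graph" and k :: nat and x xm xp :: "nat \<Rightarrow> 'a"
    and I :: "nat set" and P Q :: "nat \<Rightarrow> 'a list"
  assumes t5: "t \<ge> 5"
    and terr: "territory T' B'"
    and injx: "inj_on x {..<k}" and xB': "x ` {..<k} \<subseteq> verts B'"
    and stable: "\<forall>i<k. \<forall>j<k. {x i, x j} \<notin> edges B'"
    and nbrs: "\<forall>i<k. xm i \<noteq> xp i \<and> neighbours B' (x i) = {xm i, xp i}"
    and I: "I \<subseteq> {..<k}"
    and lenP: "\<forall>i<k. length (P i) = 2 * t - 6 + 1"
    and lenQ: "\<forall>i\<in>I. length (Q i) = t - 4 + 1"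
    and dist: "distinct (concat (map (\<lambda>i. P i @ (if i \<in> I then Q i else [])) [0..<k]))"
    and newP: "\<forall>i<k. set (P i) \<inter> verts T' = {}"
    and newQ: "\<forall>i\<in>I. set (Q i) \<inter> verts T' = {}"
    and no_triangle: "\<forall>i<k. {xm i, xp i} \<notin> edges T'"
begin

definition T where
  "T = Graph
          (verts T' \<union> (\<Union>i<k. set (P i)) \<union> (\<Union>i\<in>I. set (Q i)))
          (edges T' \<union>
           (\<Union>i<k. edges (path_on (P i)) \<union>
              {{xm i, hd (P i)}, {x i, P i ! (t - 3)}, {xp i, last (P i)}}) \<union>
           (\<Union>i\<in>I. edges (path_on (Q i)) \<union>
              {{P i ! (t - 4), hd (Q i)}, {P i ! (t - 2), last (Q i)}}))"

definition B where
  "B = graph_Union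
          (insert (induced B' (verts B' - x ` {..<k}))
             ((\<lambda>i. path_on (expansion_path t I xm xp P Q i)) ` {..<k}))"

abbreviation E where "E \<equiv> edges T"

lemma Ik: "i \<in> I \<Longrightarrow> i < k" using I by auto

lemma Pinj:
  assumes "i < k" "i' < k" "j < 2 * t - 5" "j' < 2 * t - 5"
  shows "P i ! j = P i' ! j' \<longleftrightarrow> i = i' \<and> j = j'"
proof -
  have len: "length (P i) = 2 * t - 5" "length (P i') = 2 * t - 5" using lenP assms t5 by auto
  have "distinct (P i)" using distinct_concat_each[OF dist] assms by auto
  then have "i = i' \<Longrightarrow> ?thesis" using len assms by (auto simp: nth_eq_iff_index_eq)
  moreover have "P i ! j \<in> set (P i)" "P i' ! j' \<in> set (P i')" using len assms by auto
  then have "i \<noteq> i' \<Longrightarrow> ?thesis" using distinct_concat_disjoint[OF dist, of i i'] assms by auto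
  ultimately show ?thesis by blast
qed

lemma Qinj:
  assumes "i \<in> I" "i' \<in> I" "j < t - 3" "j' < t - 3"
  shows "Q i ! j = Q i' ! j' \<longleftrightarrow> i = i' \<and> j = j'"
proof -
  have len: "length (Q i) = t - 3" "length (Q i') = t - 3" using lenQ assms t5 by auto
  have ik: "i < k" "i' < k" using Ik assms by auto
  have "distinct (Q i)" using distinct_concat_each[OF dist ik(1)] assms by auto
  then have "i = i' \<Longrightarrow> ?thesis" using len assms by (auto simp: nth_eq_iff_index_eq)
  moreover have "Q i ! j \<in> set (Q i)" "Q i' ! j' \<in> set (Q i')" using len assms by auto
  then have "i \<noteq> i' \<Longrightarrow> ?thesis" using distinct_concat_disjoint[OF dist ik] assms by auto
  ultimately show ?thesis by blast
qed

lemma PQ_ne: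
  assumes "i < k" "i' \<in> I" "j < 2 * t - 5" "j' < t - 3"
  shows "P i ! j \<noteq> Q i' ! j'" "Q i' ! j' \<noteq> P i ! j"
proof -
  have len: "length (P i) = 2 * t - 5" "length (Q i') = t - 3" using lenP lenQ assms t5 by auto
  have ik: "i' < k" using Ik assms by auto
  have *: "P i ! j \<in> set (P i)" "Q i' ! j' \<in> set (Q i')" using len assms by auto
  have "P i ! j \<noteq> Q i' ! j'"
  proof (cases "i = i'")
    case True
    then show ?thesis using distinct_concat_each[OF dist ik] * assms by auto
  next
    case False
    then show ?thesis using distinct_concat_disjoint[OF dist assms(1) ik] * assms by auto
  qed
  then show "P i ! j \<noteq> Q i' ! j'" "Q i' ! j' \<noteq> P i ! j" by auto
qed

lemma P_new: "i < k \<Longrightarrow> j < 2 * t - 5 \<Longrightarrow> P i ! j \<notin> verts T'"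
proof -
  assume *: "i < k" "j < 2 * t - 5"
  then have "P i ! j \<in> set (P i)" using lenP t5 by auto
  then show ?thesis using newP * by auto
qed

lemma Q_new: "i \<in> I \<Longrightarrow> j < t - 3 \<Longrightarrow> Q i ! j \<notin> verts T'"
proof -
  assume *: "i \<in> I" "j < t - 3"
  then have "Q i ! j \<in> set (Q i)" using lenQ t5 by auto
  then show ?thesis using newQ * by auto
qed

lemma B'_sub: "verts B' \<subseteq> verts T'" "edges B' \<subseteq> edges T'"
  and B'_induced: "\<And>a b. a \<in> verts B' \<Longrightarrow> b \<in> verts B' \<Longrightarrow> {a, b} \<in> edges T' \<Longrightarrow> {a, b} \<in> edges B'"
  and T'_simple: "\<And>e. e \<in> edges T' \<Longrightarrow> e \<subseteq> verts T' \<and> card e = 2"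
  and B'_verts: "\<And>e. e \<in> edges B' \<Longrightarrow> e \<subseteq> verts B'"
proof -
  have B': "edges B' = {e \<in> edges T'. e \<subseteq> verts B'}"
    using terr unfolding territory_def by (metis graph.sel(2) induced_def)
  then show "edges B' \<subseteq> edges T'" "\<And>e. e \<in> edges B' \<Longrightarrow> e \<subseteq> verts B'"
    "\<And>a b. a \<in> verts B' \<Longrightarrow> b \<in> verts B' \<Longrightarrow> {a, b} \<in> edges T' \<Longrightarrow> {a, b} \<in> edges B'" by auto
  show "verts B' \<subseteq> verts T'" "\<And>e. e \<in> edges T' \<Longrightarrow> e \<subseteq> verts T' \<and> card e = 2"
    using terr by (auto simp: territory_def simple_graph_def)
qed

lemma x_nbrs:
  assumes "i < k"
  shows "x i \<in> verts T'" "xm i \<in> verts T'" "xp i \<in> verts T'"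
    "x i \<in> verts B'" "xm i \<in> verts B'" "xp i \<in> verts B'" "xm i \<noteq> xp i" "x i \<noteq> xm i" "x i \<noteq> xp i"
    "{xm i, x i} \<in> edges B'" "{xp i, x i} \<in> edges B'" "{xm i, x i} \<in> edges T'" "{xp i, x i} \<in> edges T'"
    "xm i \<notin> x ` {..<k}" "xp i \<notin> x ` {..<k}"
proof -
  show x: "x i \<in> verts B'" using xB' assms by auto
  have "xm i \<in> neighbours B' (x i)" "xp i \<in> neighbours B' (x i)" using nbrs assms by auto
  then show m: "xm i \<in> verts B'" "xp i \<in> verts B'" "{xm i, x i} \<in> edges B'" "{xp i, x i} \<in> edges B'"
    by (auto simp: neighbours_def)
  then show e: "{xm i, x i} \<in> edges T'" "{xp i, x i} \<in> edges T'" using B'_sub by auto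
  show "x i \<in> verts T'" "xm i \<in> verts T'" "xp i \<in> verts T'" using x m B'_sub by auto
  show "xm i \<noteq> xp i" using nbrs assms by auto
  show "x i \<noteq> xm i" "x i \<noteq> xp i" using T'_simple[OF e(1)] T'_simple[OF e(2)] by auto
  show "xm i \<notin> x ` {..<k}" "xp i \<notin> x ` {..<k}" using m stable assms by (auto simp: insert_commute)
qed

section \<open>Adjacency in an expansion\<close>

lemma T'_edge_old: "{a, b} \<in> edges T' \<Longrightarrow> a \<in> verts T' \<and> b \<in> verts T'"
  using T'_simple by blast

text \<open>One rule for each kind of edge, new edges being listed in one direction only;
  \<open>E_adj\<close> restores the symmetry. Every non-adjacency below is then a case analysis on
  the rules, closed by the distinctness facts \<open>new_simps\<close>.\<close>

inductive adj :: "'a \<Rightarrow> 'a \<Rightarrow> bool" where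
  old: "{a, b} \<in> edges T' \<Longrightarrow> adj a b"
| PP: "i < k \<Longrightarrow> Suc j < 2 * t - 5 \<Longrightarrow> adj (P i ! j) (P i ! Suc j)"
| mP: "i < k \<Longrightarrow> adj (xm i) (P i ! 0)"
| xP: "i < k \<Longrightarrow> adj (x i) (P i ! (t - 3))"
| pP: "i < k \<Longrightarrow> adj (xp i) (P i ! (2 * t - 6))"
| QQ: "i \<in> I \<Longrightarrow> Suc j < t - 3 \<Longrightarrow> adj (Q i ! j) (Q i ! Suc j)"
| mQ: "i \<in> I \<Longrightarrow> adj (P i ! (t - 4)) (Q i ! 0)"
| pQ: "i \<in> I \<Longrightarrow> adj (P i ! (t - 2)) (Q i ! (t - 4))"

lemma P_path: "i < k \<Longrightarrow> edges (path_on (P i)) = {{P i ! j, P i ! Suc j} | j. Suc j < 2 * t - 5}"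
    "i < k \<Longrightarrow> hd (P i) = P i ! 0" "i < k \<Longrightarrow> last (P i) = P i ! (2 * t - 6)"
proof -
  assume "i < k"
  then have len: "length (P i) = 2 * t - 6 + 1" using lenP by auto
  show "hd (P i) = P i ! 0" using len by (intro hd_conv_nth) auto
  show "last (P i) = P i ! (2 * t - 6)" using len by (subst last_conv_nth) auto
  have "length (P i) = 2 * t - 5" using len t5 by simp
  then show "edges (path_on (P i)) = {{P i ! j, P i ! Suc j} | j. Suc j < 2 * t - 5}"
    by (simp add: path_on_def)
qed

lemma Q_path: "i \<in> I \<Longrightarrow> edges (path_on (Q i)) = {{Q i ! j, Q i ! Suc j} | j. Suc j < t - 3}"
    "i \<in> I \<Longrightarrow> hd (Q i) = Q i ! 0" "i \<in> I \<Longrightarrow> last (Q i) = Q i ! (t - 4)"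
proof -
  assume "i \<in> I"
  then have len: "length (Q i) = t - 4 + 1" using lenQ by auto
  show "hd (Q i) = Q i ! 0" using len by (intro hd_conv_nth) auto
  show "last (Q i) = Q i ! (t - 4)" using len by (subst last_conv_nth) auto
  have "length (Q i) = t - 3" using len t5 by simp
  then show "edges (path_on (Q i)) = {{Q i ! j, Q i ! Suc j} | j. Suc j < t - 3}"
    by (simp add: path_on_def)
qed

lemma E_iff: "e \<in> E \<longleftrightarrow> (\<exists>a b. e = {a, b} \<and> adj a b)"
proof
  assume "e \<in> E"
  then consider "e \<in> edges T'" | i where "i < k" "e \<in> edges (path_on (P i))"
    | i where "i < k" "e = {xm i, hd (P i)}" | i where "i < k" "e = {x i, P i ! (t - 3)}"
    | i where "i < k" "e = {xp i, last (P i)}" | i where "i \<in> I" "e \<in> edges (path_on (Q i))"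
    | i where "i \<in> I" "e = {P i ! (t - 4), hd (Q i)}" | i where "i \<in> I" "e = {P i ! (t - 2), last (Q i)}"
    unfolding T_def by (simp only: graph.sel) (elim UnE UN_E insertE emptyE; simp only: lessThan_iff)
  then show "\<exists>a b. e = {a, b} \<and> adj a b"
  proof cases
    case 1
    then obtain a b where "e = {a, b}" using T'_simple by (meson card_2_iff)
    then show ?thesis using 1 adj.old by blast
  next
    case (2 i)
    then obtain j where "e = {P i ! j, P i ! Suc j}" "Suc j < 2 * t - 5" by (auto simp: P_path)
    then show ?thesis using adj.PP 2 by blast
  next
    case (6 i)
    then obtain j where "e = {Q i ! j, Q i ! Suc j}" "Suc j < t - 3" by (auto simp: Q_path)
    then show ?thesis using adj.QQ 6 by blast
  qed (use P_path Q_path adj.intros in metis)+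
next
  assume "\<exists>a b. e = {a, b} \<and> adj a b"
  then obtain a b where e: "e = {a, b}" and "adj a b" by blast
  have UN1: "e \<in> E" if "i < k" "e \<in> edges (path_on (P i)) \<union> {{xm i, hd (P i)}, {x i, P i ! (t - 3)}, {xp i, last (P i)}}"
    for i using that unfolding T_def graph.sel by blast
  have UN2: "e \<in> E" if "i \<in> I" "e \<in> edges (path_on (Q i)) \<union> {{P i ! (t - 4), hd (Q i)}, {P i ! (t - 2), last (Q i)}}"
    for i using that unfolding T_def graph.sel by blast
  from \<open>adj a b\<close> show "e \<in> E"
  proof cases
    case old
    then show ?thesis by (simp add: T_def e)
  next
    case (PP i j)
    then show ?thesis using e by (intro UN1[of i]) (auto simp: P_path)
  next
    case (mP i)
    then show ?thesis using e by (intro UN1[of i]) (auto simp: P_path)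
  next
    case (xP i)
    then show ?thesis using e by (intro UN1[of i]) (auto simp: P_path)
  next
    case (pP i)
    then show ?thesis using e by (intro UN1[of i]) (auto simp: P_path)
  next
    case (QQ i j)
    then show ?thesis using e by (intro UN2[of i]) (auto simp: Q_path)
  next
    case (mQ i)
    then show ?thesis using e by (intro UN2[of i]) (auto simp: Q_path)
  next
    case (pQ i)
    then show ?thesis using e by (intro UN2[of i]) (auto simp: Q_path)
  qed
qed

lemma E_adj: "{a, b} \<in> E \<longleftrightarrow> adj a b \<or> adj b a"
  unfolding E_iff by (auto simp: doubleton_eq_iff)

lemma new_ne_x:
  assumes "i' < k"
  shows "i < k \<Longrightarrow> j < 2 * t - 5 \<Longrightarrow> P i ! j \<noteq> x i' \<and> P i ! j \<noteq> xm i' \<and> P i ! j \<noteq> xp i'"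
    and "i < k \<Longrightarrow> j < 2 * t - 5 \<Longrightarrow> x i' \<noteq> P i ! j \<and> xm i' \<noteq> P i ! j \<and> xp i' \<noteq> P i ! j"
    and "i \<in> I \<Longrightarrow> j < t - 3 \<Longrightarrow> Q i ! j \<noteq> x i' \<and> Q i ! j \<noteq> xm i' \<and> Q i ! j \<noteq> xp i'"
    and "i \<in> I \<Longrightarrow> j < t - 3 \<Longrightarrow> x i' \<noteq> Q i ! j \<and> xm i' \<noteq> Q i ! j \<and> xp i' \<noteq> Q i ! j"
  using x_nbrs(1-3)[OF assms] P_new Q_new by metis+

lemmas new_simps = P_new Q_new Pinj Qinj PQ_ne x_nbrs(1-3) Ik new_ne_x

lemma old_adj: "adj a b \<Longrightarrow> a \<in> verts T' \<Longrightarrow> b \<in> verts T' \<Longrightarrow> {a, b} \<in> edges T'"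
  by (erule adj.cases) (use t5 in \<open>auto simp: new_simps\<close>)

text \<open>Every added edge has a new end. Hence tiles of \<open>T'\<close> stay induced in
  \<open>T\<close>.\<close>

lemma old_edge_iff:
  assumes "a \<in> verts T'" "b \<in> verts T'"
  shows "{a, b} \<in> E \<longleftrightarrow> {a, b} \<in> edges T'"
  using old_adj[of a b] old_adj[of b a] assms adj.old[of a b] unfolding E_adj
  by (auto simp: insert_commute)

lemma PP_adj:
  assumes "adj (P i ! j) (P i ! l)" "i < k" "j < 2 * t - 5" "l < 2 * t - 5"
  shows "l = Suc j"
  using assms(1)
proof cases
  case old
  then show ?thesis using T'_edge_old P_new assms by blast
qed (use assms t5 in \<open>auto simp: new_simps\<close>)

lemma PP_edge_iff:
  assumes "i < k" "j < l" "l < 2 * t - 5"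
  shows "{P i ! j, P i ! l} \<in> E \<longleftrightarrow> l = Suc j"
  using PP_adj[of i j l] PP_adj[of i l j] adj.PP[of i j] assms unfolding E_adj by auto

lemma VP_adj:
  assumes "adj v (P i ! j) \<or> adj (P i ! j) v" "i < k" "j < 2 * t - 5" "v \<in> verts T'"
  shows "(v = xm i \<and> j = 0) \<or> (v = x i \<and> j = t - 3) \<or> (v = xp i \<and> j = 2 * t - 6)"
  using assms(1)
proof
  assume "adj v (P i ! j)"
  then show ?thesis
  proof cases
    case old
    then show ?thesis using T'_edge_old P_new assms by blast
  qed (use assms t5 in \<open>auto simp: new_simps\<close>)
next
  assume "adj (P i ! j) v"
  then show ?thesis
  proof cases
    case old
    then show ?thesis using T'_edge_old P_new assms by blast
  qed (use assms t5 in \<open>auto simp: new_simps\<close>)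
qed

lemma VP_edge_iff:
  assumes "i < k" "j < 2 * t - 5" "v \<in> verts T'"
  shows "{v, P i ! j} \<in> E \<longleftrightarrow> (v = xm i \<and> j = 0) \<or> (v = x i \<and> j = t - 3) \<or> (v = xp i \<and> j = 2 * t - 6)"
  using VP_adj[of v i j] adj.mP[of i] adj.xP[of i] adj.pP[of i] assms unfolding E_adj by auto

lemma VQ_no_edge:
  assumes "i \<in> I" "j < t - 3" "v \<in> verts T'"
  shows "{v, Q i ! j} \<notin> E"
proof
  assume "{v, Q i ! j} \<in> E"
  then show False unfolding E_adj
  proof
    assume "adj v (Q i ! j)"
    then show ?thesis
    proof cases
      case old
      then show ?thesis using T'_edge_old Q_new assms by blast
    qed (use assms t5 in \<open>auto simp: new_simps\<close>)
  next
    assume "adj (Q i ! j) v"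
    then show ?thesis
    proof cases
      case old
      then show ?thesis using T'_edge_old Q_new assms by blast
    qed (use assms t5 in \<open>auto simp: new_simps\<close>)
  qed
qed

lemma QQ_adj:
  assumes "adj (Q i ! j) (Q i ! l)" "i \<in> I" "j < t - 3" "l < t - 3"
  shows "l = Suc j"
  using assms(1)
proof cases
  case old
  then show ?thesis using T'_edge_old Q_new assms by blast
qed (use assms t5 in \<open>auto simp: new_simps\<close>)

lemma QQ_edge_iff:
  assumes "i \<in> I" "j < l" "l < t - 3"
  shows "{Q i ! j, Q i ! l} \<in> E \<longleftrightarrow> l = Suc j"
  using QQ_adj[of i j l] QQ_adj[of i l j] adj.QQ[of i j] assms unfolding E_adj by auto

lemma PQ_adj:
  assumes "adj (P i ! j) (Q i ! l) \<or> adj (Q i ! l) (P i ! j)" "i \<in> I" "j < 2 * t - 5" "l < t - 3"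
  shows "(j = t - 4 \<and> l = 0) \<or> (j = t - 2 \<and> l = t - 4)"
  using assms(1)
proof
  assume "adj (P i ! j) (Q i ! l)"
  then show ?thesis
  proof cases
    case old
    then show ?thesis using T'_edge_old Q_new assms by blast
  qed (use assms t5 in \<open>auto simp: new_simps\<close>)
next
  assume "adj (Q i ! l) (P i ! j)"
  then show ?thesis
  proof cases
    case old
    then show ?thesis using T'_edge_old Q_new assms by blast
  qed (use assms t5 in \<open>auto simp: new_simps\<close>)
qed

lemma PQ_edge_iff:
  assumes "i \<in> I" "j < 2 * t - 5" "l < t - 3"
  shows "{P i ! j, Q i ! l} \<in> E \<longleftrightarrow> (j = t - 4 \<and> l = 0) \<or> (j = t - 2 \<and> l = t - 4)"
  using PQ_adj[of i j l] adj.mQ[of i] adj.pQ[of i] assms unfolding E_adj by auto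

section \<open>The new tiles of an expansion\<close>

definition face_minus where "face_minus i = {xm i, x i} \<union> (\<lambda>j. P i ! j) ` {..<t - 2}"
definition face_plus where "face_plus i = {x i, xp i} \<union> (\<lambda>j. P i ! (t - 3 + j)) ` {..<t - 2}"
text \<open>An ear on the edge from \<open>v^-\<close> to \<open>y\<close>, at indices
  \<open>t - 4\<close> and \<open>t - 3\<close> of \<open>P i\<close>: it runs along
  \<open>Q i\<close>, and index \<open>t - 3\<close> of the ear appends \<open>v^+\<close>.\<close>

definition face_Q where
  "face_Q i = {P i ! (t - 4), P i ! (t - 3)} \<union> (\<lambda>j. if j < t - 3 then Q i ! j else P i ! (t - 2)) ` {..<t - 2}"

lemma induces_face_minus:
  assumes i: "i < k"
  shows "induces_cycle E t (face_minus i)"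
  unfolding face_minus_def
proof (rule induces_cycle_ear)
  show "inj_on (\<lambda>j. P i ! j) {..<t - 2}"
    by (rule inj_onI) (use i Pinj[of i i] t5 in auto)
  show "xm i \<noteq> x i" using x_nbrs[OF i] by auto
  show "xm i \<notin> (\<lambda>j. P i ! j) ` {..<t - 2}" "x i \<notin> (\<lambda>j. P i ! j) ` {..<t - 2}"
    using i t5 by (auto simp: new_simps)
  show "{xm i, x i} \<in> E" using x_nbrs[OF i] old_edge_iff by auto
  show "{P i ! j, P i ! l} \<in> E \<longleftrightarrow> l = Suc j" if "j < l" "l < t - 2" for j l
    using PP_edge_iff[of i j l] i that t5 by auto
  show "{xm i, P i ! j} \<in> E \<longleftrightarrow> j = 0" if "j < t - 2" for j
    using VP_edge_iff[of i j "xm i"] i that t5 x_nbrs[OF i] by auto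
  show "{x i, P i ! j} \<in> E \<longleftrightarrow> Suc j = t - 2" if "j < t - 2" for j
    using VP_edge_iff[of i j "x i"] i that t5 x_nbrs[OF i] by auto
qed (use t5 in auto)

lemma induces_face_plus:
  assumes i: "i < k"
  shows "induces_cycle E t (face_plus i)"
  unfolding face_plus_def
proof (rule induces_cycle_ear)
  show "inj_on (\<lambda>j. P i ! (t - 3 + j)) {..<t - 2}"
    by (rule inj_onI) (use i Pinj[of i i] t5 in auto)
  show "x i \<noteq> xp i" using x_nbrs[OF i] by auto
  show "xp i \<notin> (\<lambda>j. P i ! (t - 3 + j)) ` {..<t - 2}" "x i \<notin> (\<lambda>j. P i ! (t - 3 + j)) ` {..<t - 2}"
    using i t5 by (auto simp: new_simps)
  show "{x i, xp i} \<in> E" using x_nbrs[OF i] old_edge_iff by (auto simp: insert_commute)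
  show "{P i ! (t - 3 + j), P i ! (t - 3 + l)} \<in> E \<longleftrightarrow> l = Suc j" if "j < l" "l < t - 2" for j l
    using PP_edge_iff[of i "t - 3 + j" "t - 3 + l"] i that t5 by auto
  show "{x i, P i ! (t - 3 + j)} \<in> E \<longleftrightarrow> j = 0" if "j < t - 2" for j
    using VP_edge_iff[of i "t - 3 + j" "x i"] i that t5 x_nbrs[OF i] by auto
  show "{xp i, P i ! (t - 3 + j)} \<in> E \<longleftrightarrow> Suc j = t - 2" if "j < t - 2" for j
    using VP_edge_iff[of i "t - 3 + j" "xp i"] i that t5 x_nbrs[OF i] by auto
qed (use t5 in auto)

lemma induces_face_Q:
  assumes i: "i \<in> I"
  shows "induces_cycle E t (face_Q i)"
  unfolding face_Q_def
proof (rule induces_cycle_ear)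
  let ?c = "\<lambda>j. if j < t - 3 then Q i ! j else P i ! (t - 2)"
  have ik: "i < k" using i Ik by auto
  show "inj_on ?c {..<t - 2}"
  proof (rule linorder_inj_onI')
    fix j l assume jl: "j \<in> {..<t - 2}" "l \<in> {..<t - 2}" "j < l"
    then have "j < t - 3" by auto
    then show "?c j \<noteq> ?c l" using jl i ik t5 by (auto simp: new_simps)
  qed
  show "P i ! (t - 4) \<noteq> P i ! (t - 3)" using ik t5 by (auto simp: Pinj)
  show "P i ! (t - 4) \<notin> ?c ` {..<t - 2}" "P i ! (t - 3) \<notin> ?c ` {..<t - 2}"
    using ik i t5 by (auto simp: new_simps)
  show "{P i ! (t - 4), P i ! (t - 3)} \<in> E" using PP_edge_iff[of i "t - 4" "t - 3"] ik t5 by auto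
  show "{?c j, ?c l} \<in> E \<longleftrightarrow> l = Suc j" if "j < l" "l < t - 2" for j l
  proof (cases "l < t - 3")
    case True
    then show ?thesis using QQ_edge_iff[of i j l] i that by auto
  next
    case False
    then have "l = t - 3" "j < t - 3" using that by auto
    moreover have "{Q i ! j, P i ! (t - 2)} \<in> E \<longleftrightarrow> Suc j = t - 3" if "j < t - 3"
      using PQ_edge_iff[of i "t - 2" j] i t5 that by (auto simp: insert_commute)
    ultimately show ?thesis by auto
  qed
  show "{P i ! (t - 4), ?c j} \<in> E \<longleftrightarrow> j = 0" if "j < t - 2" for j
    using PQ_edge_iff[of i "t - 4" j] PP_edge_iff[of i "t - 4" "t - 2"] i ik t5 that by auto
  show "{P i ! (t - 3), ?c j} \<in> E \<longleftrightarrow> Suc j = t - 2" if "j < t - 2" for j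
    using PQ_edge_iff[of i "t - 3" j] PP_edge_iff[of i "t - 3" "t - 2"] i ik t5 that by auto
qed (use t5 in auto)

lemma face_minus_cases:
  assumes "v \<in> face_minus i"
  shows "v = xm i \<or> v = x i \<or> (\<exists>j \<le> t - 3. v = P i ! j)"
proof -
  have "j \<le> t - 3" if "j < t - 2" for j using that by linarith
  then show ?thesis using assms unfolding face_minus_def by blast
qed

lemma face_plus_cases:
  assumes "v \<in> face_plus i"
  shows "v = xp i \<or> v = x i \<or> (\<exists>j. t - 3 \<le> j \<and> j \<le> 2 * t - 6 \<and> v = P i ! j)"
proof -
  have "t - 3 \<le> t - 3 + j \<and> t - 3 + j \<le> 2 * t - 6" if "j < t - 2" for j using that t5 by auto
  then show ?thesis using assms unfolding face_plus_def by blast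
qed

lemma face_Q_cases:
  assumes "v \<in> face_Q i"
  shows "v = P i ! (t - 4) \<or> v = P i ! (t - 3) \<or> v = P i ! (t - 2) \<or> (\<exists>j < t - 3. v = Q i ! j)"
  using assms by (auto simp: face_Q_def split: if_splits)

lemma in_face_minus: "xm i \<in> face_minus i" "x i \<in> face_minus i" "j \<le> t - 3 \<Longrightarrow> P i ! j \<in> face_minus i"
  using t5 by (auto simp: face_minus_def)

lemma in_face_plus: "xp i \<in> face_plus i" "x i \<in> face_plus i"
  "t - 3 \<le> j \<Longrightarrow> j \<le> 2 * t - 6 \<Longrightarrow> P i ! j \<in> face_plus i"
proof -
  assume "t - 3 \<le> j" "j \<le> 2 * t - 6"
  then have "j = t - 3 + (j - (t - 3))" "j - (t - 3) < t - 2" using t5 by auto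
  then show "P i ! j \<in> face_plus i"
    unfolding face_plus_def by (metis (mono_tags, lifting) UnI2 imageI lessThan_iff)
qed (auto simp: face_plus_def)

lemma in_face_Q: "P i ! (t - 4) \<in> face_Q i" "P i ! (t - 3) \<in> face_Q i" "P i ! (t - 2) \<in> face_Q i"
  "j < t - 3 \<Longrightarrow> Q i ! j \<in> face_Q i"
proof -
  have "t - 3 \<in> {..<t - 2}" using t5 by auto
  then show "P i ! (t - 2) \<in> face_Q i" unfolding face_Q_def by (auto simp: image_iff intro!: bexI[of _ "t - 3"])
  show "j < t - 3 \<Longrightarrow> Q i ! j \<in> face_Q i"
    unfolding face_Q_def by (auto simp: image_iff intro!: bexI[of _ j])
qed (auto simp: face_Q_def)

text \<open>The edge from \<open>x i\<close> to the middle of \<open>P i\<close> separates the minus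
  tile from the plus tile, whether or not \<open>i\<close> is in \<open>I\<close>.\<close>

lemma theta_spoke:
  assumes i: "i < k"
  shows "theta E t {x i, P i ! (t - 3)}"
proof (rule thetaI)
  let ?e = "{x i, P i ! (t - 3)}"
  show "induces_cycle E t (face_minus i)" "induces_cycle E t (face_plus i)"
    using induces_face_minus induces_face_plus i by auto
  have main: "a \<noteq> b \<and> {a, b} \<notin> E" if "a \<in> face_minus i - ?e" "b \<in> face_plus i - ?e" for a b
  proof -
    have a: "a = xm i \<or> (\<exists>j < t - 3. a = P i ! j)"
      using face_minus_cases[of a i] that by (auto simp: order_le_less)
    have b: "b = xp i \<or> (\<exists>l. t - 3 < l \<and> l \<le> 2 * t - 6 \<and> b = P i ! l)"
      using face_plus_cases[of b i] that by (auto simp: order_le_less)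
    \<comment> \<open>The old vertices of the two tiles off the spoke are \<open>xm i\<close> and
      \<open>xp i\<close>; this is the place where \<open>no_triangle\<close> enters.\<close>
    have 1: "xm i \<noteq> xp i" "{xm i, xp i} \<notin> E"
      using x_nbrs[OF i] no_triangle i old_edge_iff[of "xm i" "xp i"] by auto
    have 2: "xm i \<noteq> P i ! l \<and> {xm i, P i ! l} \<notin> E" if "t - 3 < l" "l \<le> 2 * t - 6" for l
      using i t5 that x_nbrs(7,8)[OF i] by (auto simp: VP_edge_iff new_simps)
    have 3: "P i ! j \<noteq> xp i \<and> {P i ! j, xp i} \<notin> E" if "j < t - 3" for j
      using VP_edge_iff[of i j "xp i"] x_nbrs[OF i] i t5 that
      by (auto simp: insert_commute new_simps)
    have 4: "P i ! j \<noteq> P i ! l \<and> {P i ! j, P i ! l} \<notin> E" if "j < t - 3" "t - 3 < l" "l \<le> 2 * t - 6" for j l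
      using PP_edge_iff[of i j l] Pinj[of i i j l] i t5 that by auto
    show ?thesis using a b 1 2 3 4 by metis
  qed
  then show "{a, b} \<notin> E" if "a \<in> face_minus i - ?e" "b \<in> face_plus i - ?e" for a b using that by blast
  have "?e \<subseteq> face_minus i" "?e \<subseteq> face_plus i"
    using in_face_minus(2)[of i] in_face_minus(3)[of "t - 3" i] in_face_plus(2)[of i] in_face_plus(3)[of "t - 3" i] t5 by auto
  then show "face_minus i \<inter> face_plus i = ?e" using main by blast
qed

text \<open>For \<open>i\<close> in \<open>I\<close> the new boundary bypasses the middle of
  \<open>P i\<close>, so the two edges of \<open>P i\<close> at that vertex become inner;
  \<open>face_Q i\<close> is their second tile.\<close>

lemma theta_Q_minus:
  assumes i: "i \<in> I"
  shows "theta E t {P i ! (t - 4), P i ! (t - 3)}"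
proof (rule thetaI)
  let ?e = "{P i ! (t - 4), P i ! (t - 3)}"
  have ik: "i < k" using i Ik by auto
  show "induces_cycle E t (face_minus i)" "induces_cycle E t (face_Q i)"
    using induces_face_minus induces_face_Q i ik by auto
  have main: "a \<noteq> b \<and> {a, b} \<notin> E" if "a \<in> face_minus i - ?e" "b \<in> face_Q i - ?e" for a b
  proof -
    have "a = xm i \<or> a = x i \<or> (\<exists>j \<le> t - 3. a = P i ! j \<and> j \<noteq> t - 3 \<and> j \<noteq> t - 4)"
      using face_minus_cases[of a i] that by auto
    moreover have "j < t - 4" if "j \<le> t - 3" "j \<noteq> t - 3" "j \<noteq> t - 4" for j using that by linarith
    ultimately have a: "a = xm i \<or> a = x i \<or> (\<exists>j < t - 4. a = P i ! j)" by metis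
    have b: "b = P i ! (t - 2) \<or> (\<exists>l < t - 3. b = Q i ! l)"
      using face_Q_cases[of b i] that by auto
    have 1: "v \<noteq> P i ! (t - 2) \<and> {v, P i ! (t - 2)} \<notin> E" if "v = xm i \<or> v = x i" for v
      using x_nbrs(7-9)[OF ik] ik t5 that by (auto simp: VP_edge_iff new_simps)
    have 2: "v \<noteq> Q i ! l \<and> {v, Q i ! l} \<notin> E" if "v = xm i \<or> v = x i" "l < t - 3" for v l
      using ik i that by (auto simp: VQ_no_edge new_simps)
    have 3: "P i ! j \<noteq> P i ! (t - 2) \<and> {P i ! j, P i ! (t - 2)} \<notin> E" if "j < t - 4" for j
      using PP_edge_iff[of i j "t - 2"] Pinj[of i i j "t - 2"] ik t5 that by auto
    have 4: "P i ! j \<noteq> Q i ! l \<and> {P i ! j, Q i ! l} \<notin> E" if "j < t - 4" "l < t - 3" for j l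
      using PQ_edge_iff[of i j l] PQ_ne[of i i j l] i ik t5 that by auto
    show ?thesis using a b 1 2 3 4 by metis
  qed
  then show "{a, b} \<notin> E" if "a \<in> face_minus i - ?e" "b \<in> face_Q i - ?e" for a b using that by blast
  have "?e \<subseteq> face_minus i" "?e \<subseteq> face_Q i"
    using in_face_minus(3)[of "t - 4" i] in_face_minus(3)[of "t - 3" i] in_face_Q[of i] t5 by auto
  then show "face_minus i \<inter> face_Q i = ?e" using main by blast
qed

lemma theta_Q_plus:
  assumes i: "i \<in> I"
  shows "theta E t {P i ! (t - 3), P i ! (t - 2)}"
proof (rule thetaI)
  let ?e = "{P i ! (t - 3), P i ! (t - 2)}"
  have ik: "i < k" using i Ik by auto
  show "induces_cycle E t (face_plus i)" "induces_cycle E t (face_Q i)"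
    using induces_face_plus induces_face_Q i ik by auto
  have main: "a \<noteq> b \<and> {a, b} \<notin> E" if "a \<in> face_plus i - ?e" "b \<in> face_Q i - ?e" for a b
  proof -
    have "a = xp i \<or> a = x i \<or> (\<exists>j. t - 3 \<le> j \<and> j \<le> 2 * t - 6 \<and> a = P i ! j \<and> j \<noteq> t - 3 \<and> j \<noteq> t - 2)"
      using face_plus_cases[of a i] that by auto
    moreover have "t - 2 < j" if "t - 3 \<le> j" "j \<noteq> t - 3" "j \<noteq> t - 2" for j using that by linarith
    ultimately have a: "a = xp i \<or> a = x i \<or> (\<exists>j. t - 2 < j \<and> j \<le> 2 * t - 6 \<and> a = P i ! j)" by metis
    have b: "b = P i ! (t - 4) \<or> (\<exists>l < t - 3. b = Q i ! l)"
      using face_Q_cases[of b i] that by auto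
    have 1: "v \<noteq> P i ! (t - 4) \<and> {v, P i ! (t - 4)} \<notin> E" if "v = xp i \<or> v = x i" for v
      using x_nbrs(7-9)[OF ik] ik t5 that by (auto simp: VP_edge_iff new_simps)
    have 2: "v \<noteq> Q i ! l \<and> {v, Q i ! l} \<notin> E" if "v = xp i \<or> v = x i" "l < t - 3" for v l
      using ik i that by (auto simp: VQ_no_edge new_simps)
    have 3: "P i ! j \<noteq> P i ! (t - 4) \<and> {P i ! j, P i ! (t - 4)} \<notin> E" if "t - 2 < j" "j \<le> 2 * t - 6" for j
      using PP_edge_iff[of i "t - 4" j] Pinj[of i i j "t - 4"] ik t5 that by (auto simp: insert_commute)
    have 4: "P i ! j \<noteq> Q i ! l \<and> {P i ! j, Q i ! l} \<notin> E" if "t - 2 < j" "j \<le> 2 * t - 6" "l < t - 3" for j l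
      using PQ_edge_iff[of i j l] PQ_ne[of i i j l] i ik t5 that by auto
    show ?thesis using a b 1 2 3 4 by metis
  qed
  then show "{a, b} \<notin> E" if "a \<in> face_plus i - ?e" "b \<in> face_Q i - ?e" for a b using that by blast
  have "?e \<subseteq> face_plus i" "?e \<subseteq> face_Q i"
    using in_face_plus(3)[of "t - 3" i] in_face_plus(3)[of "t - 2" i] in_face_Q[of i] t5 by auto
  then show "face_plus i \<inter> face_Q i = ?e" using main by blast
qed

section \<open>The new boundary and its tiles\<close>

abbreviation R where "R \<equiv> expansion_path t I xm xp P Q"

lemma R_nth_out:
  assumes "i < k" "i \<notin> I"
  shows "length (R i) = 2 * t - 3" "R i ! 0 = xm i" "j < 2 * t - 5 \<Longrightarrow> R i ! Suc j = P i ! j"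
    "R i ! (2 * t - 4) = xp i"
proof -
  have len: "length (P i) = 2 * t - 5" using lenP assms t5 by auto
  show "length (R i) = 2 * t - 3" "R i ! 0 = xm i" "j < 2 * t - 5 \<Longrightarrow> R i ! Suc j = P i ! j"
    using assms len t5 by (auto simp: expansion_path_def nth_append)
  have "2 * t - 4 = Suc (2 * t - 5)" using t5 by simp
  then show "R i ! (2 * t - 4) = xp i" using assms len by (simp add: expansion_path_def nth_append)
qed

text \<open>The blocks of \<open>R i\<close> are: \<open>xm i\<close> at 0, \<open>P i\<close> up to
  \<open>v^-\<close> at 1 to \<open>t - 3\<close>, \<open>Q i\<close> at \<open>t - 2\<close> to
  \<open>2 * t - 6\<close>, \<open>P i\<close> from \<open>v^+\<close> on at
  \<open>2 * t - 5\<close> to \<open>3 * t - 9\<close>, and \<open>xp i\<close> at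
  \<open>3 * t - 8\<close>. Only the middle vertex \<open>P i ! (t - 3)\<close> is left out.\<close>

lemma R_nth_in:
  assumes "i \<in> I"
  shows "length (R i) = 3 * t - 7" "R i ! 0 = xm i" "j < t - 3 \<Longrightarrow> R i ! Suc j = P i ! j"
    "j < t - 3 \<Longrightarrow> R i ! (t - 2 + j) = Q i ! j" "j < t - 3 \<Longrightarrow> R i ! (2 * t - 5 + j) = P i ! (t - 2 + j)"
    "R i ! (3 * t - 8) = xp i"
proof -
  have len: "length (P i) = 2 * t - 5" "length (Q i) = t - 3" using lenP lenQ Ik assms t5 by auto
  have R: "R i = xm i # take (t - 3) (P i) @ Q i @ drop (t - 2) (P i) @ [xp i]"
    using assms by (simp add: expansion_path_def)
  have len': "length (take (t - 3) (P i)) = t - 3" "length (drop (t - 2) (P i)) = t - 3"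
    using len t5 by auto
  show "length (R i) = 3 * t - 7" using t5 by (simp add: R len len')
  show "R i ! 0 = xm i" by (simp add: R)
  show "j < t - 3 \<Longrightarrow> R i ! Suc j = P i ! j"
    using len by (simp add: R nth_append len')
  have 1: "t - 2 + j = Suc (t - 3 + j)" "2 * t - 5 + j = Suc (t - 3 + (t - 3 + j))"
    "3 * t - 8 = Suc (t - 3 + (t - 3 + (t - 3)))" using t5 by auto
  have skip: "(take (t - 3) (P i) @ ys) ! (t - 3 + n) = ys ! n" "(Q i @ ys) ! (t - 3 + n) = ys ! n"
    "(drop (t - 2) (P i) @ [xp i]) ! (t - 3) = xp i" for ys n
    using nth_append_length_plus[of "take (t - 3) (P i)" ys n] nth_append_length_plus[of "Q i" ys n]
      nth_append_length[of "drop (t - 2) (P i)" "xp i" "[]"] by (simp_all only: len len')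
  show "j < t - 3 \<Longrightarrow> R i ! (t - 2 + j) = Q i ! j"
    unfolding R 1(1) nth_Cons_Suc skip by (simp add: nth_append len)
  show "j < t - 3 \<Longrightarrow> R i ! (2 * t - 5 + j) = P i ! (t - 2 + j)"
    unfolding R 1(2) nth_Cons_Suc skip using len t5 by (simp add: nth_append len')
  show "R i ! (3 * t - 8) = xp i"
    unfolding R 1(3) nth_Cons_Suc skip ..
qed

lemma R_edge:
  assumes "i < k" "Suc j < length (R i)"
  shows "{R i ! j, R i ! Suc j} \<in> edges B"
proof -
  have "{R i ! j, R i ! Suc j} \<in> edges (path_on (R i))" using assms unfolding path_on_def by auto
  then show ?thesis using assms(1) unfolding B_def graph_Union_def by auto
qed

lemma outer_edge_in_B:
  assumes "e \<in> edges B'" "e \<inter> x ` {..<k} = {}"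
  shows "e \<in> edges B"
proof -
  have "e \<subseteq> verts B' - x ` {..<k}" using assms B'_verts by blast
  then have "e \<in> edges (induced B' (verts B' - x ` {..<k}))" using assms(1) by (simp add: induced_def)
  then show ?thesis unfolding B_def graph_Union_def by simp
qed

text \<open>Boundary edges at some \<open>x i\<close> become inner and gain a second tile. Spokes,
  and for \<open>i\<close> in \<open>I\<close> the edges of \<open>P i\<close> at its middle, have
  two new tiles. All other new edges lie on some \<open>R i\<close> and need one tile only.\<close>

lemma tiled_expansion:
  assumes tiled': "tiled t T' B'"
  shows "tiled t T B"
  unfolding tiled_def
proof
  fix e assume "e \<in> E"
  then obtain a b where ab: "e = {a, b}" "adj a b" using E_iff by blast
  have UT': "\<Union>(edges T') \<subseteq> verts T'" using T'_simple by blast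
  have keep: "induces_cycle E t S" if "induces_cycle (edges T') t S" for S
  proof -
    have "S \<subseteq> verts T'" using induces_cycle_in_Union[OF that] UT' t5 by auto
    then show ?thesis using induces_cycle_cong[OF that] old_edge_iff by blast
  qed
  have boundary: "e \<in> edges B \<Longrightarrow> e \<subseteq> S \<Longrightarrow> induces_cycle E t S \<Longrightarrow>
      theta E t e \<or> e \<in> edges B \<and> (\<exists>S. induces_cycle E t S \<and> e \<subseteq> S)" for S by blast
  \<comment> \<open>The old tile of an edge at \<open>x i\<close> lies in \<open>T'\<close>, and the
    new tile \<open>F\<close> has no old vertices besides the ends of that edge, so the two share
    nothing else.\<close>
  have glue: "theta E t {w, x i}" if i: "i < k" and F: "induces_cycle E t F" and
    w: "{w, x i} \<in> edges B'" "F \<inter> verts T' = {w, x i}" and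
    noE: "\<And>a b. a \<in> verts T' - {w, x i} \<Longrightarrow> b \<in> F - {w, x i} \<Longrightarrow> {a, b} \<notin> E" for i w F
  proof -
    obtain S where S: "induces_cycle (edges T') t S" "{w, x i} \<subseteq> S"
      using tiled_face[OF tiled'] w(1) B'_sub by blast
    have SV: "S \<subseteq> verts T'" using induces_cycle_in_Union[OF S(1)] UT' t5 by auto
    show ?thesis
      by (rule thetaI[OF keep[OF S(1)] F]) (use S SV w noE in auto)
  qed
  have glue_m: "theta E t {xm i, x i}" if i: "i < k" for i
  proof (rule glue[OF i induces_face_minus[OF i]])
    show "{xm i, x i} \<in> edges B'" using x_nbrs[OF i] by auto
    have Pn: "P i ! j \<notin> verts T'" if "j < t - 2" for j using that i t5 by (simp add: P_new)
    then show "face_minus i \<inter> verts T' = {xm i, x i}"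
      unfolding face_minus_def using x_nbrs(1,2)[OF i] by auto
    fix a b assume a: "a \<in> verts T' - {xm i, x i}" and b: "b \<in> face_minus i - {xm i, x i}"
    then obtain j where "b = P i ! j" "j \<le> t - 3" using face_minus_cases by blast
    then show "{a, b} \<notin> E" using a i t5 by (auto simp: VP_edge_iff)
  qed
  have glue_p: "theta E t {xp i, x i}" if i: "i < k" for i
  proof (rule glue[OF i induces_face_plus[OF i]])
    show "{xp i, x i} \<in> edges B'" using x_nbrs[OF i] by auto
    have "P i ! (t - 3 + j) \<notin> verts T'" if "j < t - 2" for j using that i t5 by (simp add: P_new)
    then show "face_plus i \<inter> verts T' = {xp i, x i}"
      unfolding face_plus_def using x_nbrs(1,3)[OF i] by auto
    fix a b assume a: "a \<in> verts T' - {xp i, x i}" and b: "b \<in> face_plus i - {xp i, x i}"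
    then obtain j where "b = P i ! j" "t - 3 \<le> j" "j \<le> 2 * t - 6" using face_plus_cases by blast
    then show "{a, b} \<notin> E" using a i t5 by (auto simp: VP_edge_iff)
  qed
  from ab(2) show "theta E t e \<or> e \<in> edges B \<and> (\<exists>S. induces_cycle E t S \<and> e \<subseteq> S)"
  proof cases
    case old
    then have e: "e \<in> edges T'" using ab by simp
    show ?thesis
    proof (cases "e \<in> edges B'")
      case False
      then have "theta (edges T') t e" using tiled' e by (auto simp: tiled_def)
      from theta_cong[OF this _ UT' old_edge_iff] t5 show ?thesis by simp
    next
      case True
      show ?thesis
      proof (cases "e \<inter> x ` {..<k} = {}")
        case True
        obtain S where "induces_cycle (edges T') t S" "e \<subseteq> S" using tiled_face[OF tiled' e] by blast
        then show ?thesis using boundary[OF outer_edge_in_B[OF \<open>e \<in> edges B'\<close> True]] keep by blast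
      next
        case False
        then obtain i where i: "i < k" "x i \<in> e" by auto
        then obtain w where w: "e = {w, x i}" using ab by auto
        then have "w \<in> neighbours B' (x i)"
          using True B'_verts by (auto simp: neighbours_def)
        then have "w = xm i \<or> w = xp i" using nbrs i by auto
        then show ?thesis using glue_m glue_p w i by auto
      qed
    qed
  next
    case (PP i j)
    have face: "\<exists>S. induces_cycle E t S \<and> e \<subseteq> S"
    proof (cases "Suc j \<le> t - 3")
      case True
      then show ?thesis using PP ab in_face_minus(3)[of j i] in_face_minus(3)[of "Suc j" i] induces_face_minus
        by (intro exI[of _ "face_minus i"]) auto
    next
      case False
      then have "P i ! j \<in> face_plus i" "P i ! Suc j \<in> face_plus i" using PP by (auto intro!: in_face_plus(3))
      then show ?thesis using PP ab induces_face_plus by (intro exI[of _ "face_plus i"]) auto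
    qed
    show ?thesis
    proof (cases "i \<in> I")
      case False
      have "{R i ! Suc j, R i ! Suc (Suc j)} \<in> edges B"
        by (rule R_edge) (use PP R_nth_out[OF _ False] in auto)
      then show ?thesis using face ab PP R_nth_out[OF _ False] by auto
    next
      case True
      \<comment> \<open>The first two ranges lie before \<open>v^-\<close> and after
        \<open>v^+\<close>, hence on \<open>R i\<close>; the last two are the edges at the middle
        vertex, which \<open>R i\<close> bypasses.\<close>
      consider "Suc j < t - 3" | "t - 2 \<le> j" | "j = t - 4" | "j = t - 3" using t5 by linarith
      then show ?thesis
      proof cases
        case 1
        have "{R i ! Suc j, R i ! Suc (Suc j)} \<in> edges B"
          by (rule R_edge) (use PP 1 R_nth_in[OF True] in auto)
        then show ?thesis using face ab PP R_nth_in[OF True] 1 by auto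
      next
        case 2
        define l where "l = j - (t - 2)"
        have l: "j = t - 2 + l" "Suc l < t - 3" using 2 PP by (auto simp: l_def)
        have "{R i ! (2 * t - 5 + l), R i ! Suc (2 * t - 5 + l)} \<in> edges B"
          by (rule R_edge) (use PP l R_nth_in[OF True] in auto)
        moreover have "R i ! (2 * t - 5 + l) = P i ! j" "R i ! (2 * t - 5 + Suc l) = P i ! Suc j"
          using R_nth_in(5)[OF True, of l] R_nth_in(5)[OF True, of "Suc l"] l by auto
        ultimately show ?thesis using face ab PP by auto
      next
        case 3
        then have "Suc j = t - 3" using t5 by simp
        then show ?thesis using theta_Q_minus[OF True] 3 ab PP by auto
      next
        case 4
        then have "Suc j = t - 2" using t5 by simp
        then show ?thesis using theta_Q_plus[OF True] 4 ab PP by auto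
      qed
    qed
  next
    case (mP i)
    show ?thesis
    proof (rule boundary)
      have "R i ! 0 = xm i" "R i ! Suc 0 = P i ! 0" "Suc 0 < length (R i)"
        using R_nth_in[of i] R_nth_out[of i] mP t5 by (cases "i \<in> I"; auto)+
      then show "e \<in> edges B" using R_edge[of i 0] mP ab by auto
      show "induces_cycle E t (face_minus i)" using induces_face_minus mP by auto
      show "e \<subseteq> face_minus i" using in_face_minus[where i=i] mP ab by auto
    qed
  next
    case (xP i)
    then show ?thesis using theta_spoke ab by auto
  next
    case (pP i)
    show ?thesis
    proof (rule boundary)
      have "\<exists>l. R i ! l = P i ! (2 * t - 6) \<and> R i ! Suc l = xp i \<and> Suc l < length (R i)"
      proof (cases "i \<in> I")
        case True
        have "R i ! (2 * t - 5 + (t - 4)) = P i ! (t - 2 + (t - 4))" using R_nth_in(5)[OF True, of "t - 4"] t5 by simp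
        moreover have "2 * t - 5 + (t - 4) = 3 * t - 9" "t - 2 + (t - 4) = 2 * t - 6" "Suc (3 * t - 9) = 3 * t - 8"
          using t5 by auto
        ultimately show ?thesis using R_nth_in(1,6)[OF True] t5 by (intro exI[of _ "3 * t - 9"]) auto
      next
        case False
        have "Suc (2 * t - 6) = 2 * t - 5" "Suc (2 * t - 5) = 2 * t - 4" using t5 by auto
        then show ?thesis using R_nth_out(1,4)[OF pP(3) False] R_nth_out(3)[OF pP(3) False, of "2 * t - 6"] t5
          by (intro exI[of _ "2 * t - 5"]) auto
      qed
      then show "e \<in> edges B" using R_edge[of i] pP ab by (metis insert_commute)
      show "induces_cycle E t (face_plus i)" using induces_face_plus pP by auto
      show "e \<subseteq> face_plus i" using in_face_plus(1)[of i] in_face_plus(3)[of "2 * t - 6" i] pP ab t5 by auto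
    qed
  next
    case (QQ i j)
    show ?thesis
    proof (rule boundary)
      have "R i ! (t - 2 + j) = Q i ! j" "R i ! (t - 2 + Suc j) = Q i ! Suc j"
        using R_nth_in(4)[OF QQ(3), of j] R_nth_in(4)[OF QQ(3), of "Suc j"] QQ by auto
      moreover have "Suc (t - 2 + j) < length (R i)" using R_nth_in(1)[OF QQ(3)] QQ t5 by auto
      ultimately show "e \<in> edges B" using R_edge[of i "t - 2 + j"] QQ ab Ik by auto
      show "induces_cycle E t (face_Q i)" using induces_face_Q QQ by auto
      show "e \<subseteq> face_Q i" using in_face_Q(4)[of _ i] QQ ab by auto
    qed
  next
    case (mQ i)
    show ?thesis
    proof (rule boundary)
      have "Suc (t - 4) = t - 3" "Suc (t - 3) = t - 2" using t5 by auto
      then have "R i ! (t - 3) = P i ! (t - 4)" "R i ! Suc (t - 3) = Q i ! 0" "Suc (t - 3) < length (R i)"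
        using R_nth_in(1)[OF mQ(3)] R_nth_in(3)[OF mQ(3), of "t - 4"] R_nth_in(4)[OF mQ(3), of 0] t5 by auto
      then show "e \<in> edges B" using R_edge[of i "t - 3"] mQ ab Ik by auto
      show "induces_cycle E t (face_Q i)" using induces_face_Q mQ by auto
      show "e \<subseteq> face_Q i" using in_face_Q(1)[of i] in_face_Q(4)[of 0 i] mQ ab t5 by auto
    qed
  next
    case (pQ i)
    show ?thesis
    proof (rule boundary)
      have "t - 2 + (t - 4) = 2 * t - 6" "Suc (2 * t - 6) = 2 * t - 5" using t5 by auto
      then have "R i ! (2 * t - 6) = Q i ! (t - 4)" "R i ! Suc (2 * t - 6) = P i ! (t - 2)" "Suc (2 * t - 6) < length (R i)"
        using R_nth_in(1)[OF pQ(3)] R_nth_in(4)[OF pQ(3), of "t - 4"] R_nth_in(5)[OF pQ(3), of 0] t5 by auto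
      then show "e \<in> edges B" using R_edge[of i "2 * t - 6"] pQ ab Ik by (auto simp: insert_commute)
      show "induces_cycle E t (face_Q i)" using induces_face_Q pQ by auto
      show "e \<subseteq> face_Q i" using in_face_Q(3)[of i] in_face_Q(4)[of "t - 4" i] pQ ab t5 by auto
    qed
  qed
qed

end

section \<open>Distances along the boundary\<close>

text \<open>A walk that may pause. This makes the relation monotone in \<open>n\<close> and lets it
  survive maps that contract edges, as in \<open>near_map\<close>.\<close>

definition near :: "'a set set \<Rightarrow> nat \<Rightarrow> 'a \<Rightarrow> 'a \<Rightarrow> bool" where
  "near E n = (\<lambda>u v. u = v \<or> {u, v} \<in> E) ^^ n"

lemma near_0 [simp]: "near E 0 u v \<longleftrightarrow> u = v"
  by (simp add: near_def)

lemma near_SucE: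
  assumes "near E (Suc n) u v"
  obtains w where "near E n u w" "w = v \<or> {w, v} \<in> E"
  using assms by (auto simp: near_def)

lemma near_SucI: "near E n u w \<Longrightarrow> w = v \<or> {w, v} \<in> E \<Longrightarrow> near E (Suc n) u v"
  unfolding near_def by (auto simp: relcompp_apply)

lemma near_trans: "near E n u v \<Longrightarrow> near E m v w \<Longrightarrow> near E (n + m) u w"
  unfolding near_def by (auto simp: relpowp_add)

lemma near_mono: "near E n u v \<Longrightarrow> n \<le> m \<Longrightarrow> near E m u v"
proof (induction m)
  case (Suc m)
  then show ?case by (metis le_Suc_eq near_SucI)
qed simp

lemma near_refl [simp]: "near E n u u"
  using near_mono[of E 0 u u n] by simp

lemma near_edge: "{u, v} \<in> E \<Longrightarrow> near E 1 u v"
  using near_SucI[of E 0 u u v] by simp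

lemma near_sym: "near E n u v \<Longrightarrow> near E n v u"
proof (induction n arbitrary: v)
  case (Suc n)
  obtain w where w: "near E n u w" "w = v \<or> {w, v} \<in> E" using Suc.prems by (rule near_SucE)
  have "near E 1 v w" using w(2) near_edge[of v w E] by (auto simp: insert_commute)
  from near_trans[OF this Suc.IH[OF w(1)]] show ?case by simp
qed simp

lemma near_map:
  assumes "near E n u v" "\<And>a b. {a, b} \<in> E \<Longrightarrow> h a = h b \<or> {h a, h b} \<in> E'"
  shows "near E' n (h u) (h v)"
  using assms(1)
proof (induction n arbitrary: v)
  case (Suc n)
  obtain w where w: "near E n u w" "w = v \<or> {w, v} \<in> E" using Suc.prems by (rule near_SucE)
  then show ?case using Suc.IH assms(2)[of w v] by (blast intro: near_SucI)
qed simp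

lemma near_subset: "near E n u v \<Longrightarrow> E \<subseteq> E' \<Longrightarrow> near E' n u v"
  using near_map[of E n u v "\<lambda>x. x" E'] by auto

lemma near_Union: "near E n u v \<Longrightarrow> u = v \<or> v \<in> \<Union>E"
  by (induction n arbitrary: v) (auto elim!: near_SucE)

lemma near_list:
  assumes "\<And>j. Suc j < length xs \<Longrightarrow> {xs ! j, xs ! Suc j} \<in> E" "a \<in> set xs" "b \<in> set xs"
  shows "near E (length xs) a b"
proof -
  have *: "near E n (xs ! i) (xs ! (i + n))" if "i + n < length xs" for i n
    using that
  proof (induction n)
    case (Suc n)
    then show ?case using assms(1)[of "i + n"] by (auto intro!: near_SucI)
  qed simp
  have **: "near E (length xs) (xs ! i) (xs ! j)" if "i \<le> j" "j < length xs" for i j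
    using *[of i "j - i"] that near_mono[of E "j - i" _ _ "length xs"] by simp
  obtain i j where "a = xs ! i" "b = xs ! j" "i < length xs" "j < length xs"
    using assms(2,3) by (metis in_set_conv_nth)
  then show ?thesis using **[of i j] **[of j i] near_sym by (cases "i \<le> j") auto
qed

section \<open>Walks in the nested rings\<close>

lemma nested_edge_cases:
  assumes "t \<ge> 5" "e \<in> edges (nested_rings t m)"
  shows "(\<exists>l\<le>m. e \<in> edges (ring_cycle t l)) \<or>
    (\<exists>l<m. \<exists>c. e = {ring_vertex t l c, ring_vertex t (Suc l) (c * int (t - 3))})"
  using assms(2)
proof (induction m)
  case (Suc m)
  then show ?case unfolding edges_nested_rings_Suc[OF assms(1)]
    by (elim UnE rangeE) (use le_SucI less_SucI in \<open>blast+\<close>)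
qed simp

text \<open>Projecting ring \<open>l\<close> outwards to ring \<open>m\<close> multiplies positions
  by \<open>(t - 3) ^ (m - l)\<close>, and the ring length grows by the same factor.\<close>

lemma ring_len_scale:
  assumes "l \<le> m" "int (ring_len t l) dvd z"
  shows "int (ring_len t m) dvd z * int (t - 3) ^ (m - l)"
proof -
  have "ring_len t m = ring_len t l * (t - 3) ^ (m - l)"
    using assms(1) by (simp add: ring_len_def flip: power_add)
  then show ?thesis using assms(2) by (simp add: mult_dvd_mono)
qed

text \<open>The invariant follows the outward projection of the current vertex to ring
  \<open>m\<close>: \<open>z\<close> is its displacement from \<open>a\<close>, up to full turns.
  Spokes do not change it, and a step on ring \<open>l\<close> changes it by
  \<open>(t - 3) ^ (m - l)\<close>, where \<open>m - l <= n\<close>.\<close>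

lemma nested_walk:
  assumes t: "t \<ge> 5" and "near (edges (nested_rings t m)) n (ring_vertex t m a) v"
  shows "\<exists>l b z. v = ring_vertex t l b \<and> l \<le> m \<and> m \<le> l + n \<and> \<bar>z\<bar> \<le> int n * int (t - 3) ^ n \<and>
    int (ring_len t m) dvd b * int (t - 3) ^ (m - l) - a - z"
  using assms(2)
proof (induction n arbitrary: v)
  case 0
  then show ?case by (intro exI[of _ m] exI[of _ a] exI[of _ 0]) auto
next
  case (Suc n)
  let ?r = "int (t - 3)" and ?N = "\<lambda>l. int (ring_len t l)"
  obtain w where w: "near (edges (nested_rings t m)) n (ring_vertex t m a) w"
    "w = v \<or> {w, v} \<in> edges (nested_rings t m)" using Suc.prems by (rule near_SucE)
  obtain l b z where lbz: "w = ring_vertex t l b" "l \<le> m" "m \<le> l + n" "\<bar>z\<bar> \<le> int n * ?r ^ n"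
    "?N m dvd b * ?r ^ (m - l) - a - z" using Suc.IH[OF w(1)] by blast
  have r: "?r \<ge> 1" using t by simp
  \<comment> \<open>The allowance has to increase by at least \<open>?r ^ n\<close>, the largest
    displacement one further step can cause.\<close>
  have grow: "int n * ?r ^ n + ?r ^ n \<le> int (Suc n) * ?r ^ Suc n"
  proof -
    have "?r ^ n \<le> ?r ^ Suc n" using r by (intro power_increasing) auto
    then have "int (Suc n) * ?r ^ n \<le> int (Suc n) * ?r ^ Suc n" by (intro mult_left_mono) auto
    then show ?thesis by (simp add: algebra_simps)
  qed
  have pos: "?r ^ n \<ge> 1" using r by simp
  have bound: "\<bar>z\<bar> \<le> int (Suc n) * ?r ^ Suc n" using lbz(4) grow pos by linarith
  consider "w = v" | l' where "l' \<le> m" "{w, v} \<in> edges (ring_cycle t l')"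
    | l' c where "l' < m" "{w, v} = {ring_vertex t l' c, ring_vertex t (Suc l') (c * ?r)}"
    using w(2) nested_edge_cases[OF t] by blast
  then show ?case
  proof cases
    case 1
    then show ?thesis using lbz bound by (intro exI[of _ l] exI[of _ b] exI[of _ z]) auto
  next
    case (2 l')
    then have "w \<in> range (ring_vertex t l')" "v \<in> range (ring_vertex t l')"
      unfolding edges_ring_cycle[OF t] by (auto simp: doubleton_eq_iff)
    then obtain b' where b': "v = ring_vertex t l b'" and l': "l' = l"
      using lbz(1) by (metis fst_ring_vertex imageE)
    then have "?N l dvd b' - b - 1 \<or> ?N l dvd b - b' - 1"
      using 2(2) lbz(1) ring_edge_iff[OF t] by metis
    then have "\<exists>s. \<bar>s\<bar> = 1 \<and> ?N l dvd b' - b - s"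
    proof
      assume "?N l dvd b - b' - 1"
      then have "?N l dvd - (b - b' - 1)" by (simp only: dvd_minus_iff)
      then show ?thesis by (intro exI[of _ "- 1"]) (simp add: algebra_simps)
    qed (auto intro!: exI[of _ 1])
    then obtain s where s: "\<bar>s\<bar> = 1" "?N l dvd b' - b - s" by blast
    have "?N m dvd (b' - b - s) * ?r ^ (m - l) + (b * ?r ^ (m - l) - a - z)"
      using ring_len_scale[OF lbz(2) s(2)] lbz(5) by (rule dvd_add)
    then have "?N m dvd b' * ?r ^ (m - l) - a - (z + s * ?r ^ (m - l))" by (simp add: algebra_simps)
    moreover have "\<bar>z + s * ?r ^ (m - l)\<bar> \<le> int (Suc n) * ?r ^ Suc n"
    proof -
      have "\<bar>s * ?r ^ (m - l)\<bar> = ?r ^ (m - l)" using s r by (simp add: abs_mult)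
      also have "\<dots> \<le> ?r ^ n" using r lbz(3) by (intro power_increasing) auto
      finally show ?thesis using lbz(4) grow by linarith
    qed
    ultimately show ?thesis using b' lbz by (intro exI[of _ l] exI[of _ b'] exI[of _ "z + s * ?r ^ (m - l)"]) auto
  next
    \<comment> \<open>Both ends of a spoke project to the same outer position, so \<open>z\<close>
      is kept and only the level changes.\<close>
    case (3 l' c)
    then consider "w = ring_vertex t l' c" "v = ring_vertex t (Suc l') (c * ?r)"
      | "v = ring_vertex t l' c" "w = ring_vertex t (Suc l') (c * ?r)"
      by (auto simp: doubleton_eq_iff)
    then show ?thesis
    proof cases
      case 1
      then have l: "l' = l" using lbz(1) by (metis fst_ring_vertex)
      then have "?N l dvd c - b" using 1 lbz(1) ring_vertex_eq_iff[OF t, of l c b] by simp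
      then have "?N m dvd (c - b) * ?r ^ (m - l) + (b * ?r ^ (m - l) - a - z)"
        using ring_len_scale[OF lbz(2)] lbz(5) by (intro dvd_add)
      moreover have "m - l = Suc (m - Suc l)" using 3 l by simp
      then have "?r ^ (m - l) = ?r * ?r ^ (m - Suc l)" by simp
      ultimately have "?N m dvd c * ?r * ?r ^ (m - Suc l) - a - z" by (simp add: algebra_simps)
      then show ?thesis using 1 3 l bound lbz(3)
        by (intro exI[of _ "Suc l"] exI[of _ "c * ?r"] exI[of _ z]) auto
    next
      case 2
      then have l: "l = Suc l'" using lbz(1) by (metis fst_ring_vertex)
      then have "?N l dvd c * ?r - b" using 2 lbz(1) ring_vertex_eq_iff[OF t, of l "c * ?r" b] by simp
      then have "?N m dvd (c * ?r - b) * ?r ^ (m - l) + (b * ?r ^ (m - l) - a - z)"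
        using ring_len_scale[OF lbz(2)] lbz(5) by (intro dvd_add)
      moreover have "m - l' = Suc (m - l)" using 3 l by simp
      then have "?r ^ (m - l') = ?r * ?r ^ (m - l)" by simp
      ultimately have "?N m dvd c * ?r ^ (m - l') - a - z" by (simp add: algebra_simps)
      then show ?thesis using 2 3 l bound lbz(3)
        by (intro exI[of _ l'] exI[of _ c] exI[of _ z]) auto
    qed
  qed
qed

lemma near_ring:
  assumes t: "t \<ge> 5"
  shows "near (edges (ring_cycle t m)) (nat \<bar>z\<bar>) (ring_vertex t m a) (ring_vertex t m (a + z))"
proof -
  have *: "near (edges (ring_cycle t m)) n (ring_vertex t m a) (ring_vertex t m (a + int n))" for n a
  proof (induction n)
    case (Suc n)
    have "{ring_vertex t m (a + int n), ring_vertex t m (a + int n + 1)} \<in> edges (ring_cycle t m)"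
      unfolding edges_ring_cycle[OF t] by blast
    then show ?case using Suc near_SucI by (fastforce simp: algebra_simps)
  qed simp
  show ?thesis
  proof (cases "z \<ge> 0")
    case True
    then show ?thesis using *[of "nat z" a] by simp
  next
    case False
    then show ?thesis using near_sym[OF *[of "nat (- z)" "a + z"]] by simp
  qed
qed

text \<open>A walk that ends on the outer ring has \<open>l = m\<close> in
  \<open>nested_walk\<close>, so its end is the start shifted along the ring by
  \<open>z\<close>.\<close>

lemma nested_rings_distance:
  assumes t: "t \<ge> 5" and "u \<in> verts (ring_cycle t m)" "v \<in> verts (ring_cycle t m)"
    and "near (edges (nested_rings t m)) n u v"
  shows "near (edges (ring_cycle t m)) (n * (t - 3) ^ n) u v"
proof -
  obtain a where a: "u = ring_vertex t m a" using assms(2) verts_ring_cycle'[OF t] by blast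
  obtain l b z where z: "v = ring_vertex t l b" "\<bar>z\<bar> \<le> int n * int (t - 3) ^ n"
    "int (ring_len t m) dvd b * int (t - 3) ^ (m - l) - a - z"
    using nested_walk[OF t] assms(4) a by blast
  have "fst v = m" using assms(3) by (auto simp: verts_ring_cycle)
  then have "l = m" using z(1) by simp
  then have "v = ring_vertex t m (a + z)"
    using z(1,3) by (simp add: ring_vertex_eq_iff[OF t] algebra_simps)
  then have "near (edges (ring_cycle t m)) (nat \<bar>z\<bar>) u v" using near_ring[OF t] a by simp
  then show ?thesis by (rule near_mono) (use z(2) in \<open>simp add: nat_le_iff\<close>)
qed

section \<open>Contracting an expansion to the old territory\<close>

context expansion_data
begin

text \<open>Contracts all vertices added at \<open>x i\<close> to \<open>x i\<close>; the choice is
  unambiguous because the added lists are disjoint. Every edge of \<open>T\<close> becomes an edge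
  of \<open>T'\<close> or a point.\<close>

definition proj :: "'a \<Rightarrow> 'a" where
  "proj v = (if v \<in> verts T' then v
     else x (SOME i. i < k \<and> v \<in> set (P i @ (if i \<in> I then Q i else []))))"

lemma proj_new:
  assumes "i < k" "v \<in> set (P i @ (if i \<in> I then Q i else []))"
  shows "proj v = x i"
proof -
  have "v \<notin> verts T'" using assms newP newQ by (auto split: if_splits)
  moreover have "(SOME i. i < k \<and> v \<in> set (P i @ (if i \<in> I then Q i else []))) = i"
  proof (rule some_equality)
    fix j assume "j < k \<and> v \<in> set (P j @ (if j \<in> I then Q j else []))"
    then show "j = i" using distinct_concat_disjoint[OF dist, of i j] assms by blast
  qed (use assms in blast)
  ultimately show ?thesis by (simp add: proj_def)
qed

lemma proj_P: "i < k \<Longrightarrow> j < 2 * t - 5 \<Longrightarrow> proj (P i ! j) = x i"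
  using lenP t5 by (intro proj_new) auto

lemma proj_Q: "i \<in> I \<Longrightarrow> j < t - 3 \<Longrightarrow> proj (Q i ! j) = x i"
  using lenQ t5 Ik by (intro proj_new) auto

lemma proj_old: "v \<in> verts T' \<Longrightarrow> proj v = v"
  by (simp add: proj_def)

lemma proj_adj:
  assumes "adj a b"
  shows "proj a = proj b \<or> {proj a, proj b} \<in> edges T'"
  using assms
proof cases
  case old
  then show ?thesis using T'_edge_old[OF old] by (simp add: proj_old)
qed (use t5 x_nbrs in \<open>auto simp: proj_P proj_Q proj_old Ik\<close>)

lemma near_proj: "near E n a b \<Longrightarrow> near (edges T') n (proj a) (proj b)"
proof (erule near_map)
  fix a b assume "{a, b} \<in> E"
  then have "adj a b \<or> adj b a" by (simp add: E_adj)
  then show "proj a = proj b \<or> {proj a, proj b} \<in> edges T'"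
    using proj_adj[of a b] proj_adj[of b a] by (auto simp: insert_commute)
qed

lemma in_R:
  assumes "i < k"
  shows "xm i \<in> set (R i)" "xp i \<in> set (R i)" "P i ! 0 \<in> set (R i)"
    "set (R i) \<subseteq> {xm i, xp i} \<union> set (P i @ (if i \<in> I then Q i else []))" "length (R i) \<le> 3 * t"
proof -
  show "xm i \<in> set (R i)" "xp i \<in> set (R i)" by (auto simp: expansion_path_def)
  have "R i ! Suc 0 = P i ! 0" "Suc 0 < length (R i)"
    using R_nth_in[of i] R_nth_out[of i] assms t5 by (cases "i \<in> I"; auto)+
  then show "P i ! 0 \<in> set (R i)" by (metis nth_mem)
  show "set (R i) \<subseteq> {xm i, xp i} \<union> set (P i @ (if i \<in> I then Q i else []))"
    by (auto simp: expansion_path_def dest: in_set_takeD in_set_dropD)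
  show "length (R i) \<le> 3 * t" using R_nth_in(1)[of i] R_nth_out(1)[of i] assms by (cases "i \<in> I") auto
qed

lemma verts_B: "verts B = (verts B' - x ` {..<k}) \<union> (\<Union>i<k. set (R i))"
  by (auto simp: B_def graph_Union_def induced_def path_on_def)

lemma edges_B: "\<Union>(edges B) \<subseteq> verts B"
proof -
  have "e \<subseteq> verts B" if "e \<in> edges B" for e
  proof -
    consider "e \<in> edges (induced B' (verts B' - x ` {..<k}))" | i where "i < k" "e \<in> edges (path_on (R i))"
      using \<open>e \<in> edges B\<close> unfolding B_def graph_Union_def by auto
    then show ?thesis
    proof cases
      case 1
      then show ?thesis using verts_B by (auto simp: induced_def)
    next
      case (2 i)
      then have "e \<subseteq> set (R i)" by (auto simp: path_on_def)
      then show ?thesis using 2 verts_B by blast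
    qed
  qed
  then show ?thesis by blast
qed

lemma edges_T: "\<Union>E \<subseteq> verts T"
proof -
  have P: "P i ! j \<in> verts T" if "i < k" "j < 2 * t - 5" for i j
  proof -
    have "P i ! j \<in> set (P i)" using that lenP t5 by auto
    then show ?thesis using that by (auto simp: T_def)
  qed
  have Q: "Q i ! j \<in> verts T" if "i \<in> I" "j < t - 3" for i j
  proof -
    have "Q i ! j \<in> set (Q i)" using that lenQ t5 by auto
    then show ?thesis using that by (auto simp: T_def)
  qed
  have old: "v \<in> verts T" if "v \<in> verts T'" for v using that by (simp add: T_def)
  have "a \<in> verts T \<and> b \<in> verts T" if "adj a b" for a b
    using that
  proof cases
    case old
    then show ?thesis using T'_edge_old \<open>\<And>v. v \<in> verts T' \<Longrightarrow> v \<in> verts T\<close> by blast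
  qed (use P Q old x_nbrs Ik t5 in auto)
  then show ?thesis unfolding E_iff by (auto simp: E_iff)
qed

lemma verts_B_cases:
  assumes "a \<in> verts B"
  obtains "a \<in> verts B' - x ` {..<k}" "proj a = a" | i where "i < k" "proj a = x i" "a \<in> set (R i)"
proof (cases "a \<in> verts B' - x ` {..<k}")
  case True
  then show ?thesis using that(1) B'_sub proj_old by blast
next
  case False
  then obtain i where i: "i < k" "a \<in> set (R i)" using assms verts_B by auto
  moreover have "a \<noteq> xm i" "a \<noteq> xp i" using False x_nbrs[OF i(1)] by auto
  ultimately have "a \<in> set (P i @ (if i \<in> I then Q i else []))" using in_R(4) by blast
  then show ?thesis using that(2)[OF i(1) proj_new[OF i(1)] i(2)] by blast
qed

lemma near_R:
  assumes "i < k" "a \<in> set (R i)" "b \<in> set (R i)"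
  shows "near (edges B) (3 * t) a b"
  using near_mono[OF near_list[OF R_edge[OF assms(1)] assms(2,3)] in_R(5)[OF assms(1)]] .

text \<open>Unless both vertices are old, they lie on a common \<open>R i\<close>: an old neighbour
  of \<open>x i\<close> on \<open>B'\<close> is an end of \<open>R i\<close>, and two different
  \<open>x i\<close> are never adjacent. The bound \<open>3 * t\<close> is the one for the length of
  \<open>R i\<close>.\<close>

lemma lift_edge:
  assumes ab: "a \<in> verts B" "b \<in> verts B" and "proj a = proj b \<or> {proj a, proj b} \<in> edges B'"
  shows "near (edges B) (3 * t) a b"
proof -
  have mixed: "near (edges B) (3 * t) a b"
    if "a \<in> verts B' - x ` {..<k}" "i < k" "b \<in> set (R i)" "a = x i \<or> {a, x i} \<in> edges B'" for a b i
  proof -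
    have "{a, x i} \<in> edges B'" using that by auto
    then have "a \<in> neighbours B' (x i)" using that by (auto simp: neighbours_def)
    then have "a = xm i \<or> a = xp i" using nbrs that by auto
    then show ?thesis using near_R[of i a b] in_R(1,2)[of i] that by auto
  qed
  from ab(1) show ?thesis
  proof (cases rule: verts_B_cases)
    case 1
    from ab(2) show ?thesis
    proof (cases rule: verts_B_cases)
      case 1
      note 2 = \<open>a \<in> verts B' - x ` {..<k}\<close> \<open>proj a = a\<close>
      then have "a = b \<or> {a, b} \<in> edges B'" using 1 2 assms(3) by simp
      then have "a = b \<or> {a, b} \<in> edges B" using outer_edge_in_B[of "{a, b}"] 1 2 by auto
      then have "near (edges B) 1 a b" using near_edge by fastforce
      then show ?thesis using near_mono[of "edges B" 1 a b "3 * t"] t5 by simp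
    next
      case (2 i)
      then show ?thesis using mixed[of a i b] 1 assms(3) by simp
    qed
  next
    case (2 i)
    note a = 2
    from ab(2) show ?thesis
    proof (cases rule: verts_B_cases)
      case 1
      then have "near (edges B) (3 * t) b a" using mixed[of b i a] a assms(3) by (auto simp: insert_commute)
      then show ?thesis by (rule near_sym)
    next
      case (2 j)
      then have "x i = x j" using stable a assms(3) by auto
      then have "i = j" using injx a 2 by (auto dest: inj_onD)
      then show ?thesis using near_R[of i a b] a 2 by simp
    qed
  qed
qed

lemma proj_B: "a \<in> verts B \<Longrightarrow> proj a \<in> verts B'"
  by (erule verts_B_cases) (use x_nbrs in auto)

text \<open>The factor is \<open>n + 1\<close> because even \<open>n = 0\<close> costs
  \<open>3 * t\<close>: vertices with equal projection may be far apart on the same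
  \<open>R i\<close>.\<close>

lemma lift_walk:
  assumes "near (edges B') n (proj a) (proj b)" "a \<in> verts B" "b \<in> verts B"
  shows "near (edges B) ((n + 1) * (3 * t)) a b"
  using assms(1,3)
proof (induction n arbitrary: b)
  case 0
  then show ?case using lift_edge[OF assms(2), of b] by simp
next
  case (Suc n)
  obtain w where w: "near (edges B') n (proj a) w" "w = proj b \<or> {w, proj b} \<in> edges B'"
    using Suc.prems(1) by (rule near_SucE)
  have "w \<in> verts B'" using near_Union[OF w(1)] proj_B[OF assms(2)] B'_verts by auto
  \<comment> \<open>Each intermediate vertex needs a preimage on \<open>B\<close>; a removed
    \<open>x i\<close> is represented by the first vertex of \<open>P i\<close>, which lies on
    \<open>R i\<close>.\<close>
  have "\<exists>c\<in>verts B. proj c = w"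
  proof (cases "w \<in> x ` {..<k}")
    case True
    then obtain i where i: "i < k" "w = x i" by auto
    then show ?thesis using proj_P[of i 0] in_R(3)[of i] t5 verts_B by (intro bexI[of _ "P i ! 0"]) auto
  next
    case False
    then show ?thesis using \<open>w \<in> verts B'\<close> verts_B proj_old B'_sub by (intro bexI[of _ w]) auto
  qed
  then obtain c where c: "c \<in> verts B" "proj c = w" by blast
  have "near (edges B) ((n + 1) * (3 * t)) a c" using Suc.IH c w by simp
  moreover have "near (edges B) (3 * t) c b" using lift_edge c w Suc.prems by simp
  ultimately have "near (edges B) ((n + 1) * (3 * t) + 3 * t) a b" by (rule near_trans)
  then show ?case by (simp add: algebra_simps)
qed

end

text \<open>Two neighbours of the same vertex differ by 2 modulo the ring length, adjacent ones by 1
  up to sign; together the length would divide 1 or 3, but it is at least 5.\<close>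

lemma ring_no_triangle:
  assumes t: "t \<ge> 5" and "p \<noteq> q" "neighbours (ring_cycle t m) c = {p, q}" "c \<in> verts (ring_cycle t m)"
  shows "{p, q} \<notin> edges (nested_rings t m)"
proof
  let ?N = "int (ring_len t m)"
  assume "{p, q} \<in> edges (nested_rings t m)"
  have "p \<in> neighbours (ring_cycle t m) c" "q \<in> neighbours (ring_cycle t m) c" using assms(3) by auto
  then have pq: "p \<in> verts (ring_cycle t m)" "q \<in> verts (ring_cycle t m)"
    "{p, c} \<in> edges (ring_cycle t m)" "{q, c} \<in> edges (ring_cycle t m)" by (auto simp: neighbours_def)
  then have "{p, q} \<in> edges (ring_cycle t m)"
    using nested_outer_edge[OF t \<open>{p, q} \<in> _\<close>] by (auto simp: verts_ring_cycle)
  moreover obtain a b z where v: "p = ring_vertex t m a" "q = ring_vertex t m b" "c = ring_vertex t m z"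
    using pq(1,2) assms(4) unfolding verts_ring_cycle'[OF t] by blast
  ultimately have ab: "?N dvd b - a - 1 \<or> ?N dvd a - b - 1" using ring_edge_iff[OF t] by blast
  have az: "?N dvd z - a - 1 \<or> ?N dvd a - z - 1" and bz: "?N dvd z - b - 1 \<or> ?N dvd b - z - 1"
    using pq(3,4) v ring_edge_iff[OF t] by blast+
  have ne: "\<not> ?N dvd a - b" using assms(2) v ring_vertex_eq_iff[OF t] by blast
  have small: "\<not> ?N dvd 1" "\<not> ?N dvd 3"
    using dvd_small_int[of ?N 1] dvd_small_int[of ?N 3] ring_len_ge[OF t, of m] by auto
  have "?N dvd a - b - 2 \<or> ?N dvd a - b + 2"
    using az bz
  proof (elim disjE)
    assume "?N dvd z - a - 1" "?N dvd z - b - 1"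
    from dvd_diff[OF this(2,1)] ne show ?thesis by simp
  next
    assume "?N dvd a - z - 1" "?N dvd b - z - 1"
    from dvd_diff[OF this] ne show ?thesis by simp
  next
    assume "?N dvd z - a - 1" "?N dvd b - z - 1"
    from dvd_add[OF this] have "?N dvd - (a - b + 2)" by (simp add: algebra_simps)
    then have "?N dvd a - b + 2" by (simp only: dvd_minus_iff)
    then show ?thesis ..
  next
    assume "?N dvd a - z - 1" "?N dvd z - b - 1"
    from dvd_add[OF this] have "?N dvd a - b - 2" by (simp add: algebra_simps)
    then show ?thesis by simp
  qed
  then show False
  proof
    assume *: "?N dvd a - b - 2"
    from ab show False
    proof
      assume "?N dvd b - a - 1"
      from dvd_add[OF this *] have "?N dvd - 3" by simp
      then show False using small by (simp only: dvd_minus_iff)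
    next
      assume "?N dvd a - b - 1"
      from dvd_diff[OF this *] show False using small by simp
    qed
  next
    assume *: "?N dvd a - b + 2"
    from ab show False
    proof
      assume "?N dvd b - a - 1"
      from dvd_add[OF this *] show False using small by simp
    next
      assume "?N dvd a - b - 1"
      from dvd_diff[OF * this] show False using small by simp
    qed
  qed
qed

lemma expansion_rings:
  assumes t: "t \<ge> 5" and "expansion t (nested_rings t m) (ring_cycle t m) T B"
  shows "tiled t T B"
    and "\<And>n a b. a \<in> verts B \<Longrightarrow> b \<in> verts B \<Longrightarrow> near (edges T) n a b \<Longrightarrow>
      near (edges B) ((n * (t - 3) ^ n + 1) * (3 * t)) a b"
    and "\<Union>(edges T) \<subseteq> verts T" and "\<Union>(edges B) \<subseteq> verts B"
proof -
  obtain k x xm xp I P Q where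
    1: "territory (nested_rings t m) (ring_cycle t m)" "inj_on x {..<k}" "x ` {..<k} \<subseteq> verts (ring_cycle t m)"
        "\<forall>i<k. \<forall>j<k. {x i, x j} \<notin> edges (ring_cycle t m)"
        "\<forall>i<k. xm i \<noteq> xp i \<and> neighbours (ring_cycle t m) (x i) = {xm i, xp i}"
        "I \<subseteq> {..<k}"
        "\<forall>i<k. length (P i) = 2 * t - 6 + 1"
        "\<forall>i\<in>I. length (Q i) = t - 4 + 1"
        "distinct (concat (map (\<lambda>i. P i @ (if i \<in> I then Q i else [])) [0..<k]))"
        "\<forall>i<k. set (P i) \<inter> verts (nested_rings t m) = {}"
        "\<forall>i\<in>I. set (Q i) \<inter> verts (nested_rings t m) = {}" and
    TB: "T = Graph
          (verts (nested_rings t m) \<union> (\<Union>i<k. set (P i)) \<union> (\<Union>i\<in>I. set (Q i)))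
          (edges (nested_rings t m) \<union>
           (\<Union>i<k. edges (path_on (P i)) \<union>
              {{xm i, hd (P i)}, {x i, P i ! (t - 3)}, {xp i, last (P i)}}) \<union>
           (\<Union>i\<in>I. edges (path_on (Q i)) \<union>
              {{P i ! (t - 4), hd (Q i)}, {P i ! (t - 2), last (Q i)}}))"
        "B = graph_Union
          (insert (induced (ring_cycle t m) (verts (ring_cycle t m) - x ` {..<k}))
             ((\<lambda>i. path_on (expansion_path t I xm xp P Q i)) ` {..<k}))"
    using assms(2) unfolding expansion_def by blast
  interpret X: expansion_data t "nested_rings t m" "ring_cycle t m" k x xm xp I P Q
  proof
    show "\<forall>i<k. {xm i, xp i} \<notin> edges (nested_rings t m)"
      using ring_no_triangle[OF t, of "xm _" "xp _" m "x _"] 1(3,5) by blast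
  qed (use t 1 in blast)+
  have T: "T = X.T" and B: "B = X.B" using TB by (simp_all only: X.T_def X.B_def)
  show "\<Union>(edges T) \<subseteq> verts T" "\<Union>(edges B) \<subseteq> verts B" unfolding T B
    using X.edges_T X.edges_B by simp_all
  show "tiled t T B" unfolding T B using X.tiled_expansion tiled_nested_rings[OF t] by blast
  fix n a b assume ab: "a \<in> verts B" "b \<in> verts B" "near (edges T) n a b"
  then have "near (edges (nested_rings t m)) n (X.proj a) (X.proj b)" using X.near_proj T by blast
  then have "near (edges (ring_cycle t m)) (n * (t - 3) ^ n) (X.proj a) (X.proj b)"
    using nested_rings_distance[OF t] X.proj_B ab B by blast
  then show "near (edges B) ((n * (t - 3) ^ n + 1) * (3 * t)) a b"
    using X.lift_walk ab B by blast
qed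

lemma canonical_tiled:
  assumes t: "t \<ge> 5" and "canonical t T B"
  shows "tiled t T B"
    and "\<And>n a b. a \<in> verts B \<Longrightarrow> b \<in> verts B \<Longrightarrow> near (edges T) n a b \<Longrightarrow>
      near (edges B) ((n * (t - 3) ^ n + 1) * (3 * t)) a b"
proof -
  obtain m T' B' f where terr: "territory T B" and ex: "expansion t (nested_rings t m) (ring_cycle t m) T' B'"
    and fT: "graph_iso f T T'" and fB: "graph_iso f B B'"
    using assms(2) unfolding canonical_def by blast
  note ex = expansion_rings[OF t ex]
  have bij: "bij_betw f (verts T) (verts T')" "bij_betw f (verts B) (verts B')"
    using fT fB by (auto simp: graph_iso_def)
  have fTe: "{f u, f v} \<in> edges T' \<longleftrightarrow> {u, v} \<in> edges T" if "u \<in> verts T" "v \<in> verts T" for u v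
    using fT that by (auto simp: graph_iso_def)
  have fBe: "{f u, f v} \<in> edges B' \<longleftrightarrow> {u, v} \<in> edges B" if "u \<in> verts B" "v \<in> verts B" for u v
    using fB that by (auto simp: graph_iso_def)
  have simple: "e \<subseteq> verts T \<and> card e = 2" if "e \<in> edges T" for e
    using terr that by (auto simp: territory_def simple_graph_def)
  have sub: "verts B \<subseteq> verts T" using terr by (auto simp: territory_def)
  \<comment> \<open>The same \<open>f\<close> is an isomorphism for \<open>T\<close> and for
    \<open>B\<close>, so this one inverse carries back tiles as well as boundary walks.\<close>
  define h where "h = inv_into (verts T) f"
  have hf: "h (f u) = u" if "u \<in> verts T" for u using bij that by (simp add: h_def bij_betw_def)
  have fh: "f (h v) = v" "h v \<in> verts T" if "v \<in> verts T'" for v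
    using bij that by (auto simp: h_def bij_betw_def f_inv_into_f inv_into_into)
  have hB: "h v \<in> verts B" "f (h v) = v" if v: "v \<in> verts B'" for v
  proof -
    obtain u where "u \<in> verts B" "v = f u" using bij(2) v by (auto simp: bij_betw_def)
    then show "h v \<in> verts B" "f (h v) = v" using hf sub by auto
  qed
  have injh: "inj_on h (verts T')" using fh by (metis inj_onI)
  have hTe: "{h a, h b} \<in> edges T \<longleftrightarrow> {a, b} \<in> edges T'" if "a \<in> verts T'" "b \<in> verts T'" for a b
    using fTe[of "h a" "h b"] fh that by simp
  show "tiled t T B" unfolding tiled_def
  proof
    fix e assume e: "e \<in> edges T"
    then obtain u v where uv: "e = {u, v}" "u \<in> verts T" "v \<in> verts T"
      using simple by (metis card_2_iff insert_subset)
    then have e': "f ` e \<in> edges T'" using fTe[of u v] e by simp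
    have he: "h ` f ` e = e" using uv hf by simp
    consider "theta (edges T') t (f ` e)" | S where "f ` e \<in> edges B'" "induces_cycle (edges T') t S" "f ` e \<subseteq> S"
      using ex(1) e' unfolding tiled_def by blast
    then show "theta (edges T) t e \<or> e \<in> edges B \<and> (\<exists>S. induces_cycle (edges T) t S \<and> e \<subseteq> S)"
    proof cases
      case 1
      have "theta (edges T) t (h ` f ` e)"
        by (rule theta_map[OF 1 _ ex(3) injh hTe]) (use t in auto)
      then show ?thesis using he by simp
    next
      case 2
      have "S \<subseteq> verts T'" using induces_cycle_in_Union[OF 2(2)] ex(3) t by auto
      then have "induces_cycle (edges T) t (h ` S)" using induces_cycle_map[OF 2(2) _ injh hTe] by blast
      moreover have "e \<subseteq> h ` S" using 2(3) he by blast
      moreover have "f ` e \<subseteq> verts B'" using 2(1) ex(4) by blast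
      then have "u \<in> verts B" "v \<in> verts B" using hB(1)[of "f u"] hB(1)[of "f v"] hf uv by auto
      then have "e \<in> edges B" using fBe[of u v] 2(1) uv by simp
      ultimately show ?thesis by blast
    qed
  qed
  fix n a b assume ab: "a \<in> verts B" "b \<in> verts B" "near (edges T) n a b"
  have "near (edges T') n (f a) (f b)"
    by (rule near_map[OF ab(3)]) (use fTe simple in blast)
  moreover have "f a \<in> verts B'" "f b \<in> verts B'" using bij(2) ab by (auto simp: bij_betw_def)
  ultimately have "near (edges B') ((n * (t - 3) ^ n + 1) * (3 * t)) (f a) (f b)" using ex(2) by blast
  moreover have "{h a, h b} \<in> edges B" if "{a, b} \<in> edges B'" for a b
  proof -
    have "a \<in> verts B'" "b \<in> verts B'" using ex(4) that by auto
    then show ?thesis using fBe[of "h a" "h b"] hB[of a] hB[of b] that by simp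
  qed
  ultimately have "near (edges B) ((n * (t - 3) ^ n + 1) * (3 * t)) (h (f a)) (h (f b))"
    using near_map[of "edges B'" _ "f a" "f b" h "edges B"] by blast
  moreover have "h (f a) = a" "h (f b) = b" using hf ab sub by blast+
  ultimately show "near (edges B) ((n * (t - 3) ^ n + 1) * (3 * t)) a b" by (simp only:)
qed

section \<open>Large girth\<close>

text \<open>When the walk returns to a vertex of the path built so far, the path is cut there. The
  length counts vertices, hence \<open>Suc n\<close>.\<close>

lemma near_imp_path:
  assumes "near E n u v"
  obtains xs where "distinct xs" "xs \<noteq> []" "hd xs = u" "last xs = v" "length xs \<le> Suc n"
    "\<And>j. Suc j < length xs \<Longrightarrow> {xs ! j, xs ! Suc j} \<in> E"
proof -
  have "\<exists>xs. distinct xs \<and> xs \<noteq> [] \<and> hd xs = u \<and> last xs = v \<and> length xs \<le> Suc n \<and>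
    (\<forall>j. Suc j < length xs \<longrightarrow> {xs ! j, xs ! Suc j} \<in> E)"
    using assms
  proof (induction n arbitrary: v)
    case 0
    then show ?case by (intro exI[of _ "[u]"]) auto
  next
    case (Suc n)
    obtain w where w: "near E n u w" "w = v \<or> {w, v} \<in> E" using Suc.prems by (rule near_SucE)
    obtain xs where xs: "distinct xs" "xs \<noteq> []" "hd xs = u" "last xs = w" "length xs \<le> Suc n"
      "\<And>j. Suc j < length xs \<Longrightarrow> {xs ! j, xs ! Suc j} \<in> E"
      using Suc.IH[OF w(1)] by blast
    show ?case
    proof (cases "v \<in> set xs")
      case True
      then obtain i where i: "i < length xs" "v = xs ! i" by (metis in_set_conv_nth)
      show ?thesis
      proof (intro exI[of _ "take (Suc i) xs"] conjI allI impI)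
        show "last (take (Suc i) xs) = v" using i by (simp add: take_Suc_conv_app_nth)
        show "hd (take (Suc i) xs) = u" using xs by (cases xs) auto
      qed (use xs i in auto)
    next
      case False
      then have e: "{w, v} \<in> E" using w xs by (metis last_in_set)
      show ?thesis
      proof (intro exI[of _ "xs @ [v]"] conjI allI impI)
        fix j assume j: "Suc j < length (xs @ [v])"
        show "{(xs @ [v]) ! j, (xs @ [v]) ! Suc j} \<in> E"
        proof (cases "Suc j < length xs")
          case True
          then show ?thesis using xs(6)[of j] by (simp add: nth_append)
        next
          case False
          then have jj: "Suc j = length xs" using j by simp
          then have "xs ! j = w" using xs(2,4) by (metis diff_Suc_1 last_conv_nth)
          then show ?thesis using jj e by (simp add: nth_append)
        qed
      qed (use xs False in auto)
    qed
  qed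
  then show ?thesis using that by blast
qed

text \<open>A path from \<open>a\<close> to \<open>b\<close> that avoids the edge closes with it to
  a cycle on at most \<open>n + 1\<close> vertices.\<close>

lemma girth_no_short_detour:
  assumes G: "simple_graph \<Gamma>" and g: "enat g \<le> girth \<Gamma>" and e: "{a, b} \<in> edges \<Gamma>"
    and n: "Suc n < g"
  shows "\<not> near (edges \<Gamma> - {{a, b}}) n a b"
proof
  assume "near (edges \<Gamma> - {{a, b}}) n a b"
  then obtain xs where xs: "distinct xs" "xs \<noteq> []" "hd xs = a" "last xs = b" "length xs \<le> Suc n"
    "\<And>j. Suc j < length xs \<Longrightarrow> {xs ! j, xs ! Suc j} \<in> edges \<Gamma> - {{a, b}}"
    by (rule near_imp_path) blast
  have ab: "a \<noteq> b" using G e by (auto simp: simple_graph_def)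
  have a: "xs ! 0 = a" using xs by (metis hd_conv_nth)
  have b: "xs ! (length xs - 1) = b" using xs by (metis last_conv_nth)
  \<comment> \<open>One vertex would give \<open>a = b\<close>, and two vertices would use the
    deleted edge.\<close>
  have len: "3 \<le> length xs"
  proof (rule ccontr)
    assume "\<not> 3 \<le> length xs"
    moreover have "length xs \<noteq> 0" using xs(2) by simp
    ultimately have "length xs = 1 \<or> length xs = 2" by linarith
    then show False using a b ab xs(6)[of 0] by auto
  qed
  have E: "edges (cycle_on xs) \<subseteq> edges \<Gamma>"
  proof
    fix f assume "f \<in> edges (cycle_on xs)"
    then obtain i where i: "i < length xs" "f = {xs ! i, xs ! (Suc i mod length xs)}"
      by (auto simp: cycle_on_def)
    show "f \<in> edges \<Gamma>"
    proof (cases "Suc i < length xs")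
      case True
      then show ?thesis using i xs(6)[of i] by simp
    next
      case False
      then have "Suc i = length xs" using i by simp
      then show ?thesis using i a b e by (metis diff_Suc_1 insert_commute mod_self)
    qed
  qed
  moreover have "set xs \<subseteq> verts \<Gamma>"
  proof
    fix v assume "v \<in> set xs"
    then obtain i where i: "i < length xs" "v = xs ! i" by (metis in_set_conv_nth)
    then have "{xs ! i, xs ! (Suc i mod length xs)} \<in> edges (cycle_on xs)" by (auto simp: cycle_on_def)
    then have "{xs ! i, xs ! (Suc i mod length xs)} \<subseteq> verts \<Gamma>"
      using E G unfolding simple_graph_def by blast
    then show "v \<in> verts \<Gamma>" using i by simp
  qed
  ultimately have "cycle_on xs \<in> {C. is_cycle C \<and> subgraph C \<Gamma>}"
    using xs len by (auto simp: is_cycle_def subgraph_def cycle_on_def)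
  then have "girth \<Gamma> \<le> enat (card (verts (cycle_on xs)))" unfolding girth_def by (rule INF_lower)
  also have "\<dots> = enat (length xs)" using xs by (simp add: cycle_on_def distinct_card)
  finally have "enat g \<le> enat (length xs)" using g order_trans by blast
  then show False using n xs(5) by simp
qed

text \<open>\<open>H\<close> and \<open>H'\<close> are two cycles of \<open>\<Gamma>\<close> whose common edges form a matching; locally, \<open>\<Gamma>\<close> is a
  tree, so close to a common edge \<open>e\<close> they can meet only in \<open>e\<close>.\<close>

locale locally_tree =
  fixes \<Gamma> :: "'a graph" and N :: nat and H H' :: "'a set set" and e :: "'a set" and u :: 'a
  assumes no_detour: "\<And>a b n. {a, b} \<in> edges \<Gamma> \<Longrightarrow> n \<le> N \<Longrightarrow> \<not> near (edges \<Gamma> - {{a, b}}) n a b"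
    and H: "H \<subseteq> edges \<Gamma>" "H' \<subseteq> edges \<Gamma>"
    and matching: "\<And>f f'. f \<in> H \<inter> H' \<Longrightarrow> f' \<in> H \<inter> H' \<Longrightarrow> f \<inter> f' \<noteq> {} \<Longrightarrow> f = f'"
    and e: "e \<in> H \<inter> H'" "u \<in> e"
begin

text \<open>Take a path in \<open>H\<close> from \<open>u\<close> to \<open>w\<close>. If all its
  edges are in \<open>H'\<close> as well, the matching condition leaves a single edge at
  \<open>u\<close>, which is \<open>e\<close>. Otherwise some edge of it is not in
  \<open>H'\<close>, and the rest of the path with the walk in \<open>H'\<close> is a short detour
  around that edge.\<close>

lemma meet_in_edge:
  assumes "near H n u w" "near H' n u w" "2 * n + 1 \<le> N"
  shows "w \<in> e"
proof (rule ccontr)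
  assume w: "w \<notin> e"
  obtain xs where xs: "distinct xs" "xs \<noteq> []" "hd xs = u" "last xs = w" "length xs \<le> Suc n"
    "\<And>j. Suc j < length xs \<Longrightarrow> {xs ! j, xs ! Suc j} \<in> H"
    using assms(1) by (rule near_imp_path) blast
  have u: "xs ! 0 = u" using xs by (metis hd_conv_nth)
  have wl: "xs ! (length xs - 1) = w" using xs by (metis last_conv_nth)
  have "u \<noteq> w" using w e by auto
  then have "length xs \<noteq> 1" using u wl by auto
  moreover have "length xs \<noteq> 0" using xs(2) by simp
  ultimately have len: "2 \<le> length xs" by linarith
  show False
  proof (cases "\<forall>j. Suc j < length xs \<longrightarrow> {xs ! j, xs ! Suc j} \<in> H'")
    case True
    then have *: "{xs ! j, xs ! Suc j} \<in> H \<inter> H'" if "Suc j < length xs" for j using xs(6) that by blast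
    show False
    proof (cases "length xs = 2")
      case True
      then have "{u, w} \<in> H \<inter> H'" using *[of 0] u wl by simp
      then have "{u, w} = e" using matching e by blast
      then show False using w by auto
    next
      case False
      then have l3: "3 \<le> length xs" using len by simp
      then have "{xs ! 0, xs ! 1} = {xs ! 1, xs ! 2}"
        using *[of 0] *[of 1] matching[of "{xs ! 0, xs ! 1}" "{xs ! 1, xs ! 2}"] by (simp add: numeral_2_eq_2)
      then have "xs ! 0 = xs ! 2" by (auto simp: doubleton_eq_iff)
      moreover have "0 < length xs" "2 < length xs" using l3 by auto
      ultimately show False using nth_eq_iff_index_eq[OF xs(1)] by (metis zero_neq_numeral)
    qed
  next
    case False
    then obtain j where j: "Suc j < length xs" "{xs ! j, xs ! Suc j} \<notin> H'" by blast
    let ?f = "{xs ! j, xs ! Suc j}" and ?E = "edges \<Gamma> - {{xs ! j, xs ! Suc j}}"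
    \<comment> \<open>Here a path rather than a walk is essential: with distinct vertices the
      omitted edge is used only once.\<close>
    have other: "{xs ! i, xs ! Suc i} \<in> ?E" if "Suc i < length xs" "i \<noteq> j" for i
    proof -
      have "{xs ! i, xs ! Suc i} \<noteq> ?f"
        using xs(1) that j(1) by (auto simp: doubleton_eq_iff nth_eq_iff_index_eq)
      then show ?thesis using xs(6)[OF that(1)] H by auto
    qed
    have "near ?E (length (take (Suc j) xs)) (xs ! j) u"
    proof (rule near_list)
      have *: "take (Suc j) xs ! i \<in> set (take (Suc j) xs)" if "i \<le> j" for i
        using j that by (intro nth_mem) simp
      show "xs ! j \<in> set (take (Suc j) xs)" "u \<in> set (take (Suc j) xs)" using *[of j] *[of 0] u by simp_all
      fix i assume "Suc i < length (take (Suc j) xs)"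
      then show "{take (Suc j) xs ! i, take (Suc j) xs ! Suc i} \<in> ?E" using other[of i] by auto
    qed
    moreover have "H' \<subseteq> ?E" using H j by auto
    then have "near ?E n u w" by (rule near_subset[OF assms(2)])
    moreover have "near ?E (length (drop (Suc j) xs)) w (xs ! Suc j)"
    proof (rule near_list)
      show "xs ! Suc j \<in> set (drop (Suc j) xs)" using j by (simp flip: Cons_nth_drop_Suc)
      have "last (drop (Suc j) xs) = w" "drop (Suc j) xs \<noteq> []" using j xs(4) by (simp_all add: last_drop)
      then show "w \<in> set (drop (Suc j) xs)" using last_in_set by metis
      fix i assume "Suc i < length (drop (Suc j) xs)"
      then show "{drop (Suc j) xs ! i, drop (Suc j) xs ! Suc i} \<in> ?E" using other[of "Suc j + i"] by auto
    qed
    ultimately have "near ?E (length (take (Suc j) xs) + n + length (drop (Suc j) xs)) (xs ! j) (xs ! Suc j)"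
      by (intro near_trans)
    \<comment> \<open>The two pieces together have at most \<open>n + 1\<close> vertices and the
      walk in \<open>H'\<close> adds \<open>n\<close>, which is the origin of
      \<open>2 * n + 1\<close>.\<close>
    moreover have "length (take (Suc j) xs) + n + length (drop (Suc j) xs) \<le> N" using assms(3) xs(5) j by simp
    moreover have "?f \<in> edges \<Gamma>" using xs(6)[OF j(1)] H by auto
    ultimately show False using no_detour by blast
  qed
qed

text \<open>If the edge is in \<open>H\<close> or \<open>H'\<close>, it prolongs one walk and
  \<open>meet_in_edge\<close> for \<open>n + 1\<close> applies, whence \<open>2 * n + 3\<close>.
  Otherwise the two walks through \<open>u\<close> form a detour around it.\<close>

lemma no_cross_edge:
  assumes "near H n u a" "near H' n u b" "{a, b} \<in> edges \<Gamma>" "a \<notin> e" "b \<notin> e" "2 * n + 3 \<le> N"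
  shows False
proof -
  consider "{a, b} \<in> H" | "{a, b} \<in> H'" | "{a, b} \<notin> H" "{a, b} \<notin> H'" by blast
  then show False
  proof cases
    case 1
    then have "near H (Suc n) u b" using near_SucI[OF assms(1)] by blast
    then show False using meet_in_edge[of "Suc n" b] near_mono[OF assms(2), of "Suc n"] assms(5,6) by simp
  next
    case 2
    then have "near H' (Suc n) u a" using near_SucI[OF assms(2)] by (simp add: insert_commute)
    then show False using meet_in_edge[of "Suc n" a] near_mono[OF assms(1), of "Suc n"] assms(4,6) by simp
  next
    case 3
    then have "H \<subseteq> edges \<Gamma> - {{a, b}}" "H' \<subseteq> edges \<Gamma> - {{a, b}}" using H by auto
    then have "near (edges \<Gamma> - {{a, b}}) (n + n) a b"
      using near_trans[OF near_sym[OF near_subset[OF assms(1)]] near_subset[OF assms(2)]] by blast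
    then show False using no_detour[OF assms(3), of "n + n"] assms(6) by simp
  qed
qed

end

section \<open>Matchings and the cycles left by removing one\<close>

lemma cycle_family_edges:
  assumes "K \<in> cycle_family \<Gamma> M"
  shows "edges K \<subseteq> edges \<Gamma> - M" "verts K \<subseteq> verts \<Gamma>"
  using assms by (auto simp: cycle_family_def components_def induced_def)

lemma cycle_family_closed:
  assumes "simple_graph \<Gamma>" "K \<in> cycle_family \<Gamma> M" "f \<in> edges \<Gamma> - M" "v \<in> f" "v \<in> verts K"
  shows "f \<in> edges K"
proof -
  let ?G = "Graph (verts \<Gamma>) (edges \<Gamma> - M)"
  obtain r where r: "K = induced ?G {u. reachable ?G r u}"
    using assms(2) by (auto simp: cycle_family_def components_def)
  obtain w where w: "f = {v, w}" using assms(1,3,4)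
    by (metis DiffD1 card_2_iff insert_commute insert_iff simple_graph_def singletonD)
  have "reachable ?G r v" using assms(5) r by (auto simp: induced_def)
  moreover have "{v, w} \<in> edges ?G" using assms(3) w by simp
  ultimately have "reachable ?G r w" unfolding reachable_def by (rule rtranclp.rtrancl_into_rtrancl)
  then show ?thesis using assms(3) w r \<open>reachable ?G r v\<close> by (simp add: induced_def)
qed

lemma cycle_family_cover:
  assumes "simple_graph \<Gamma>" "f \<in> edges \<Gamma> - M"
  obtains K where "K \<in> cycle_family \<Gamma> M" "f \<in> edges K" "f \<subseteq> verts K"
proof -
  let ?G = "Graph (verts \<Gamma>) (edges \<Gamma> - M)"
  obtain v w where f: "f = {v, w}" "v \<in> verts \<Gamma>" "w \<in> verts \<Gamma>"
    using assms unfolding simple_graph_def by (metis DiffD1 card_2_iff insert_subset)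
  let ?K = "induced ?G {u. reachable ?G v u}"
  have K: "?K \<in> cycle_family \<Gamma> M" using f by (auto simp: cycle_family_def components_def)
  moreover have v: "reachable ?G v v" by (simp add: reachable_def)
  moreover have "{v, w} \<in> edges ?G" using assms(2) f by simp
  then have "reachable ?G v w" unfolding reachable_def by (rule r_into_rtranclp)
  ultimately show ?thesis using that[OF K] f assms(2) by (simp add: induced_def)
qed

text \<open>At each vertex the two given matchings use two different ones of the three neighbours,
  leaving exactly one.\<close>

lemma third_matching:
  assumes G: "simple_graph \<Gamma>" "regular 3 \<Gamma>" and M: "perfect_matching M\<^sub>1 \<Gamma>" "perfect_matching M\<^sub>2 \<Gamma>" "M\<^sub>1 \<inter> M\<^sub>2 = {}"
  shows "perfect_matching (edges \<Gamma> - (M\<^sub>1 \<union> M\<^sub>2)) \<Gamma>"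
  unfolding perfect_matching_def
proof (intro conjI ballI)
  fix v assume v: "v \<in> verts \<Gamma>"
  have form: "\<exists>w. f = {w, v} \<and> w \<in> neighbours \<Gamma> v" if f: "f \<in> edges \<Gamma>" "v \<in> f" for f
  proof -
    have "card f = 2" "f \<subseteq> verts \<Gamma>" using G f by (auto simp: simple_graph_def)
    then obtain w where "f = {w, v}" using f(2) by (metis card_2_iff insert_commute insert_iff singletonD)
    then show ?thesis using f \<open>f \<subseteq> verts \<Gamma>\<close> by (auto simp: neighbours_def)
  qed
  have one: "\<exists>w \<in> neighbours \<Gamma> v. \<forall>x. {x, v} \<in> M \<longleftrightarrow> x = w" if "perfect_matching M \<Gamma>" for M
  proof -
    have "M \<subseteq> edges \<Gamma>" and "\<exists>!f. f \<in> M \<and> v \<in> f" using that v by (auto simp: perfect_matching_def)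
    then obtain f where f: "f \<in> M" "v \<in> f" "\<And>f'. f' \<in> M \<Longrightarrow> v \<in> f' \<Longrightarrow> f' = f" by blast
    then obtain w where w: "f = {w, v}" "w \<in> neighbours \<Gamma> v" using form \<open>M \<subseteq> edges \<Gamma>\<close> by blast
    have "{x, v} \<in> M \<longleftrightarrow> x = w" for x using f(1) f(3)[of "{x, v}"] w by (auto simp: doubleton_eq_iff)
    then show ?thesis using w by blast
  qed
  obtain a b where a: "a \<in> neighbours \<Gamma> v" "\<And>x. {x, v} \<in> M\<^sub>1 \<longleftrightarrow> x = a"
    and b: "b \<in> neighbours \<Gamma> v" "\<And>x. {x, v} \<in> M\<^sub>2 \<longleftrightarrow> x = b" using one[OF M(1)] one[OF M(2)] by blast
  have "a \<noteq> b" using a(2)[of a] b(2)[of a] M(3) by blast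
  moreover have c3: "card (neighbours \<Gamma> v) = 3" using G v by (auto simp: regular_def)
  ultimately have "card (neighbours \<Gamma> v - {a, b}) = 1" using a(1) b(1) by (subst card_Diff_subset) auto
  then obtain c where c: "neighbours \<Gamma> v - {a, b} = {c}" by (auto simp: card_1_singleton_iff)
  have nb: "{x, v} \<in> edges \<Gamma> \<longleftrightarrow> x \<in> neighbours \<Gamma> v" for x
    using G by (auto simp: neighbours_def simple_graph_def)
  show "\<exists>!f. f \<in> edges \<Gamma> - (M\<^sub>1 \<union> M\<^sub>2) \<and> v \<in> f"
  proof (intro ex1I conjI)
    have "c \<in> neighbours \<Gamma> v" "c \<noteq> a" "c \<noteq> b" using c by auto
    then show "{c, v} \<in> edges \<Gamma> - (M\<^sub>1 \<union> M\<^sub>2)" using nb a b by auto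
    fix f assume f: "f \<in> edges \<Gamma> - (M\<^sub>1 \<union> M\<^sub>2) \<and> v \<in> f"
    then obtain w where "f = {w, v}" "w \<in> neighbours \<Gamma> v" using form by blast
    then have "w \<in> neighbours \<Gamma> v - {a, b}" using f a b by auto
    then show "f = {c, v}" using c \<open>f = {w, v}\<close> by auto
  qed simp
qed auto

lemma perfect_matching_disjoint:
  assumes "simple_graph \<Gamma>" "perfect_matching M \<Gamma>" "f \<in> M" "f' \<in> M" "f \<inter> f' \<noteq> {}"
  shows "f = f'"
proof -
  obtain v where v: "v \<in> f" "v \<in> f'" using assms by auto
  have "f \<subseteq> verts \<Gamma>" using assms by (auto simp: simple_graph_def perfect_matching_def)
  then have "\<exists>!e. e \<in> M \<and> v \<in> e" using assms(2) v unfolding perfect_matching_def by blast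
  then show ?thesis using assms v by blast
qed

text \<open>The left side is \<open>2 * radius + 5\<close>: detours of length up to
  \<open>2 * radius + 3\<close> occur in \<open>no_cross_edge\<close>, and
  \<open>girth_no_short_detour\<close> needs \<open>Suc n\<close> strictly below the girth bound.
  The estimate is \<open>18 * t^2 * p + 5 <= 25 * t^2 * p <= t^4 * p\<close> with
  \<open>p = t ^ (2 * t)\<close>, using \<open>t >= 5\<close>.\<close>

lemma distance_bound:
  assumes "t \<ge> (5::nat)"
  shows "2 * ((2 * t * (t - 3) ^ (2 * t) + 1) * (3 * t)) + 5 \<le> t ^ (5 * t)"
proof -
  let ?p = "t ^ (2 * t)"
  have p: "?p \<ge> 1" using assms by simp
  have "(t - 3) ^ (2 * t) \<le> ?p" by (intro power_mono) auto
  then have "2 * t * (t - 3) ^ (2 * t) \<le> 2 * t * ?p" by (rule mult_le_mono2)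
  moreover have "1 \<le> t * ?p" using assms p by simp
  ultimately have "2 * t * (t - 3) ^ (2 * t) + 1 \<le> 3 * t * ?p" by linarith
  then have "(2 * t * (t - 3) ^ (2 * t) + 1) * (3 * t) \<le> 3 * t * ?p * (3 * t)" by (rule mult_le_mono1)
  also have "\<dots> = 9 * (t ^ 2 * ?p)" by (simp add: power2_eq_square)
  finally have 1: "2 * ((2 * t * (t - 3) ^ (2 * t) + 1) * (3 * t)) + 5 \<le> 18 * (t ^ 2 * ?p) + 5" by simp
  have "1 \<le> t ^ 2 * ?p" using assms p by simp
  then have 2: "18 * (t ^ 2 * ?p) + 5 \<le> 25 * (t ^ 2 * ?p)" by linarith
  have "25 * (t ^ 2 * ?p) \<le> t ^ 2 * (t ^ 2 * ?p)"
    using power_mono[of 5 t 2] assms by (intro mult_le_mono1) simp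
  also have "\<dots> = t ^ (2 + (2 + 2 * t))" by (simp only: power_add)
  also have "\<dots> \<le> t ^ (5 * t)" using assms by (intro power_increasing) auto
  finally show ?thesis using 1 2 by linarith
qed

section \<open>The constructed graph\<close>

lemma induces_cycle_near:
  assumes "induces_cycle E n S" "a \<in> S" "b \<in> S"
  shows "near E n a b"
proof -
  obtain c where c: "icycle E n c" "S = c ` {..<n}" using assms(1) by (auto simp: induces_cycle_def)
  let ?xs = "map c [0..<n]"
  have "near E (length ?xs) a b"
  proof (rule near_list)
    show "a \<in> set ?xs" "b \<in> set ?xs" using assms c by auto
    show "{?xs ! j, ?xs ! Suc j} \<in> E" if "Suc j < length ?xs" for j
      using c(1) that by (auto simp: icycle_def)
  qed
  then show ?thesis by simp
qed

text \<open>The three matchings enter symmetrically, so that one lemma, applied to each choice of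
  the matching containing the edge, covers all of \<open>\<Gamma>\<close>.\<close>

locale construction =
  fixes t :: nat and \<Gamma> :: "'a graph" and M\<^sub>1 M\<^sub>2 M\<^sub>3 :: "'a set set" and \<K> :: "'a graph set"
    and T :: "'a graph \<Rightarrow> 'a graph" and G :: "'a graph"
  assumes t5: "t \<ge> 5"
    and \<Gamma>: "simple_graph \<Gamma>" and girth: "enat (t ^ (5 * t)) \<le> girth \<Gamma>"
    and M: "perfect_matching M\<^sub>1 \<Gamma>" "perfect_matching M\<^sub>2 \<Gamma>" "perfect_matching M\<^sub>3 \<Gamma>"
    and part: "M\<^sub>1 \<union> M\<^sub>2 \<union> M\<^sub>3 = edges \<Gamma>" "M\<^sub>1 \<inter> M\<^sub>2 = {}" "M\<^sub>1 \<inter> M\<^sub>3 = {}" "M\<^sub>2 \<inter> M\<^sub>3 = {}"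
    and \<K>: "\<K> = cycle_family \<Gamma> M\<^sub>1 \<union> cycle_family \<Gamma> M\<^sub>2 \<union> cycle_family \<Gamma> M\<^sub>3"
    and canon: "\<And>K. K \<in> \<K> \<Longrightarrow> canonical t (T K) K"
    and T\<Gamma>: "\<And>K. K \<in> \<K> \<Longrightarrow> verts (T K) \<inter> verts \<Gamma> = verts K"
    and TT: "\<And>K K'. K \<in> \<K> \<Longrightarrow> K' \<in> \<K> \<Longrightarrow> K \<noteq> K' \<Longrightarrow> verts (T K) \<inter> verts (T K') = verts K \<inter> verts K'"
    and G: "G = graph_Union (insert \<Gamma> (T ` \<K>))"
begin

text \<open>The boundary distance given by \<open>canonical_tiled\<close> for walks of length
  \<open>2 * t\<close>, enough to join any two vertices of two tiles with a common vertex.\<close>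

definition radius :: nat where "radius = (2 * t * (t - 3) ^ (2 * t) + 1) * (3 * t)"

lemma no_detour:
  assumes "{a, b} \<in> edges \<Gamma>" "n \<le> 2 * radius + 3"
  shows "\<not> near (edges \<Gamma> - {{a, b}}) n a b"
  using girth_no_short_detour[OF \<Gamma> girth assms(1)] assms(2) distance_bound[OF t5] by (simp add: radius_def)

lemma edges_G: "f \<in> edges G \<longleftrightarrow> f \<in> edges \<Gamma> \<or> (\<exists>K\<in>\<K>. f \<in> edges (T K))"
  by (auto simp: G graph_Union_def)

lemma K_edges: "K \<in> \<K> \<Longrightarrow> edges K \<subseteq> edges \<Gamma>"
  using cycle_family_edges unfolding \<K> by blast

lemma terr: "K \<in> \<K> \<Longrightarrow> territory (T K) K"
  using canon by (auto simp: canonical_def)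

lemma T_simple: "K \<in> \<K> \<Longrightarrow> simple_graph (T K)"
  using terr by (auto simp: territory_def)

lemma T_edge_verts: "K \<in> \<K> \<Longrightarrow> {a, b} \<in> edges (T K) \<Longrightarrow> a \<in> verts (T K) \<and> b \<in> verts (T K)"
  using T_simple unfolding simple_graph_def by blast

lemma K_edge_iff: "K \<in> \<K> \<Longrightarrow> f \<in> edges K \<longleftrightarrow> f \<in> edges (T K) \<and> f \<subseteq> verts K"
  using terr[of K] unfolding territory_def induced_def by (metis (mono_tags, lifting) graph.sel(2) mem_Collect_eq)

lemma simple_G: "simple_graph G"
proof -
  have "finite (verts \<Gamma>)" using \<Gamma> by (auto simp: simple_graph_def)
  then have "finite \<K>" by (simp add: \<K> cycle_family_def components_def)
  then have "finite (verts G)" using \<Gamma> T_simple by (auto simp: simple_graph_def G graph_Union_def)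
  moreover have "f \<subseteq> verts G \<and> card f = 2" if f: "f \<in> edges G" for f
  proof -
    obtain H where H: "H \<in> insert \<Gamma> (T ` \<K>)" "f \<in> edges H" using f by (auto simp: edges_G)
    then have "simple_graph H" using \<Gamma> T_simple by auto
    then have "f \<subseteq> verts H \<and> card f = 2" using H by (simp add: simple_graph_def)
    then show ?thesis using H(1) unfolding G graph_Union_def graph.sel by blast
  qed
  ultimately show ?thesis by (simp add: simple_graph_def)
qed

lemma boundary_near:
  assumes "K \<in> \<K>" "a \<in> verts K" "b \<in> verts K" "near (edges (T K)) n a b" "n \<le> 2 * t"
  shows "near (edges K) radius a b"
  using canonical_tiled(2)[OF t5 canon[OF assms(1)] assms(2,3) near_mono[OF assms(4,5)]]
  by (simp add: radius_def)

text \<open>A third territory meets the other two only in vertices of its own cycle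
  \<open>K''\<close>, and \<open>K''\<close> is induced in it.\<close>

lemma edge_other:
  assumes "K \<in> \<K>" "K' \<in> \<K>" "K'' \<in> \<K>" "K'' \<noteq> K" "K'' \<noteq> K'" "a \<in> verts (T K)" "b \<in> verts (T K')"
    "{a, b} \<in> edges (T K'')"
  shows "{a, b} \<in> edges \<Gamma>"
proof -
  have "a \<in> verts (T K'')" "b \<in> verts (T K'')" using T_edge_verts assms by blast+
  then have "a \<in> verts K''" "b \<in> verts K''" using TT[of K K''] TT[of K' K''] assms by blast+
  then have "{a, b} \<in> edges K''" using K_edge_iff assms by auto
  then show ?thesis using K_edges assms by blast
qed

text \<open>An extra edge would be an edge of \<open>\<Gamma>\<close> with both ends on
  \<open>K\<close> and not in \<open>K\<close>; since the ends are close along \<open>K\<close>, the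
  cycle \<open>K\<close> itself provides a forbidden short detour.\<close>

lemma edge_in_T:
  assumes K: "K \<in> \<K>" and ab: "a \<in> verts (T K)" "b \<in> verts (T K)" "near (edges (T K)) n a b" "n \<le> 2 * t"
  shows "{a, b} \<in> edges G \<longleftrightarrow> {a, b} \<in> edges (T K)"
proof
  assume "{a, b} \<in> edges G"
  then consider "{a, b} \<in> edges (T K)" | "{a, b} \<in> edges \<Gamma>"
    using edge_other[OF K K] ab unfolding edges_G by blast
  then show "{a, b} \<in> edges (T K)"
  proof cases
    case 2
    then have "a \<in> verts \<Gamma>" "b \<in> verts \<Gamma>" using \<Gamma> by (auto simp: simple_graph_def)
    then have abK: "a \<in> verts K" "b \<in> verts K" using T\<Gamma>[OF K] ab by auto
    have near: "near (edges K) radius a b" using boundary_near[OF K abK ab(3,4)] .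
    have "{a, b} \<in> edges K"
    proof (rule ccontr)
      assume "{a, b} \<notin> edges K"
      then have "edges K \<subseteq> edges \<Gamma> - {{a, b}}" using K_edges[OF K] by auto
      from near_subset[OF near this] show False using no_detour[OF 2, of radius] by simp
    qed
    then show ?thesis using K_edge_iff[OF K] by blast
  qed
qed (use K edges_G in blast)

lemma face_G:
  assumes K: "K \<in> \<K>" and S: "induces_cycle (edges (T K)) t S"
  shows "induces_cycle (edges G) t S" "S \<subseteq> verts (T K)"
proof -
  show SV: "S \<subseteq> verts (T K)"
    using induces_cycle_in_Union[OF S] T_simple[OF K] t5 by (fastforce simp: simple_graph_def)
  show "induces_cycle (edges G) t S"
  proof (rule induces_cycle_cong[OF S])
    fix a b assume "a \<in> S" "b \<in> S"
    then show "{a, b} \<in> edges G \<longleftrightarrow> {a, b} \<in> edges (T K)"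
      using edge_in_T[OF K, of a b t] induces_cycle_near[OF S] SV by auto
  qed
qed

lemma theta_inner:
  assumes K: "K \<in> \<K>" and e: "e \<in> edges (T K)" and th: "theta (edges (T K)) t e"
  shows "theta (edges G) t e"
proof -
  obtain S S' where S: "induces_cycle (edges (T K)) t S" "induces_cycle (edges (T K)) t S'" "S \<inter> S' = e"
    and cross: "\<And>a b. a \<in> S - e \<Longrightarrow> b \<in> S' - e \<Longrightarrow> {a, b} \<notin> edges (T K)"
    using th unfolding theta_def by blast
  have "card e = 2" using T_simple[OF K] e by (auto simp: simple_graph_def)
  then obtain u where u: "u \<in> e" by (metis card_2_iff insertI1)
  show ?thesis
  proof (rule thetaI[OF face_G(1)[OF K S(1)] face_G(1)[OF K S(2)] S(3)])
    fix a b assume ab: "a \<in> S - e" "b \<in> S' - e"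
    \<comment> \<open>The walk goes through the common vertex \<open>u\<close>; its length
      \<open>2 * t\<close> is just what \<open>edge_in_T\<close> permits.\<close>
    have "near (edges (T K)) (t + t) a b"
      using near_trans[OF induces_cycle_near[OF S(1), of a u] induces_cycle_near[OF S(2), of u b]] ab u S(3) by blast
    then show "{a, b} \<notin> edges G"
      using edge_in_T[OF K, of a b "t + t"] cross[OF ab] face_G(2)[OF K] S ab by auto
  qed
qed

text \<open>With \<open>e\<close> in \<open>C\<close>, the components of \<open>\<Gamma>\<close>
  minus \<open>A\<close> and of \<open>\<Gamma>\<close> minus \<open>B\<close> that contain
  \<open>e\<close> bound the two discs at \<open>e\<close>. They share only edges of the matching
  \<open>C\<close>, as \<open>locally_tree\<close> requires.\<close>

lemma theta_outer:
  assumes A: "perfect_matching A \<Gamma>" "cycle_family \<Gamma> A \<subseteq> \<K>" and B: "perfect_matching B \<Gamma>" "cycle_family \<Gamma> B \<subseteq> \<K>"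
    and C: "perfect_matching C \<Gamma>" "A \<inter> B = {}" "A \<inter> C = {}" "B \<inter> C = {}" "A \<union> B \<union> C = edges \<Gamma>"
    and e: "e \<in> C"
  shows "theta (edges G) t e"
proof -
  have e\<Gamma>: "e \<in> edges \<Gamma> - A" "e \<in> edges \<Gamma> - B" using e C by auto
  obtain K where K: "K \<in> cycle_family \<Gamma> A" "e \<in> edges K" "e \<subseteq> verts K" using cycle_family_cover[OF \<Gamma> e\<Gamma>(1)] .
  obtain K' where K': "K' \<in> cycle_family \<Gamma> B" "e \<in> edges K'" "e \<subseteq> verts K'" using cycle_family_cover[OF \<Gamma> e\<Gamma>(2)] .
  have KK: "K \<in> \<K>" "K' \<in> \<K>" using K K' A B by auto
  have "card e = 2" "e \<subseteq> verts \<Gamma>" using \<Gamma> e\<Gamma> by (auto simp: simple_graph_def)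
  then obtain u where u: "u \<in> e" "u \<in> verts \<Gamma>" by (metis card_2_iff insertI1 subsetD)
  have "K \<noteq> K'"
  proof -
    \<comment> \<open>The edge of \<open>B\<close> at \<open>u\<close> lies on \<open>K\<close> but
      cannot lie on \<open>K'\<close>.\<close>
    obtain f where f: "f \<in> B" "u \<in> f" using B(1) u(2) unfolding perfect_matching_def by blast
    then have "f \<in> edges \<Gamma> - A" using C by auto
    then have "f \<in> edges K" using cycle_family_closed[OF \<Gamma> K(1)] f u K(3) by blast
    moreover have "f \<notin> edges K'" using cycle_family_edges(1)[OF K'(1)] f by blast
    ultimately show ?thesis by blast
  qed
  interpret tree: locally_tree \<Gamma> "2 * radius + 3" "edges K" "edges K'" e u
  proof
    show "edges K \<subseteq> edges \<Gamma>" "edges K' \<subseteq> edges \<Gamma>" using K_edges KK by auto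
    have "edges K \<inter> edges K' \<subseteq> C" using cycle_family_edges(1)[OF K(1)] cycle_family_edges(1)[OF K'(1)] C by blast
    then show "f = f'" if "f \<in> edges K \<inter> edges K'" "f' \<in> edges K \<inter> edges K'" "f \<inter> f' \<noteq> {}" for f f'
      using perfect_matching_disjoint[OF \<Gamma> C(1), of f f'] that by blast
  qed (use K K' u no_detour in auto)
  have uK: "u \<in> verts K" "u \<in> verts K'" using u K K' by auto
  obtain S where S: "induces_cycle (edges (T K)) t S" "e \<subseteq> S"
    using tiled_face[OF canonical_tiled(1)[OF t5 canon[OF KK(1)]]] K(2) K_edge_iff[OF KK(1)] by blast
  obtain S' where S': "induces_cycle (edges (T K')) t S'" "e \<subseteq> S'"
    using tiled_face[OF canonical_tiled(1)[OF t5 canon[OF KK(2)]]] K'(2) K_edge_iff[OF KK(2)] by blast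
  note SG = face_G[OF KK(1) S(1)] and SG' = face_G[OF KK(2) S'(1)]
  have nS: "near (edges (T K)) t u a" if "a \<in> S" for a using induces_cycle_near[OF S(1)] S(2) u that by blast
  have nS': "near (edges (T K')) t u a" if "a \<in> S'" for a using induces_cycle_near[OF S'(1)] S'(2) u that by blast
  \<comment> \<open>The bound \<open>t + 1\<close> instead of \<open>t\<close> leaves room for one
    edge from a tile into the other territory, used in the first two cases below.\<close>
  have meet: "w \<in> e" if "w \<in> verts K" "w \<in> verts K'" "near (edges (T K)) (t + 1) u w" "near (edges (T K')) (t + 1) u w" for w
    using tree.meet_in_edge[of radius w] boundary_near[OF KK(1) uK(1) that(1,3)]
      boundary_near[OF KK(2) uK(2) that(2,4)] t5 by simp
  show ?thesis
  proof (rule thetaI[OF SG(1) SG'(1)])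
    have "w \<in> e" if "w \<in> S" "w \<in> S'" for w
    proof -
      have "w \<in> verts K \<inter> verts K'" using TT[OF KK \<open>K \<noteq> K'\<close>] SG(2) SG'(2) that by blast
      then show ?thesis using meet near_mono[OF nS[OF that(1)], of "t + 1"] near_mono[OF nS'[OF that(2)], of "t + 1"] by simp
    qed
    then show "S \<inter> S' = e" using S(2) S'(2) by blast
    fix a b assume a: "a \<in> S - e" and b: "b \<in> S' - e"
    have aT: "a \<in> verts (T K)" and bT: "b \<in> verts (T K')" using a b SG(2) SG'(2) by auto
    have na: "near (edges (T K)) t u a" "near (edges (T K)) (t + 1) u a"
      and nb: "near (edges (T K')) t u b" "near (edges (T K')) (t + 1) u b"
      using nS[of a] nS'[of b] a b near_mono by (metis DiffD1 le_add1)+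
    show "{a, b} \<notin> edges G"
    proof
      assume "{a, b} \<in> edges G"
      then consider "{a, b} \<in> edges (T K)" | "{a, b} \<in> edges (T K')" | "{a, b} \<in> edges \<Gamma>"
        using edge_other[OF KK _ _ _ aT bT] unfolding edges_G by blast
      then show False
      proof cases
        case 1
        then have "b \<in> verts (T K)" using T_edge_verts[OF KK(1)] by blast
        then have "b \<in> verts K \<inter> verts K'" using TT[OF KK \<open>K \<noteq> K'\<close>] bT by blast
        moreover have "near (edges (T K)) (t + 1) u b" using near_SucI[OF na(1)] 1 by simp
        ultimately show False using meet nb(2) b by blast
      next
        case 2
        then have "a \<in> verts (T K')" using T_edge_verts[OF KK(2)] by blast
        then have "a \<in> verts K \<inter> verts K'" using TT[OF KK \<open>K \<noteq> K'\<close>] aT by blast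
        moreover have "near (edges (T K')) (t + 1) u a" using near_SucI[OF nb(1)] 2 by (simp add: insert_commute)
        ultimately show False using meet na(2) a by blast
      next
        case 3
        then have "a \<in> verts \<Gamma>" "b \<in> verts \<Gamma>" using \<Gamma> by (auto simp: simple_graph_def)
        then have "a \<in> verts K" "b \<in> verts K'" using T\<Gamma>[OF KK(1)] T\<Gamma>[OF KK(2)] aT bT by auto
        then have "near (edges K) radius u a" "near (edges K') radius u b"
          using boundary_near[OF KK(1) uK(1) _ na(1)] boundary_near[OF KK(2) uK(2) _ nb(1)] by auto
        then show False using tree.no_cross_edge[of radius a b] 3 a b by blast
      qed
    qed
  qed
qed

lemma theta_G:
  assumes "e \<in> edges G"
  shows "theta (edges G) t e"
proof (cases "e \<in> edges \<Gamma>")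
  case True
  then consider "e \<in> M\<^sub>1" | "e \<in> M\<^sub>2" | "e \<in> M\<^sub>3" using part by blast
  then show ?thesis
  proof cases
    case 1
    show ?thesis by (rule theta_outer[of M\<^sub>2 M\<^sub>3 M\<^sub>1]) (use M part \<K> 1 in auto)
  next
    case 2
    show ?thesis by (rule theta_outer[of M\<^sub>1 M\<^sub>3 M\<^sub>2]) (use M part \<K> 2 in auto)
  next
    case 3
    show ?thesis by (rule theta_outer[of M\<^sub>1 M\<^sub>2 M\<^sub>3]) (use M part \<K> 3 in auto)
  qed
next
  case False
  then obtain K where K: "K \<in> \<K>" "e \<in> edges (T K)" using assms edges_G by blast
  \<comment> \<open>Off \<open>\<Gamma>\<close> the boundary alternative of \<open>tiled\<close> is
    impossible, so both tiles lie in one territory.\<close>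
  moreover have "e \<notin> edges K" using K_edges K False by blast
  ultimately have "theta (edges (T K)) t e"
    using canonical_tiled(1)[OF t5 canon[OF K(1)]] unfolding tiled_def by blast
  then show ?thesis by (rule theta_inner[OF K])
qed

end

theorem theorem4p5:
  fixes t :: nat and G :: "'a graph" and e :: "'a set"
  assumes "t \<ge> 5"
    and "constructed_graph t G"
    and "e \<in> edges G"
  shows "has_induced_copy (delete_edge G e) (cycle_graph (2 * t - 2))"
proof -
  obtain \<Gamma> \<Omega> M\<^sub>1 M\<^sub>2 M\<^sub>3 \<K> T where
    1: "simple_graph \<Gamma>" "regular 3 \<Gamma>" "enat (t ^ (5 * t)) \<le> girth \<Gamma>" "hamiltonian_cycle \<Omega> \<Gamma>"
      "M\<^sub>1 \<union> M\<^sub>2 = edges \<Omega>" "M\<^sub>1 \<inter> M\<^sub>2 = {}" "perfect_matching M\<^sub>1 \<Gamma>" "perfect_matching M\<^sub>2 \<Gamma>"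
      "M\<^sub>3 = edges \<Gamma> - edges \<Omega>"
      "\<K> = cycle_family \<Gamma> M\<^sub>1 \<union> cycle_family \<Gamma> M\<^sub>2 \<union> cycle_family \<Gamma> M\<^sub>3"
      "\<forall>K\<in>\<K>. canonical t (T K) K \<and> verts (T K) \<inter> verts \<Gamma> = verts K"
      "\<forall>K\<in>\<K>. \<forall>K'\<in>\<K>. K \<noteq> K' \<longrightarrow> verts (T K) \<inter> verts (T K') = verts K \<inter> verts K'"
      "G = graph_Union (insert \<Gamma> (T ` \<K>))"
    using assms(2) unfolding constructed_graph_def by blast
  have M3: "M\<^sub>3 = edges \<Gamma> - (M\<^sub>1 \<union> M\<^sub>2)" using 1(5,9) by simp
  have "M\<^sub>1 \<union> M\<^sub>2 \<subseteq> edges \<Gamma>" using 1(7,8) by (auto simp: perfect_matching_def)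
  interpret construction t \<Gamma> M\<^sub>1 M\<^sub>2 M\<^sub>3 \<K> T G
  proof
    show "perfect_matching M\<^sub>3 \<Gamma>" unfolding M3 using third_matching 1 by blast
    show "M\<^sub>1 \<union> M\<^sub>2 \<union> M\<^sub>3 = edges \<Gamma>" "M\<^sub>1 \<inter> M\<^sub>3 = {}" "M\<^sub>2 \<inter> M\<^sub>3 = {}"
      using M3 \<open>M\<^sub>1 \<union> M\<^sub>2 \<subseteq> edges \<Gamma>\<close> by auto
  qed (use assms 1 in simp_all)
  show ?thesis
    using theta_imp_induced_copy[OF simple_G assms(3)] theta_G[OF assms(3)] assms(1) by simp
qed

end
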